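(* Let $\Gamma$ be a metrized graph. Let $\mathrm{Meas}(\Gamma)$ be the space of bounded complex Borel measures on $\Gamma$ and $\mathrm{Meas}_0(\Gamma)$ the subspace of measures $\nu$ with $\nu(\Gamma)=0$. For a real-valued signed Borel measure $\mu$ with $\mu(\Gamma)=1$ and $|\mu|(\Gamma)<\infty$, and $\nu,\omega\in\mathrm{Meas}(\Gamma)$, put $\langle\nu,\omega\rangle_\mu=\iint_{\Gamma\times\Gamma}g_\mu(x,y)\,d\nu(x)\,\overline{d\omega(y)}$. For $\nu,\omega\in\mathrm{Meas}_0(\Gamma)$ this value is independent of $\mu$ and is denoted $\langle\nu,\omega\rangle$ (the energy pairing). (A) The energy pairing $\langle\nu,\omega\rangle$ is positive definite on $\mathrm{Meas}_0(\Gamma)$. (B) For each such $\mu$, the $\mu$-energy pairing $\langle\nu,\omega\rangle_\mu$ is positive semi-definite on $\mathrm{Meas}(\Gamma)$, with kernel $\mathbb{C}\mu$. (C) For each such $\mu$, among all $\nu\in\mathrm{Meas}(\Gamma)$ with $\nu(\Gamma)=1$, $\mu$ is the unique measure which minimizes the energy integral $I_\mu(\nu)=\iint_{\Gamma\times\Gamma}g_\mu(x,y)\,d\nu(x)\,\overline{d\nu(y)}$.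
   Context: A metrized graph $\Gamma$ is a compact connected metric space such that for each $p\in\Gamma$ there are a radius $r_p>0$ and an integer $n_p\ge 1$ such that $p$ has a neighborhood isometric to the star $\{te^{2\pi i k/n_p}\in\mathbb{C}: 0\le t<r_p,\ k\in\mathbb{Z}\}$ with the path metric. $\mathrm{Vec}(p)$ is the set of $n_p$ formal unit vectors at $p$ (one for each ray of the star); $p+t\vec v$ is the point at distance $t$ from $p$ in direction $\vec v$ (small $t\ge0$), and $d_{\vec v}f(p)=\lim_{t\to0^+}(f(p+t\vec v)-f(p))/t$. Kernel $g_\mu$: $\mathrm{CPA}(\Gamma)$ is the space of continuous piecewise affine functions $f:\Gamma\to\mathbb{C}$; for such $f$, $\Delta f=-\sum_{p}\big(\sum_{\vec v\in\mathrm{Vec}(p)}d_{\vec v}f(p)\big)\delta_p$. For $\zeta,y\in\Gamma$, $x\mapsto j_\zeta(x,y)$ is the unique function in $\mathrm{CPA}(\Gamma)$ with $\Delta_x j_\zeta(x,y)=\delta_y-\delta_\zeta$ and $j_\zeta(\zeta,y)=0$; $j_\zeta(x,y)$ is jointly continuous in $(\zeta,x,y)$ and symmetric in $x,y$. Put $j_\mu(x,y)=\int_\Gamma j_\zeta(x,y)\,d\mu(\zeta)$; the number $c_\mu=\int_\Gamma j_\mu(x,y)\,d\mu(x)$ does not depend on $y$, and $g_\mu(x,y)=j_\mu(x,y)-c_\mu$. A bounded measure $\nu$ is one with $|\nu|(\Gamma)<\infty$. *)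

theory Defs
  imports "HOL-Analysis.Analysis"
begin

section \<open>Metrized graphs\<close>

definition star_set :: "nat \<Rightarrow> real \<Rightarrow> complex set" where
  "star_set n r =
     {of_real t * cis (2 * pi * of_int k / of_nat n) | (t::real) (k::int). 0 \<le> t \<and> t < r}"

text \<open>The path metric of a star: two points on a common ray (that is, with the same sign) are
  joined by the straight segment, any other two by the path through the centre.\<close>

definition star_dist :: "complex \<Rightarrow> complex \<Rightarrow> real" where
  "star_dist z w = (if sgn z = sgn w then cmod (z - w) else cmod z + cmod w)"

text \<open>An isometry of the star with \<open>n\<close> rays onto a neighbourhood of \<open>p\<close> in \<open>\<Gamma>\<close>, sending the
  centre of the star to \<open>p\<close>; this is what makes \<open>n\<close> an invariant of \<open>p\<close>.\<close>

definition star_chart ::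
  "'a::metric_space set \<Rightarrow> 'a \<Rightarrow> nat \<Rightarrow> real \<Rightarrow> (complex \<Rightarrow> 'a) \<Rightarrow> bool" where
  "star_chart \<Gamma> p n r \<phi> \<longleftrightarrow>
     n \<ge> 1 \<and> r > 0 \<and> \<phi> 0 = p \<and> \<phi> ` star_set n r \<subseteq> \<Gamma> \<and>
     (\<forall>z\<in>star_set n r. \<forall>w\<in>star_set n r. dist (\<phi> z) (\<phi> w) = star_dist z w) \<and>
     (\<exists>U. openin (top_of_set \<Gamma>) U \<and> p \<in> U \<and> U \<subseteq> \<phi> ` star_set n r)"

definition metrized_graph :: "'a::metric_space set \<Rightarrow> bool" where
  "metrized_graph \<Gamma> \<longleftrightarrow>
     \<Gamma> \<noteq> {} \<and> compact \<Gamma> \<and> connected \<Gamma> \<and> (\<forall>p\<in>\<Gamma>. \<exists>n r \<phi>. star_chart \<Gamma> p n r \<phi>)"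

text \<open>The formal unit vectors at \<open>p\<close> are the indices \<open>k < n\<close> of the rays of some fixed star
  chart at \<open>p\<close>. Another choice of chart only permutes the rays and changes the range of
  parameters \<open>t\<close>, so it does not affect sums over \<open>Vec \<Gamma> p\<close> of directional derivatives.\<close>

definition chosen_chart :: "'a::metric_space set \<Rightarrow> 'a \<Rightarrow> nat \<times> real \<times> (complex \<Rightarrow> 'a)" where
  "chosen_chart \<Gamma> p = (SOME (n, r, \<phi>). star_chart \<Gamma> p n r \<phi>)"

definition valence :: "'a::metric_space set \<Rightarrow> 'a \<Rightarrow> nat" where
  "valence \<Gamma> p = fst (chosen_chart \<Gamma> p)"

definition Vec :: "'a::metric_space set \<Rightarrow> 'a \<Rightarrow> nat set" where
  "Vec \<Gamma> p = {..<valence \<Gamma> p}"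

text \<open>\<open>translate \<Gamma> p v t\<close> is the point \<open>p + t v\<close>, meaningful for small \<open>t \<ge> 0\<close>.\<close>

definition translate :: "'a::metric_space set \<Rightarrow> 'a \<Rightarrow> nat \<Rightarrow> real \<Rightarrow> 'a" where
  "translate \<Gamma> p v t =
     snd (snd (chosen_chart \<Gamma> p)) (of_real t * cis (2 * pi * of_nat v / of_nat (valence \<Gamma> p)))"

definition dir_deriv :: "'a::metric_space set \<Rightarrow> ('a \<Rightarrow> complex) \<Rightarrow> 'a \<Rightarrow> nat \<Rightarrow> complex" where
  "dir_deriv \<Gamma> f p v = Lim (at_right 0) (\<lambda>t. (f (translate \<Gamma> p v t) - f p) / of_real t)"


section \<open>Complex measures\<close>

text \<open>The library has only \<open>ennreal\<close>-valued measures. A bounded complex measure on the measurable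
  space \<open>M\<close> is a countably additive set function on \<open>sets M\<close> of finite total variation; as for
  \<^const>\<open>emeasure\<close>, it takes the value \<open>0\<close> on non-measurable sets, so that equality of
  measures is equality of functions.\<close>

definition total_variation :: "'a measure \<Rightarrow> ('a set \<Rightarrow> complex) \<Rightarrow> 'a set \<Rightarrow> ennreal" where
  "total_variation M \<nu> E =
     (SUP P\<in>{P. finite P \<and> P \<subseteq> sets M \<and> disjoint P \<and> \<Union>P = E}. \<Sum>A\<in>P. ennreal (cmod (\<nu> A)))"

definition bounded_complex_measure :: "'a measure \<Rightarrow> ('a set \<Rightarrow> complex) \<Rightarrow> bool" where
  "bounded_complex_measure M \<nu> \<longleftrightarrow>
     (\<forall>E. E \<notin> sets M \<longrightarrow> \<nu> E = 0) \<and> \<nu> {} = 0 \<and>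
     (\<forall>A::nat \<Rightarrow> 'a set. range A \<subseteq> sets M \<longrightarrow> disjoint_family A \<longrightarrow>
        (\<lambda>i. \<nu> (A i)) sums \<nu> (\<Union>i. A i)) \<and>
     total_variation M \<nu> (space M) < \<infinity>"

text \<open>The positive part \<open>\<rho>\<^sup>+(E) = sup {\<rho>(A). A \<subseteq> E}\<close> in the Jordan decomposition
  \<open>\<rho> = \<rho>\<^sup>+ - (-\<rho>)\<^sup>+\<close> of a real signed measure.\<close>

definition upper_variation :: "'a measure \<Rightarrow> ('a set \<Rightarrow> real) \<Rightarrow> 'a measure" where
  "upper_variation M \<rho> =
     measure_of (space M) (sets M) (\<lambda>E. SUP A\<in>{A\<in>sets M. A \<subseteq> E}. ennreal (\<rho> A))"

definition signed_integral ::
  "'a measure \<Rightarrow> ('a set \<Rightarrow> real) \<Rightarrow> ('a \<Rightarrow> complex) \<Rightarrow> complex" where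
  "signed_integral M \<rho> f =
     (LINT x|upper_variation M \<rho>. f x) - (LINT x|upper_variation M (\<lambda>E. - \<rho> E). f x)"

definition complex_integral ::
  "'a measure \<Rightarrow> ('a set \<Rightarrow> complex) \<Rightarrow> ('a \<Rightarrow> complex) \<Rightarrow> complex" where
  "complex_integral M \<nu> f =
     signed_integral M (\<lambda>E. Re (\<nu> E)) f + \<i> * signed_integral M (\<lambda>E. Im (\<nu> E)) f"


section \<open>Measures on a metrized graph\<close>

abbreviation borel_on :: "'a::metric_space set \<Rightarrow> 'a measure" where
  "borel_on \<Gamma> \<equiv> restrict_space borel \<Gamma>"

definition Meas :: "'a::metric_space set \<Rightarrow> ('a set \<Rightarrow> complex) set" where
  "Meas \<Gamma> = {\<nu>. bounded_complex_measure (borel_on \<Gamma>) \<nu>}"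

definition Meas0 :: "'a::metric_space set \<Rightarrow> ('a set \<Rightarrow> complex) set" where
  "Meas0 \<Gamma> = {\<nu> \<in> Meas \<Gamma>. \<nu> \<Gamma> = 0}"

definition Meas1 :: "'a::metric_space set \<Rightarrow> ('a set \<Rightarrow> complex) set" where
  "Meas1 \<Gamma> = {\<nu> \<in> Meas \<Gamma>. \<nu> \<Gamma> = 1}"

definition signed_Meas1 :: "'a::metric_space set \<Rightarrow> ('a set \<Rightarrow> complex) set" where
  "signed_Meas1 \<Gamma> = {\<mu> \<in> Meas1 \<Gamma>. \<forall>E. \<mu> E \<in> \<real>}"

definition dirac :: "'a::metric_space set \<Rightarrow> 'a \<Rightarrow> 'a set \<Rightarrow> complex" where
  "dirac \<Gamma> p E = (if E \<in> sets (borel_on \<Gamma>) \<and> p \<in> E then 1 else 0)"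


section \<open>Piecewise affine functions and the Laplacian\<close>

text \<open>A continuous function is piecewise affine if \<open>\<Gamma>\<close> is a finite union of segments (isometric
  images \<open>c ` {0..L}\<close> of compact intervals), on each of which it is affine in the length
  parameter. Functions on \<open>\<Gamma>\<close> are taken to be \<^const>\<open>extensional\<close>, so that a function
  determined by its values on \<open>\<Gamma>\<close> is unique.\<close>

definition CPA :: "'a::metric_space set \<Rightarrow> ('a \<Rightarrow> complex) set" where
  "CPA \<Gamma> = {f \<in> extensional \<Gamma>. continuous_on \<Gamma> f \<and>
     (\<exists>S :: ((real \<Rightarrow> 'a) \<times> real) set. finite S \<and> \<Gamma> = (\<Union>(c, L)\<in>S. c ` {0..L}) \<and>
        (\<forall>(c, L)\<in>S.
           (\<forall>s\<in>{0..L}. \<forall>t\<in>{0..L}. dist (c s) (c t) = \<bar>s - t\<bar>) \<and>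
           (\<exists>a b. \<forall>t\<in>{0..L}. f (c t) = a + of_real t * b)))}"

definition slope_sum :: "'a::metric_space set \<Rightarrow> ('a \<Rightarrow> complex) \<Rightarrow> 'a \<Rightarrow> complex" where
  "slope_sum \<Gamma> f p = (\<Sum>v\<in>Vec \<Gamma> p. dir_deriv \<Gamma> f p v)"

text \<open>For \<open>f \<in> CPA \<Gamma>\<close> only finitely many points contribute to the sum.\<close>

definition laplacian :: "'a::metric_space set \<Rightarrow> ('a \<Rightarrow> complex) \<Rightarrow> 'a set \<Rightarrow> complex" where
  "laplacian \<Gamma> f E = - (\<Sum>p\<in>{p\<in>\<Gamma>. slope_sum \<Gamma> f p \<noteq> 0}. slope_sum \<Gamma> f p * dirac \<Gamma> p E)"


section \<open>The kernels and the energy pairings\<close>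

definition j_kernel :: "'a::metric_space set \<Rightarrow> 'a \<Rightarrow> 'a \<Rightarrow> 'a \<Rightarrow> complex" where
  "j_kernel \<Gamma> \<zeta> x y =
     (THE f. f \<in> CPA \<Gamma> \<and> laplacian \<Gamma> f = (\<lambda>E. dirac \<Gamma> y E - dirac \<Gamma> \<zeta> E) \<and> f \<zeta> = 0) x"

definition j_mu :: "'a::metric_space set \<Rightarrow> ('a set \<Rightarrow> complex) \<Rightarrow> 'a \<Rightarrow> 'a \<Rightarrow> complex" where
  "j_mu \<Gamma> \<mu> x y = complex_integral (borel_on \<Gamma>) \<mu> (\<lambda>\<zeta>. j_kernel \<Gamma> \<zeta> x y)"

definition c_mu :: "'a::metric_space set \<Rightarrow> ('a set \<Rightarrow> complex) \<Rightarrow> complex" where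
  "c_mu \<Gamma> \<mu> = (THE c. \<forall>y\<in>\<Gamma>. complex_integral (borel_on \<Gamma>) \<mu> (\<lambda>x. j_mu \<Gamma> \<mu> x y) = c)"

definition g_mu :: "'a::metric_space set \<Rightarrow> ('a set \<Rightarrow> complex) \<Rightarrow> 'a \<Rightarrow> 'a \<Rightarrow> complex" where
  "g_mu \<Gamma> \<mu> x y = j_mu \<Gamma> \<mu> x y - c_mu \<Gamma> \<mu>"

text \<open>Integrating against \<open>d\<omega>\<close> with a bar over it means integrating against the complex measure
  \<open>E \<mapsto> cnj (\<omega> E)\<close>. The double integral is written as an iterated one.\<close>

definition mu_energy_pairing ::
  "'a::metric_space set \<Rightarrow> ('a set \<Rightarrow> complex) \<Rightarrow> ('a set \<Rightarrow> complex) \<Rightarrow> ('a set \<Rightarrow> complex) \<Rightarrow> complex"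
where
  "mu_energy_pairing \<Gamma> \<mu> \<nu> \<omega> =
     complex_integral (borel_on \<Gamma>) (\<lambda>E. cnj (\<omega> E))
       (\<lambda>y. complex_integral (borel_on \<Gamma>) \<nu> (\<lambda>x. g_mu \<Gamma> \<mu> x y))"

definition energy_pairing ::
  "'a::metric_space set \<Rightarrow> ('a set \<Rightarrow> complex) \<Rightarrow> ('a set \<Rightarrow> complex) \<Rightarrow> complex" where
  "energy_pairing \<Gamma> \<nu> \<omega> = (THE e. \<forall>\<mu>\<in>signed_Meas1 \<Gamma>. mu_energy_pairing \<Gamma> \<mu> \<nu> \<omega> = e)"

definition energy_integral ::
  "'a::metric_space set \<Rightarrow> ('a set \<Rightarrow> complex) \<Rightarrow> ('a set \<Rightarrow> complex) \<Rightarrow> complex" where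
  "energy_integral \<Gamma> \<mu> \<nu> = mu_energy_pairing \<Gamma> \<mu> \<nu> \<nu>"

definition positive_semidefinite_on ::
  "('b \<Rightarrow> complex) set \<Rightarrow> (('b \<Rightarrow> complex) \<Rightarrow> ('b \<Rightarrow> complex) \<Rightarrow> complex) \<Rightarrow> bool" where
  "positive_semidefinite_on V B \<longleftrightarrow> (\<forall>\<nu>\<in>V. B \<nu> \<nu> \<in> \<real> \<and> 0 \<le> Re (B \<nu> \<nu>))"

definition positive_definite_on ::
  "('b \<Rightarrow> complex) set \<Rightarrow> (('b \<Rightarrow> complex) \<Rightarrow> ('b \<Rightarrow> complex) \<Rightarrow> complex) \<Rightarrow> bool" where
  "positive_definite_on V B \<longleftrightarrow>
     positive_semidefinite_on V B \<and> (\<forall>\<nu>\<in>V. B \<nu> \<nu> = 0 \<longleftrightarrow> \<nu> = (\<lambda>_. 0))"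

definition pairing_kernel ::
  "('b \<Rightarrow> complex) set \<Rightarrow> (('b \<Rightarrow> complex) \<Rightarrow> ('b \<Rightarrow> complex) \<Rightarrow> complex) \<Rightarrow> ('b \<Rightarrow> complex) set" where
  "pairing_kernel V B = {\<nu>\<in>V. \<forall>\<omega>\<in>V. B \<nu> \<omega> = 0}"

end

theory Submission
  imports Defs
begin

text \<open>The idea is electrical. A symmetric kernel \<open>potential\<close> on \<open>\<Gamma> \<times> \<Gamma>\<close> is constructed such that
  \<open>x \<mapsto> potential x y\<close> is continuous and piecewise affine with Laplacian \<open>\<delta>\<^sub>y - \<delta>\<^sub>b\<close> for a fixed base
  vertex \<open>b\<close>, and such that it is positive semidefinite on finite sets of points. By the maximum
  principle only constants are harmonic, so
  \<open>j\<^sub>\<zeta>(x, y) = potential x y - potential x \<zeta> - potential \<zeta> y + potential \<zeta> \<zeta>\<close>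
  (\<open>j_kernel_potential\<close>). When this is integrated against \<open>\<mu>\<close>, the pairing \<open>\<langle>\<nu>, \<omega>\<rangle>\<close> relative to \<open>\<mu>\<close>
  becomes the value at \<open>\<nu> - \<nu>(\<Gamma>) \<mu>\<close> and \<open>\<omega> - \<omega>(\<Gamma>) \<mu>\<close> of one sesquilinear form \<open>form\<close>, the double
  integral of \<open>potential\<close> (\<open>mu_energy_pairing_eq\<close>). On measures of total mass \<open>0\<close> these are \<open>\<nu>\<close> and
  \<open>\<omega>\<close> themselves, which is the independence of \<open>\<mu>\<close>. All the rest follows from the fact that \<open>form\<close>
  is positive semidefinite, and definite on measures of total mass \<open>0\<close>: the kernel of the pairing
  is where \<open>\<nu> = \<nu>(\<Gamma>) \<mu>\<close>, and for \<open>\<nu>(\<Gamma>) = 1\<close> the energy of \<open>\<nu>\<close> is the value of \<open>form\<close> at \<open>\<nu> - \<mu>\<close>.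

  To construct the kernel, \<open>\<Gamma>\<close> is cut into finitely many isometric arcs with ends in a finite set of
  vertices (\<open>arc_system_exists\<close>). On the vertices the kernel is the inverse of the positive definite
  matrix of the discrete Dirichlet form, grounded at \<open>b\<close>; connectedness of \<open>\<Gamma>\<close> makes it definite.
  The kernel on \<open>\<Gamma>\<close> interpolates this inverse linearly along the arcs and adds on each arc the Green
  kernel \<open>min s t - s t / L\<close> of a segment. Continuity, symmetry and positivity can be read off from
  this formula. Slopes are computed from the arcs although the Laplacian is defined by an arbitrary
  choice of star charts, because two systems of rays at a point agree near it (\<open>ray_chart_bij\<close>).

  Integrals against complex measures are limits of Riemann sums over partitions into small Borel
  sets. This gives linearity in the measure and Fubini's theorem for continuous functions, and it
  transfers positivity from finite sets of points to \<open>form\<close>.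

  For definiteness let \<open>form \<nu> \<nu> = 0\<close>. By the Cauchy-Schwarz inequality \<open>\<nu>\<close> is orthogonal to all
  Dirac measures, that is, \<open>potential x y\<close> integrates to \<open>0\<close> in \<open>x\<close> for each \<open>y\<close>. Second differences in
  \<open>y\<close> along an arc are tents, whose combinations approximate the indicators of subarcs; similarly,
  the sections at vertices and points near them yield the indicators of single vertices. These sets
  generate the Borel sets and are closed under intersections, so \<open>\<nu> = 0\<close>
  (\<open>null_measure.measure_zero\<close>).\<close>

section \<open>Inverting a positive definite matrix over a finite index set\<close>

text \<open>Gaussian elimination: a pivot removes one equation together with one unknown.\<close>

lemma underdetermined_homogeneous_system:
  fixes m :: "'a \<Rightarrow> 'b \<Rightarrow> real"
  assumes "finite A" "finite B" "card A < card B"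
  shows "\<exists>f. (\<exists>b\<in>B. f b \<noteq> 0) \<and> (\<forall>a\<in>A. (\<Sum>b\<in>B. m a b * f b) = 0)"
  using assms
proof (induction A arbitrary: B m rule: finite_induct)
  case empty
  then obtain b where "b \<in> B" by fastforce
  then show ?case by (intro exI[of _ "\<lambda>_. 1"]) auto
next
  case (insert a A)
  show ?case
  proof (cases "\<forall>b\<in>B. m a b = 0")
    case True
    have "card A < card B" using insert by simp
    with insert.IH[OF insert.prems(1), of m] obtain f where
      "\<exists>b\<in>B. f b \<noteq> 0" "\<forall>a\<in>A. (\<Sum>b\<in>B. m a b * f b) = 0" by blast
    then show ?thesis using True by (intro exI[of _ f]) auto
  next
    case False
    then obtain c where c: "c \<in> B" "m a c \<noteq> 0" by blast
    define m' where "m' = (\<lambda>x b. m x b - m x c * m a b / m a c)"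
    have "card A < card (B - {c})" using insert c by simp
    with insert.IH[of "B - {c}" m'] insert.prems obtain f where
      f: "\<exists>b\<in>B - {c}. f b \<noteq> 0" "\<forall>x\<in>A. (\<Sum>b\<in>B - {c}. m' x b * f b) = 0" by auto
    define s where "s = (\<Sum>b\<in>B - {c}. m a b * f b)"
    define g where "g = f(c := - s / m a c)"
    have split: "(\<Sum>b\<in>B. m x b * g b) = m x c * (- s / m a c) + (\<Sum>b\<in>B - {c}. m x b * f b)" for x
    proof -
      have "(\<Sum>b\<in>B. m x b * g b) = m x c * g c + (\<Sum>b\<in>B - {c}. m x b * g b)"
        using insert.prems c by (simp add: sum.remove)
      also have "(\<Sum>b\<in>B - {c}. m x b * g b) = (\<Sum>b\<in>B - {c}. m x b * f b)"
        by (intro sum.cong) (auto simp: g_def)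
      finally show ?thesis by (simp add: g_def)
    qed
    have "(\<Sum>b\<in>B. m x b * g b) = 0" if "x \<in> insert a A" for x
    proof (cases "x = a")
      case True
      then show ?thesis using c by (simp add: split s_def)
    next
      case False
      then have "0 = (\<Sum>b\<in>B - {c}. m' x b * f b)" using f that by simp
      also have "\<dots> = (\<Sum>b\<in>B - {c}. m x b * f b) - (m x c / m a c) * s"
        by (simp add: m'_def s_def sum_distrib_left left_diff_distrib sum_subtractf algebra_simps)
      finally show ?thesis by (simp add: split)
    qed
    moreover have "\<exists>b\<in>B. g b \<noteq> 0" using f(1) by (auto simp: g_def)
    ultimately show ?thesis by blast
  qed
qed

lemma nonsingular_system_solvable:
  fixes m :: "'a \<Rightarrow> 'a \<Rightarrow> real"
  assumes "finite A"
    and inj: "\<And>f. (\<And>a. a \<in> A \<Longrightarrow> (\<Sum>b\<in>A. m a b * f b) = 0) \<Longrightarrow> (\<And>a. a \<in> A \<Longrightarrow> f a = 0)"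
  shows "\<exists>f. \<forall>a\<in>A. (\<Sum>b\<in>A. m a b * f b) = g a"
proof -
  \<comment> \<open>The right-hand side becomes one more column, indexed by \<open>None\<close>.\<close>
  define B where "B = insert None (Some ` A)"
  define m' where "m' = (\<lambda>a b. case b of None \<Rightarrow> - g a | Some b \<Rightarrow> m a b)"
  have fin: "finite B" and card: "card A < card B"
    using assms(1) by (auto simp: B_def card_insert_if card_image)
  obtain f where f: "\<exists>b\<in>B. f b \<noteq> 0" "\<forall>a\<in>A. (\<Sum>b\<in>B. m' a b * f b) = 0"
    using underdetermined_homogeneous_system[OF assms(1) fin card] by blast
  have sum: "(\<Sum>b\<in>A. m a b * f (Some b)) = g a * f None" if "a \<in> A" for a
  proof -
    have "(\<Sum>b\<in>B. m' a b * f b) = - g a * f None + (\<Sum>b\<in>A. m a b * f (Some b))"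
      using assms(1) by (simp add: B_def m'_def sum.reindex)
    then show ?thesis using f(2) that by simp
  qed
  have "f None \<noteq> 0"
  proof
    assume 0: "f None = 0"
    then have "f (Some a) = 0" if "a \<in> A" for a
      using inj[of "\<lambda>b. f (Some b)"] sum that by simp
    then show False using f(1) 0 by (auto simp: B_def)
  qed
  then have "\<forall>a\<in>A. (\<Sum>b\<in>A. m a b * (f (Some b) / f None)) = g a"
    using sum by (simp add: sum_divide_distrib[symmetric])
  then show ?thesis by (intro exI[of _ "\<lambda>b. f (Some b) / f None"])
qed

text \<open>The quadratic form of the inverse at \<open>a\<close> is the quadratic form of the matrix at the
  solution of \<open>m f = a\<close>, hence nonnegative.\<close>

lemma positive_definite_inverse:
  fixes m :: "'a \<Rightarrow> 'a \<Rightarrow> real"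
  assumes "finite A"
    and sym: "\<And>a b. m a b = m b a"
    and psd: "\<And>f. (\<Sum>a\<in>A. \<Sum>b\<in>A. f a * f b * m a b) \<ge> 0"
    and pd: "\<And>f a. (\<Sum>a\<in>A. \<Sum>b\<in>A. f a * f b * m a b) = 0 \<Longrightarrow> a \<in> A \<Longrightarrow> f a = 0"
  shows "\<exists>K :: 'a \<Rightarrow> 'a \<Rightarrow> real. (\<forall>a\<in>A. \<forall>c\<in>A. (\<Sum>b\<in>A. m a b * K b c) = (if a = c then 1 else 0)) \<and>
    (\<forall>a\<in>A. \<forall>b\<in>A. K a b = K b a) \<and> (\<forall>f. (\<Sum>a\<in>A. \<Sum>b\<in>A. f a * f b * K a b) \<ge> 0)"
proof -
  have quad: "(\<Sum>a\<in>A. \<Sum>b\<in>A. f a * h b * m a b) = (\<Sum>a\<in>A. f a * (\<Sum>b\<in>A. m a b * h b))" for f h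
    by (simp add: sum_distrib_left algebra_simps)
  have inj: "f a = 0" if "\<And>a. a \<in> A \<Longrightarrow> (\<Sum>b\<in>A. m a b * f b) = 0" "a \<in> A" for f a
    using pd[of f a] that by (simp add: quad)
  have "\<exists>f. \<forall>a\<in>A. (\<Sum>b\<in>A. m a b * f b) = (if a = c then 1 else 0)" for c
    by (rule nonsingular_system_solvable[OF assms(1)]) (fact inj)
  then obtain F where F: "\<And>c. \<forall>a\<in>A. (\<Sum>b\<in>A. m a b * F c b) = (if a = c then 1 else 0)"
    by metis
  have pick: "(\<Sum>b\<in>A. (h :: 'a \<Rightarrow> real) b * (if b = a then 1 else 0)) = h a" if "a \<in> A" for h a
    using assms(1) that by (simp add: if_distrib cong: if_cong)
  have symF: "F a b = F b a" if "a \<in> A" "b \<in> A" for a b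
  proof -
    have "F a b = (\<Sum>x\<in>A. F a x * (\<Sum>y\<in>A. m x y * F b y))"
      using F[of b] pick[OF that(2), of "F a"] by simp
    also have "\<dots> = (\<Sum>x\<in>A. \<Sum>y\<in>A. F a x * F b y * m x y)" by (simp add: quad)
    also have "\<dots> = (\<Sum>y\<in>A. \<Sum>x\<in>A. F b y * F a x * m y x)"
      by (subst sum.swap, intro sum.cong refl) (metis mult.commute sym)
    also have "\<dots> = (\<Sum>y\<in>A. F b y * (\<Sum>x\<in>A. m y x * F a x))" by (simp add: quad)
    also have "\<dots> = F b a" using F[of a] pick[OF that(1), of "F b"] by simp
    finally show ?thesis .
  qed
  have "(\<Sum>a\<in>A. \<Sum>b\<in>A. f a * f b * F b a) \<ge> 0" for f
  proof -
    define h where "h = (\<lambda>x. \<Sum>c\<in>A. f c * F c x)"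
    have mh: "(\<Sum>b\<in>A. m a b * h b) = f a" if "a \<in> A" for a
    proof -
      have "(\<Sum>b\<in>A. m a b * h b) = (\<Sum>c\<in>A. f c * (\<Sum>b\<in>A. m a b * F c b))"
        unfolding h_def sum_distrib_left
        by (subst sum.swap) (simp add: algebra_simps)
      also have "\<dots> = (\<Sum>c\<in>A. f c * (if c = a then 1 else 0))"
        using F that by (intro sum.cong refl) auto
      finally show ?thesis using pick[OF that, of f] by simp
    qed
    have "(\<Sum>a\<in>A. \<Sum>b\<in>A. f a * f b * F b a) = (\<Sum>a\<in>A. h a * (\<Sum>b\<in>A. m a b * h b))"
      by (intro sum.cong refl) (simp add: mh, simp add: h_def sum_distrib_left algebra_simps)
    also have "\<dots> \<ge> 0" using psd[of h] by (simp add: quad)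
    finally show ?thesis .
  qed
  then show ?thesis using F symF by (intro exI[of _ "\<lambda>b c. F c b"]) auto
qed

section \<open>Star charts as families of rays\<close>

text \<open>A star chart without the complex plane: \<open>\<gamma> v s\<close> is the point at distance \<open>s\<close> from \<open>p\<close>
  on the ray \<open>v\<close>, and the rays fill the ball of radius \<open>\<epsilon>\<close>. The set of names of the rays is
  arbitrary, so that the rays at \<open>p\<close> can also be named by the arcs that end there, or by \<open>-1\<close>
  and \<open>1\<close> for the two directions along an arc through \<open>p\<close>.\<close>

definition ray_chart :: "'a::metric_space set \<Rightarrow> 'a \<Rightarrow> 'j set \<Rightarrow> ('j \<Rightarrow> real \<Rightarrow> 'a) \<Rightarrow> real \<Rightarrow> bool" where
  "ray_chart \<Gamma> p J \<gamma> \<epsilon> \<longleftrightarrow> finite J \<and> J \<noteq> {} \<and> \<epsilon> > 0 \<and> (\<forall>v\<in>J. \<gamma> v 0 = p) \<and>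
     (\<forall>v\<in>J. \<forall>s\<in>{0..<\<epsilon>}. \<gamma> v s \<in> \<Gamma>) \<and>
     (\<forall>v\<in>J. \<forall>s\<in>{0..<\<epsilon>}. \<forall>t\<in>{0..<\<epsilon>}. dist (\<gamma> v s) (\<gamma> v t) = \<bar>s - t\<bar>) \<and>
     (\<forall>v\<in>J. \<forall>w\<in>J. v \<noteq> w \<longrightarrow> (\<forall>s\<in>{0..<\<epsilon>}. \<forall>t\<in>{0..<\<epsilon>}. dist (\<gamma> v s) (\<gamma> w t) = s + t)) \<and>
     (\<forall>x\<in>\<Gamma>. dist x p < \<epsilon> \<longrightarrow> (\<exists>v\<in>J. x = \<gamma> v (dist x p)))"

lemma ray_chartD:
  assumes "ray_chart \<Gamma> p J \<gamma> \<epsilon>"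
  shows "finite J" "J \<noteq> {}" "\<epsilon> > 0" "v \<in> J \<Longrightarrow> \<gamma> v 0 = p"
    "v \<in> J \<Longrightarrow> 0 \<le> s \<Longrightarrow> s < \<epsilon> \<Longrightarrow> \<gamma> v s \<in> \<Gamma>"
    "v \<in> J \<Longrightarrow> 0 \<le> s \<Longrightarrow> s < \<epsilon> \<Longrightarrow> 0 \<le> t \<Longrightarrow> t < \<epsilon> \<Longrightarrow> dist (\<gamma> v s) (\<gamma> v t) = \<bar>s - t\<bar>"
    "v \<in> J \<Longrightarrow> w \<in> J \<Longrightarrow> v \<noteq> w \<Longrightarrow> 0 \<le> s \<Longrightarrow> s < \<epsilon> \<Longrightarrow> 0 \<le> t \<Longrightarrow> t < \<epsilon> \<Longrightarrow>
       dist (\<gamma> v s) (\<gamma> w t) = s + t"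
    "x \<in> \<Gamma> \<Longrightarrow> dist x p < \<epsilon> \<Longrightarrow> \<exists>v\<in>J. x = \<gamma> v (dist x p)"
  using assms unfolding ray_chart_def by auto

lemma ray_chart_mono: "ray_chart \<Gamma> p J \<gamma> \<epsilon> \<Longrightarrow> 0 < \<delta> \<Longrightarrow> \<delta> \<le> \<epsilon> \<Longrightarrow> ray_chart \<Gamma> p J \<gamma> \<delta>"
  unfolding ray_chart_def by auto

lemma ray_chart_dist_centre:
  assumes "ray_chart \<Gamma> p J \<gamma> \<epsilon>" "v \<in> J" "0 \<le> s" "s < \<epsilon>"
  shows "dist (\<gamma> v s) p = s"
  using ray_chartD(6)[OF assms(1,2), of s 0] ray_chartD(4)[OF assms(1,2)] assms by auto

lemma cis_ray_inj:
  assumes "v < n" "w < n" "cis (2 * pi * of_nat v / of_nat n) = cis (2 * pi * of_nat w / of_nat n)"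
  shows "v = w"
proof -
  have "inj_on (\<lambda>k. cis (2 * pi * real k / real n)) {..<n}"
    using Complex.bij_betw_roots_unity[of n] assms(1) by (auto simp: bij_betw_def)
  then show ?thesis using assms by (auto dest: inj_onD)
qed

text \<open>A neighbourhood of the centre inside the star contains a ball, and a point of this ball
  lies at its distance from the centre on some ray, because the chart preserves distances.\<close>

lemma star_chart_imp_ray_chart:
  assumes "star_chart \<Gamma> p n r \<phi>"
  shows "\<exists>\<epsilon>. ray_chart \<Gamma> p {..<n} (\<lambda>v s. \<phi> (of_real s * cis (2 * pi * of_nat v / of_nat n))) \<epsilon>"
proof -
  have n: "n \<ge> 1" and r: "r > 0" and phi0: "\<phi> 0 = p" and sub: "\<phi> ` star_set n r \<subseteq> \<Gamma>"
    and iso: "\<And>z w. z \<in> star_set n r \<Longrightarrow> w \<in> star_set n r \<Longrightarrow> dist (\<phi> z) (\<phi> w) = star_dist z w"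
    using assms unfolding star_chart_def by auto
  obtain U where U: "openin (top_of_set \<Gamma>) U" "p \<in> U" "U \<subseteq> \<phi> ` star_set n r"
    using assms unfolding star_chart_def by auto
  obtain e where e: "e > 0" "ball p e \<inter> \<Gamma> \<subseteq> U"
    using U(1,2) unfolding openin_contains_ball by blast
  define z where "z = (\<lambda>v s. complex_of_real s * cis (2 * pi * of_nat v / of_nat n))"
  define \<epsilon> where "\<epsilon> = min e r"
  have eps: "\<epsilon> > 0" "\<epsilon> \<le> e" "\<epsilon> \<le> r" using e r by (auto simp: \<epsilon>_def)
  have z_in: "z v s \<in> star_set n r" if "0 \<le> s" "s < r" for v s
    unfolding star_set_def z_def
    by (rule CollectI, rule exI[of _ s], rule exI[of _ "int v"]) (use that in auto)
  have sgn_z: "sgn (z v s) = cis (2 * pi * of_nat v / of_nat n)" if "s > 0" for v s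
    using that by (simp add: z_def sgn_mult sgn_of_real sgn_cis)
  have cmod_z: "cmod (z v s) = s" if "0 \<le> s" for v s
    using that by (simp add: z_def norm_mult)
  have z0: "z v 0 = 0" for v by (simp add: z_def)
  have same: "star_dist (z v s) (z v t) = \<bar>s - t\<bar>" if "0 \<le> s" "0 \<le> t" for v s t
  proof -
    have "cmod (z v s - z v t) = \<bar>s - t\<bar>"
    proof -
      have "z v s - z v t = of_real (s - t) * cis (2 * pi * of_nat v / of_nat n)"
        by (simp add: z_def left_diff_distrib)
      then show ?thesis by (simp only: norm_mult norm_cis norm_of_real mult_1_right)
    qed
    moreover have "s = 0 \<or> t = 0 \<or> sgn (z v s) = sgn (z v t)"
      using sgn_z[of s v] sgn_z[of t v] that by fastforce
    ultimately show ?thesis using cmod_z[of s v] cmod_z[of t v] that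
      by (auto simp: star_dist_def)
  qed
  have diff: "star_dist (z v s) (z w t) = s + t" if "0 \<le> s" "0 \<le> t" "v < n" "w < n" "v \<noteq> w" for v w s t
  proof (cases "s = 0 \<or> t = 0")
    case True
    then show ?thesis using cmod_z[of s v] cmod_z[of t w] that
      by (auto simp: star_dist_def z0)
  next
    case False
    then have "sgn (z v s) \<noteq> sgn (z w t)"
      using sgn_z[of s v] sgn_z[of t w] that cis_ray_inj[of v n w] by auto
    then show ?thesis using cmod_z[of s v] cmod_z[of t w] that by (auto simp: star_dist_def)
  qed
  have cover: "\<exists>v<n. x = \<phi> (z v (dist x p))" if x: "x \<in> \<Gamma>" "dist x p < \<epsilon>" for x
  proof -
    have "x \<in> ball p e \<inter> \<Gamma>" using x eps by (auto simp: dist_commute)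
    then obtain y where y: "y \<in> star_set n r" "x = \<phi> y" using e U by blast
    then obtain t k where tk: "y = of_real t * cis (2 * pi * of_int k / of_nat n)" "0 \<le> t" "t < r"
      unfolding star_set_def by auto
    define v where "v = nat (k mod int n)"
    have v: "v < n" "int v = k mod int n" using n by (auto simp: v_def nat_less_iff)
    have "k = int v + int n * (k div int n)" using v by simp
    then have "2 * pi * of_int k / of_nat n
        = 2 * pi * of_nat v / of_nat n + 2 * pi * of_int (k div int n)"
    proof -
      have "real_of_int k = real v + real n * of_int (k div int n)"
        using \<open>k = int v + int n * (k div int n)\<close>
        by (metis of_int_add of_int_mult of_int_of_nat_eq)
      then show ?thesis using n by (simp add: add_divide_distrib distrib_left)
    qed
    then have "cis (2 * pi * of_int k / of_nat n) = cis (2 * pi * of_nat v / of_nat n)"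
      by (simp add: cis_mult[symmetric] cis_multiple_2pi)
    then have yz: "y = z v t" using tk by (simp add: z_def)
    have "dist x p = star_dist (z v t) (z v 0)"
      using iso[of y 0] y yz z0[of v] z_in[of 0 v] r phi0 by simp
    then have "dist x p = t" using same tk by simp
    then show ?thesis using v yz y by blast
  qed
  have "ray_chart \<Gamma> p {..<n} (\<lambda>v s. \<phi> (z v s)) \<epsilon>"
    unfolding ray_chart_def
  proof (intro conjI allI impI ballI)
    show "\<phi> (z v s) \<in> \<Gamma>" if "v \<in> {..<n}" "s \<in> {0..<\<epsilon>}" for v s
      using sub z_in[of s v] that eps by auto
    show "dist (\<phi> (z v s)) (\<phi> (z v t)) = \<bar>s - t\<bar>" if "v \<in> {..<n}" "s \<in> {0..<\<epsilon>}" "t \<in> {0..<\<epsilon>}" for v s t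
      using iso[of "z v s" "z v t"] z_in[of s v] z_in[of t v] same[of s t v] that eps by auto
    show "dist (\<phi> (z v s)) (\<phi> (z w t)) = s + t"
      if "v \<in> {..<n}" "w \<in> {..<n}" "v \<noteq> w" "s \<in> {0..<\<epsilon>}" "t \<in> {0..<\<epsilon>}" for v w s t
      using iso[of "z v s" "z w t"] z_in[of s v] z_in[of t w] diff[of s t v w] that eps by auto
  qed (use n eps phi0 z0 cover in \<open>auto simp: lessThan_empty_iff\<close>)
  then show ?thesis by (auto simp: z_def)
qed

locale metrized_graph_set =
  fixes \<Gamma> :: "'a::metric_space set"
  assumes metrized_graph: "metrized_graph \<Gamma>"
begin

lemma nonempty: "\<Gamma> \<noteq> {}" and compact: "compact \<Gamma>" and connected: "connected \<Gamma>"
  using metrized_graph by (auto simp: metrized_graph_def)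

lemma ray_chart_translate:
  assumes "p \<in> \<Gamma>"
  shows "\<exists>\<epsilon>. ray_chart \<Gamma> p (Vec \<Gamma> p) (translate \<Gamma> p) \<epsilon>"
proof -
  obtain n r \<phi> where c: "chosen_chart \<Gamma> p = (n, r, \<phi>)" by (cases "chosen_chart \<Gamma> p")
  have "\<exists>c. case c of (n, r, \<phi>) \<Rightarrow> star_chart \<Gamma> p n r \<phi>"
    using metrized_graph assms unfolding metrized_graph_def by fastforce
  then have "case chosen_chart \<Gamma> p of (n, r, \<phi>) \<Rightarrow> star_chart \<Gamma> p n r \<phi>"
    unfolding chosen_chart_def by (rule someI_ex)
  then have "star_chart \<Gamma> p n r \<phi>" using c by simp
  from star_chart_imp_ray_chart[OF this] show ?thesis
    by (simp add: c Vec_def valence_def translate_def[abs_def])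
qed

end

section \<open>Arcs through a point and slopes along rays\<close>

text \<open>Points on different rays are at distance \<open>s + t\<close>, points of an isometric curve only at distance
  \<open>\<bar>s - t\<bar>\<close>. So a curve that leaves \<open>p\<close> isometrically cannot change rays.\<close>

lemma isometric_ray_match:
  assumes ch: "ray_chart \<Gamma> p J \<beta> \<epsilon>" and \<alpha>: "\<alpha> 0 = p" "\<And>s. s \<in> {0..<\<epsilon>} \<Longrightarrow> \<alpha> s \<in> \<Gamma>"
    "\<And>s t. s \<in> {0..<\<epsilon>} \<Longrightarrow> t \<in> {0..<\<epsilon>} \<Longrightarrow> dist (\<alpha> s) (\<alpha> t) = \<bar>s - t\<bar>"
  shows "\<exists>!j. j \<in> J \<and> (\<forall>s\<in>{0..<\<epsilon>}. \<alpha> s = \<beta> j s)"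
proof -
  note b = ray_chartD[OF ch]
  have ex: "\<exists>j\<in>J. \<alpha> s = \<beta> j s" if "0 \<le> s" "s < \<epsilon>" for s
    using b(8)[of "\<alpha> s"] \<alpha>(1) \<alpha>(2)[of s] \<alpha>(3)[of s 0] that by auto
  have uniq: "j = k" if "j \<in> J" "k \<in> J" "\<alpha> s = \<beta> j s" "\<alpha> t = \<beta> k t" "0 < s" "s < \<epsilon>" "0 < t" "t < \<epsilon>"
    for j k s t
  proof (rule ccontr)
    assume "j \<noteq> k"
    then have "\<bar>s - t\<bar> = s + t"
      using \<alpha>(3)[of s t] b(7)[of j k s t] that by simp
    then show False using that by simp
  qed
  obtain j where j: "j \<in> J" "\<alpha> (\<epsilon>/2) = \<beta> j (\<epsilon>/2)" using ex[of "\<epsilon>/2"] b(3) by auto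
  have all: "\<forall>s\<in>{0..<\<epsilon>}. \<alpha> s = \<beta> j s"
  proof
    fix s assume s: "s \<in> {0..<\<epsilon>}"
    show "\<alpha> s = \<beta> j s"
    proof (cases "s = 0")
      case True then show ?thesis using \<alpha>(1) b(4) j by simp
    next
      case False
      obtain k where k: "k \<in> J" "\<alpha> s = \<beta> k s" using ex[of s] s by auto
      then have "j = k" using uniq[of j k "\<epsilon>/2" s] j s b(3) False by simp
      then show ?thesis using k by simp
    qed
  qed
  have "k = j" if "k \<in> J" "\<forall>s\<in>{0..<\<epsilon>}. \<alpha> s = \<beta> k s" for k
    using uniq[of k j "\<epsilon>/2" "\<epsilon>/2"] j that b(3) by simp
  then show ?thesis using j all by blast
qed

lemma ray_chart_match:
  assumes "ray_chart \<Gamma> p I \<alpha> \<epsilon>" "ray_chart \<Gamma> p J \<beta> \<epsilon>" "i \<in> I"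
  shows "\<exists>!j. j \<in> J \<and> (\<forall>s\<in>{0..<\<epsilon>}. \<alpha> i s = \<beta> j s)"
  by (rule isometric_ray_match[OF assms(2)]) (use ray_chartD[OF assms(1)] assms(3) in auto)

text \<open>Any two systems of rays at \<open>p\<close> agree near \<open>p\<close> up to a bijection of their names. So the
  chosen chart may be replaced by any other in the computation of slopes.\<close>

lemma ray_chart_bij:
  assumes "ray_chart \<Gamma> p I \<alpha> \<epsilon>" "ray_chart \<Gamma> p J \<beta> \<epsilon>"
  shows "\<exists>h. bij_betw h I J \<and> (\<forall>i\<in>I. \<forall>s\<in>{0..<\<epsilon>}. \<alpha> i s = \<beta> (h i) s)"
proof -
  define h where "h = (\<lambda>i. THE j. j \<in> J \<and> (\<forall>s\<in>{0..<\<epsilon>}. \<alpha> i s = \<beta> j s))"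
  have h: "h i \<in> J \<and> (\<forall>s\<in>{0..<\<epsilon>}. \<alpha> i s = \<beta> (h i) s)" if "i \<in> I" for i
    unfolding h_def by (rule theI') (rule ray_chart_match[OF assms that])
  have "inj_on h I"
  proof (rule inj_onI)
    fix i k assume ik: "i \<in> I" "k \<in> I" "h i = h k"
    then have "\<forall>s\<in>{0..<\<epsilon>}. \<beta> (h i) s = \<alpha> i s" "\<forall>s\<in>{0..<\<epsilon>}. \<beta> (h i) s = \<alpha> k s"
      using h[of i] h[of k] by auto
    then show "i = k" using ray_chart_match[OF assms(2,1), of "h i"] h[of i] ik by blast
  qed
  moreover have "j \<in> h ` I" if "j \<in> J" for j
  proof -
    obtain i where i: "i \<in> I" "\<forall>s\<in>{0..<\<epsilon>}. \<beta> j s = \<alpha> i s"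
      using ray_chart_match[OF assms(2,1) \<open>j \<in> J\<close>] by (elim ex1E conjE) (rule that)
    then have "\<forall>s\<in>{0..<\<epsilon>}. \<alpha> i s = \<beta> j s" "\<forall>s\<in>{0..<\<epsilon>}. \<alpha> i s = \<beta> (h i) s"
      using h[of i] by auto
    then have "h i = j" using ray_chart_match[OF assms, of i] h[of i] i that by blast
    then show ?thesis using i by blast
  qed
  ultimately show ?thesis using h unfolding bij_betw_def by blast
qed

text \<open>A point close to \<open>\<gamma> j s\<close> lies on the ray \<open>j\<close>, because the distance from \<open>\<gamma> j s\<close> to a point on
  another ray is at least \<open>s\<close>.\<close>

lemma ray_chart_interior:
  assumes "ray_chart \<Gamma> p J \<gamma> \<epsilon>" "j \<in> J" "0 < s" "s < \<epsilon>"
  shows "ray_chart \<Gamma> (\<gamma> j s) {-1, 1::real} (\<lambda>\<sigma> u. \<gamma> j (s + \<sigma> * u)) (min s (\<epsilon> - s))"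
  unfolding ray_chart_def
proof (intro conjI ballI impI)
  note r = ray_chartD[OF assms(1)]
  show "min s (\<epsilon> - s) > 0" using assms by simp
  show "\<gamma> j (s + \<sigma> * u) \<in> \<Gamma>" if "\<sigma> \<in> {-1, 1}" "u \<in> {0..<min s (\<epsilon> - s)}" for \<sigma> u
    using r(5)[OF assms(2), of "s + \<sigma> * u"] that by auto
  show "dist (\<gamma> j (s + \<sigma> * u)) (\<gamma> j (s + \<sigma> * t)) = \<bar>u - t\<bar>"
    if "\<sigma> \<in> {-1, 1}" "u \<in> {0..<min s (\<epsilon> - s)}" "t \<in> {0..<min s (\<epsilon> - s)}" for \<sigma> u t
    using r(6)[OF assms(2), of "s + \<sigma> * u" "s + \<sigma> * t"] that by auto
  show "dist (\<gamma> j (s + \<sigma> * u)) (\<gamma> j (s + \<tau> * t)) = u + t"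
    if "\<sigma> \<in> {-1, 1}" "\<tau> \<in> {-1, 1}" "\<sigma> \<noteq> \<tau>" "u \<in> {0..<min s (\<epsilon> - s)}" "t \<in> {0..<min s (\<epsilon> - s)}" for \<sigma> \<tau> u t
    using r(6)[OF assms(2), of "s + \<sigma> * u" "s + \<tau> * t"] that by auto
  show "\<exists>\<sigma>\<in>{-1, 1}. x = \<gamma> j (s + \<sigma> * dist x (\<gamma> j s))"
    if x: "x \<in> \<Gamma>" "dist x (\<gamma> j s) < min s (\<epsilon> - s)" for x
  proof -
    have dp: "dist (\<gamma> j s) p = s" using ray_chart_dist_centre[OF assms(1,2)] assms by simp
    have lt: "dist x p < \<epsilon>" using dist_triangle[of x p "\<gamma> j s"] x dp by simp
    then obtain k where k: "k \<in> J" "x = \<gamma> k (dist x p)" using r(8) x by blast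
    have "k = j"
    proof (rule ccontr)
      assume "k \<noteq> j"
      then have "dist x (\<gamma> j s) = dist x p + s" using r(7)[of k j "dist x p" s] k lt assms by simp
      then show False using x by (smt (verit) zero_le_dist)
    qed
    then have "dist x (\<gamma> j s) = \<bar>dist x p - s\<bar>" "x = \<gamma> j (dist x p)"
      using r(6)[of j "dist x p" s] k lt assms by auto
    then show ?thesis by (cases "dist x p \<le> s") auto
  qed
qed (use assms in auto)

definition isometric_arc :: "'a::metric_space set \<Rightarrow> (real \<Rightarrow> 'a) \<Rightarrow> real \<Rightarrow> bool" where
  "isometric_arc \<Gamma> c L \<longleftrightarrow> (\<forall>s\<in>{0..L}. c s \<in> \<Gamma>) \<and> (\<forall>s\<in>{0..L}. \<forall>t\<in>{0..L}. dist (c s) (c t) = \<bar>s - t\<bar>)"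

lemma isometric_on_imp_continuous_on:
  fixes c :: "real \<Rightarrow> 'a::metric_space"
  assumes "\<And>s t. s \<in> I \<Longrightarrow> t \<in> I \<Longrightarrow> dist (c s) (c t) = \<bar>s - t\<bar>"
  shows "continuous_on I c"
  unfolding continuous_on_iff using assms by (metis dist_real_def)

lemma isometric_on_imp_inj_on:
  fixes c :: "real \<Rightarrow> 'a::metric_space"
  assumes "\<And>s t. s \<in> I \<Longrightarrow> t \<in> I \<Longrightarrow> dist (c s) (c t) = \<bar>s - t\<bar>"
  shows "inj_on c I"
  by (rule inj_onI) (metis assms dist_self right_minus_eq abs_eq_0)

lemma isometric_arc_continuous: "isometric_arc \<Gamma> c L \<Longrightarrow> continuous_on {0..L} c"
  and isometric_arc_inj: "isometric_arc \<Gamma> c L \<Longrightarrow> inj_on c {0..L}"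
  unfolding isometric_arc_def
  by (auto intro: isometric_on_imp_continuous_on isometric_on_imp_inj_on)

lemma isometric_arc_compact: "isometric_arc \<Gamma> c L \<Longrightarrow> compact (c ` {0..L})"
  using isometric_arc_continuous compact_continuous_image by blast

lemma card_2_eq:
  assumes "card J = 2" "a \<in> J" "b \<in> J" "a \<noteq> b" shows "J = {a, b}"
  by (metis assms card_2_iff doubleton_eq_iff insert_iff singletonD)

text \<open>An isometric arc that passes through a point of valence two runs along both rays, because
  at each small distance from the point there are only two points of the graph.\<close>

lemma arc_covers_nbhd:
  assumes ch: "ray_chart \<Gamma> x J \<gamma> \<eta>" and J: "card J = 2"
    and arc: "isometric_arc \<Gamma> d L" and t: "x = d t" "0 < t" "t < L"
    and u: "0 \<le> u" "u < \<eta>" "u < t" "u < L - t" and j: "j \<in> J"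
  shows "\<gamma> j u \<in> d ` {0..L}"
proof (cases "u = 0")
  case True
  then show ?thesis using ray_chartD(4)[OF ch j] t by auto
next
  case False
  have d: "\<And>s t. s \<in> {0..L} \<Longrightarrow> t \<in> {0..L} \<Longrightarrow> dist (d s) (d t) = \<bar>s - t\<bar>" "\<And>s. s \<in> {0..L} \<Longrightarrow> d s \<in> \<Gamma>"
    using arc by (auto simp: isometric_arc_def)
  have "\<exists>a\<in>J. d (t + u) = \<gamma> a u" "\<exists>b\<in>J. d (t - u) = \<gamma> b u"
    using ray_chartD(8)[OF ch, of "d (t + u)"] ray_chartD(8)[OF ch, of "d (t - u)"]
      d(1)[of "t + u" t] d(1)[of "t - u" t] d(2)[of "t + u"] d(2)[of "t - u"] t u by auto
  then obtain a b where ab: "a \<in> J" "d (t + u) = \<gamma> a u" "b \<in> J" "d (t - u) = \<gamma> b u" by blast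
  have "dist (d (t + u)) (d (t - u)) = 2 * u" using d(1)[of "t + u" "t - u"] t u by auto
  then have "a \<noteq> b" using ab False by auto
  then have "j = a \<or> j = b" using card_2_eq[OF J ab(1,3)] j by auto
  moreover have "t + u \<in> {0..L}" "t - u \<in> {0..L}" using t u by auto
  ultimately show ?thesis using ab by (metis image_eqI)
qed

text \<open>A piece of the graph without branching: near each of its points the graph is the curve itself.\<close>

definition open_line :: "'a::metric_space set \<Rightarrow> (real \<Rightarrow> 'a) \<Rightarrow> real \<Rightarrow> real \<Rightarrow> bool" where
  "open_line \<Gamma> c a b \<longleftrightarrow>
     (\<forall>s\<in>{a<..<b}. \<exists>\<eta>>0. ray_chart \<Gamma> (c s) {-1, 1::real} (\<lambda>\<sigma> u. c (s + \<sigma> * u)) \<eta>) \<and>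
     (\<forall>s\<in>{a<..<b}. \<forall>t\<in>{a<..<b}. dist (c s) (c t) = \<bar>s - t\<bar>)"

lemma open_line_ray:
  assumes "ray_chart \<Gamma> p J \<gamma> \<epsilon>" "j \<in> J"
  shows "open_line \<Gamma> (\<gamma> j) 0 \<epsilon>"
  unfolding open_line_def
proof (intro conjI ballI)
  fix s assume "s \<in> {0<..<\<epsilon>}"
  then show "\<exists>\<eta>>0. ray_chart \<Gamma> (\<gamma> j s) {-1, 1::real} (\<lambda>\<sigma> u. \<gamma> j (s + \<sigma> * u)) \<eta>"
    using ray_chart_interior[OF assms, of s] by (intro exI[of _ "min s (\<epsilon> - s)"]) auto
qed (use ray_chartD(6)[OF assms] in auto)

lemma open_line_mono:
  "open_line \<Gamma> c a b \<Longrightarrow> a \<le> a' \<Longrightarrow> b' \<le> b \<Longrightarrow> open_line \<Gamma> c a' b'"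
  unfolding open_line_def by auto

text \<open>The part of the line that lies on the arc is closed by compactness and open by
  \<open>arc_covers_nbhd\<close>, so connectedness of the line decides.\<close>

lemma open_line_dichotomy:
  assumes line: "open_line \<Gamma> c a b" and arc: "isometric_arc \<Gamma> d L"
    and ends: "d 0 \<notin> c ` {a<..<b}" "d L \<notin> c ` {a<..<b}"
    and s0: "s0 \<in> {a<..<b}" "c s0 \<in> d ` {0..L}"
  shows "c ` {a<..<b} \<subseteq> d ` {0..L}"
proof -
  define I where "I = {a<..<b}"
  define T where "T = {s\<in>I. c s \<in> d ` {0..L}}"
  have "continuous_on I c"
    using line unfolding open_line_def I_def by (auto intro: isometric_on_imp_continuous_on)
  then have "closedin (top_of_set I) (I \<inter> c -` (d ` {0..L}))"
    using isometric_arc_compact[OF arc] compact_imp_closed continuous_on_closed_vimage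
    by (meson continuous_closedin_preimage)
  moreover have "T = I \<inter> c -` (d ` {0..L})" by (auto simp: T_def)
  ultimately have closed: "closedin (top_of_set I) T" by simp
  have "openin (top_of_set I) T"
    unfolding openin_contains_ball
  proof (intro conjI ballI)
    show "T \<subseteq> I" by (auto simp: T_def)
    fix s assume s: "s \<in> T"
    then have sI: "s \<in> {a<..<b}" and "c s \<in> d ` {0..L}" by (auto simp: T_def I_def)
    then obtain t where t: "c s = d t" "t \<in> {0..L}" by auto
    have "c s \<noteq> d 0" "c s \<noteq> d L" using ends sI by (metis image_eqI)+
    then have "t \<noteq> 0" "t \<noteq> L" using t(1) by auto
    then have t': "0 < t" "t < L" using t by auto
    obtain \<eta> where eta: "\<eta> > 0" "ray_chart \<Gamma> (c s) {-1, 1::real} (\<lambda>\<sigma> u. c (s + \<sigma> * u)) \<eta>"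
      using line sI unfolding open_line_def by blast
    define e where "e = min \<eta> (min t (L - t))"
    have e: "e > 0" using eta t' by (auto simp: e_def)
    have "r \<in> T" if r: "r \<in> ball s e" "r \<in> I" for r
    proof -
      define \<sigma> :: real where "\<sigma> = (if r \<ge> s then 1 else -1)"
      have "r = s + \<sigma> * \<bar>r - s\<bar>" by (auto simp: \<sigma>_def)
      moreover have "c (s + \<sigma> * \<bar>r - s\<bar>) \<in> d ` {0..L}"
        by (rule arc_covers_nbhd[OF eta(2) _ arc t(1) t', of "\<bar>r - s\<bar>" \<sigma>])
           (use r in \<open>auto simp: \<sigma>_def e_def dist_real_def\<close>)
      ultimately show ?thesis using r by (simp add: T_def)
    qed
    then show "\<exists>e>0. ball s e \<inter> I \<subseteq> T" using e by blast
  qed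
  moreover have "connected I" by (simp add: I_def)
  ultimately have "T = {} \<or> T = I" using closed unfolding connected_clopen by blast
  moreover have "s0 \<in> T" using s0 by (simp add: T_def I_def)
  ultimately have "T = I" by blast
  then show ?thesis by (auto simp: T_def I_def)
qed

lemma isometry_of_interval:
  fixes \<tau> :: "real \<Rightarrow> real"
  assumes "a < b" and iso: "\<And>s t. s \<in> {a<..<b} \<Longrightarrow> t \<in> {a<..<b} \<Longrightarrow> \<bar>\<tau> s - \<tau> t\<bar> = \<bar>s - t\<bar>"
  shows "\<exists>\<alpha> \<sigma>. \<forall>s\<in>{a<..<b}. \<tau> s = \<alpha> + \<sigma> * s"
proof -
  \<comment> \<open>The orientation is read off at two points; the distances to both then determine \<open>\<tau> s\<close>.\<close>
  define p q where "p = (2 * a + b) / 3" and "q = (a + 2 * b) / 3"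
  have pq: "p \<in> {a<..<b}" "q \<in> {a<..<b}" "p < q" using assms(1) by (auto simp: p_def q_def)
  define \<sigma> :: real where "\<sigma> = (if \<tau> q \<ge> \<tau> p then 1 else -1)"
  have "\<tau> s = (\<tau> p - \<sigma> * p) + \<sigma> * s" if "s \<in> {a<..<b}" for s
    using iso[OF pq(1,2)] iso[OF that pq(1)] iso[OF that pq(2)] pq(3)
    unfolding \<sigma>_def by (auto split: if_splits)
  then show ?thesis by blast
qed

lemma affine_along_reparametrized:
  fixes f :: "'a::metric_space \<Rightarrow> complex"
  assumes "a < b" and c: "\<And>s t. s \<in> {a<..<b} \<Longrightarrow> t \<in> {a<..<b} \<Longrightarrow> dist (c s) (c t) = \<bar>s - t\<bar>"
    and arc: "isometric_arc \<Gamma> d L" and sub: "c ` {a<..<b} \<subseteq> d ` {0..L}"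
    and f: "\<And>t. t \<in> {0..L} \<Longrightarrow> f (d t) = \<alpha> + of_real t * \<beta>"
  shows "\<exists>\<alpha>' \<beta>'. \<forall>s\<in>{a<..<b}. f (c s) = \<alpha>' + of_real s * \<beta>'"
proof -
  have "\<forall>s\<in>{a<..<b}. \<exists>t\<in>{0..L}. c s = d t" using sub by auto
  then obtain \<tau> where tau: "\<And>s. s \<in> {a<..<b} \<Longrightarrow> \<tau> s \<in> {0..L} \<and> c s = d (\<tau> s)" by metis
  have "\<bar>\<tau> s - \<tau> t\<bar> = \<bar>s - t\<bar>" if "s \<in> {a<..<b}" "t \<in> {a<..<b}" for s t
    using c[OF that] tau[OF that(1)] tau[OF that(2)] arc unfolding isometric_arc_def by metis
  then obtain \<alpha>0 \<sigma> where "\<forall>s\<in>{a<..<b}. \<tau> s = \<alpha>0 + \<sigma> * s"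
    using isometry_of_interval[OF assms(1)] by blast
  then have "\<forall>s\<in>{a<..<b}. f (c s) = (\<alpha> + of_real \<alpha>0 * \<beta>) + of_real s * (of_real \<sigma> * \<beta>)"
    using tau f by (auto simp: algebra_simps)
  then show ?thesis by blast
qed

definition linear_rays :: "'j set \<Rightarrow> ('j \<Rightarrow> real \<Rightarrow> 'a) \<Rightarrow> real \<Rightarrow> ('a \<Rightarrow> complex) \<Rightarrow> 'a \<Rightarrow> ('j \<Rightarrow> complex) \<Rightarrow> bool" where
  "linear_rays J \<gamma> \<delta> f p b \<longleftrightarrow> (\<forall>j\<in>J. \<forall>s\<in>{0..<\<delta>}. f (\<gamma> j s) = f p + of_real s * b j)"

text \<open>A ray that starts at \<open>p\<close> meets the ends of the finitely many segments on which \<open>f\<close> is affine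
  in finitely many points; before the first of them it stays on a single segment.\<close>

lemma CPA_linear_on_ray:
  assumes f: "f \<in> CPA \<Gamma>" and ch: "ray_chart \<Gamma> p J \<gamma> \<epsilon>" and j: "j \<in> J"
  shows "\<exists>\<delta>>0. \<delta> \<le> \<epsilon> \<and> (\<exists>b. \<forall>s\<in>{0..<\<delta>}. f (\<gamma> j s) = f p + of_real s * b)"
proof -
  obtain S where S: "finite S" "\<Gamma> = (\<Union>(c, L)\<in>S. c ` {0..L})"
    "\<And>c L. (c, L) \<in> S \<Longrightarrow> (\<forall>s\<in>{0..L}. \<forall>t\<in>{0..L}. dist (c s) (c t) = \<bar>s - t\<bar>) \<and>
           (\<exists>a b. \<forall>t\<in>{0..L}. f (c t) = a + of_real t * b)"
    using f unfolding CPA_def by fast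
  have contf: "continuous_on \<Gamma> f" using f by (simp add: CPA_def)
  have arc: "isometric_arc \<Gamma> c L" if "(c, L) \<in> S" for c L
    using S(2) S(3)[OF that] that unfolding isometric_arc_def by fast
  define P where "P = (\<lambda>(c, L). c 0) ` S \<union> (\<lambda>(c, L). c L) ` S"
  note r = ray_chartD[OF ch]
  have inj: "inj_on (\<gamma> j) {0..<\<epsilon>}"
    by (rule isometric_on_imp_inj_on) (use r(6)[OF j] in auto)
  have "finite {s\<in>{0..<\<epsilon>}. \<gamma> j s \<in> P}"
  proof (rule finite_imageD[of "\<gamma> j"])
    show "finite (\<gamma> j ` {s\<in>{0..<\<epsilon>}. \<gamma> j s \<in> P})"
      using S(1) by (rule_tac finite_subset[of _ P]) (auto simp: P_def)
    show "inj_on (\<gamma> j) {s\<in>{0..<\<epsilon>}. \<gamma> j s \<in> P}" using inj by (rule inj_on_subset) auto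
  qed
  then obtain \<delta>0 where d0: "\<delta>0 > 0" "\<forall>s\<in>{s\<in>{0..<\<epsilon>}. \<gamma> j s \<in> P}. s \<noteq> 0 \<longrightarrow> \<delta>0 \<le> dist 0 s"
    using finite_set_avoid[of "{s\<in>{0..<\<epsilon>}. \<gamma> j s \<in> P}" 0] by blast
  define \<delta> where "\<delta> = min \<delta>0 \<epsilon>"
  have d: "\<delta> > 0" "\<delta> \<le> \<epsilon>" using d0 r(3) by (auto simp: \<delta>_def)
  have avoid: "\<gamma> j s \<notin> P" if "s \<in> {0<..<\<delta>}" for s
  proof
    assume "\<gamma> j s \<in> P"
    then have "\<delta>0 \<le> dist 0 s" using d0(2) that by (simp add: \<delta>_def)
    then show False using that by (simp add: \<delta>_def dist_real_def)
  qed
  have "\<gamma> j (\<delta>/2) \<in> \<Gamma>" using r(5)[OF j, of "\<delta>/2"] d by simp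
  then obtain c L where cL: "(c, L) \<in> S" "\<gamma> j (\<delta>/2) \<in> c ` {0..L}" using S(2) by fast
  have "c 0 \<in> P" "c L \<in> P" using cL(1) by (force simp: P_def)+
  then have ends: "c 0 \<notin> \<gamma> j ` {0<..<\<delta>}" "c L \<notin> \<gamma> j ` {0<..<\<delta>}"
    using avoid by auto
  have line: "open_line \<Gamma> (\<gamma> j) 0 \<delta>"
    by (rule open_line_mono[OF open_line_ray[OF ch j]]) (use d in auto)
  have "\<delta>/2 \<in> {0<..<\<delta>}" using d by simp
  then have sub: "\<gamma> j ` {0<..<\<delta>} \<subseteq> c ` {0..L}"
    by (rule open_line_dichotomy[OF line arc[OF cL(1)] ends _ cL(2)])
  obtain \<alpha> \<beta> where "\<And>t. t \<in> {0..L} \<Longrightarrow> f (c t) = \<alpha> + of_real t * \<beta>" using S(3)[OF cL(1)] by blast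
  then obtain \<alpha>' \<beta>' where ab: "\<forall>s\<in>{0<..<\<delta>}. f (\<gamma> j s) = \<alpha>' + of_real s * \<beta>'"
    using affine_along_reparametrized[OF d(1) _ arc[OF cL(1)] sub, of f] r(6)[OF j] d by fastforce
  have "((\<lambda>s. f (\<gamma> j s)) \<longlongrightarrow> f (\<gamma> j 0)) (at 0 within {0..<\<delta>})"
  proof -
    have "continuous_on {0..<\<delta>} (\<gamma> j)"
      by (rule isometric_on_imp_continuous_on) (use r(6)[OF j] d in auto)
    moreover have "\<gamma> j ` {0..<\<delta>} \<subseteq> \<Gamma>" using r(5)[OF j] d by auto
    ultimately have "continuous_on {0..<\<delta>} (\<lambda>s. f (\<gamma> j s))"
      using continuous_on_compose2[OF contf] by blast
    then show ?thesis using d by (simp add: continuous_on_def)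
  qed
  then have lim: "((\<lambda>s. f (\<gamma> j s)) \<longlongrightarrow> f p) (at_right 0)"
    using r(4)[OF j] tendsto_within_subset[of _ _ 0 "{0..<\<delta>}" "{0..\<delta>/2}"] at_within_Icc_at_right[of 0 "\<delta>/2"] d
    by (simp add: subset_eq)
  have "((\<lambda>s. \<alpha>' + of_real s * \<beta>') \<longlongrightarrow> \<alpha>' + of_real 0 * \<beta>') (at_right 0)"
    by (intro tendsto_intros)
  moreover have "\<forall>\<^sub>F s in at_right 0. \<alpha>' + of_real s * \<beta>' = f (\<gamma> j s)"
    using ab eventually_at_right_less[of 0] d
    by (auto simp: eventually_at_right_field intro!: exI[of _ \<delta>])
  ultimately have "((\<lambda>s. f (\<gamma> j s)) \<longlongrightarrow> \<alpha>' + of_real 0 * \<beta>') (at_right 0)"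
    by (rule Lim_transform_eventually)
  then have "f p = \<alpha>'" using tendsto_unique[OF _ lim] by simp
  then have "\<forall>s\<in>{0..<\<delta>}. f (\<gamma> j s) = f p + of_real s * \<beta>'"
    using ab r(4)[OF j] by (metis add.right_neutral atLeastLessThan_iff greaterThanLessThan_iff mult_zero_left of_real_0 order_le_less)
  then show ?thesis using d by blast
qed

lemma CPA_linear_rays:
  assumes f: "f \<in> CPA \<Gamma>" and ch: "ray_chart \<Gamma> p J \<gamma> \<epsilon>"
  shows "\<exists>\<delta>>0. \<delta> \<le> \<epsilon> \<and> (\<exists>b. linear_rays J \<gamma> \<delta> f p b)"
proof -
  have "\<forall>j\<in>J. \<exists>\<delta> b. \<delta> > 0 \<and> \<delta> \<le> \<epsilon> \<and> (\<forall>s\<in>{0..<\<delta>}. f (\<gamma> j s) = f p + of_real s * b)"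
    using CPA_linear_on_ray[OF assms] by blast
  then obtain \<delta> b where db: "\<And>j. j \<in> J \<Longrightarrow> \<delta> j > 0 \<and> \<delta> j \<le> \<epsilon> \<and> (\<forall>s\<in>{0..<\<delta> j}. f (\<gamma> j s) = f p + of_real s * b j)"
    by metis
  note r = ray_chartD[OF ch]
  define e where "e = Min (\<delta> ` J)"
  have "e > 0" using r(1,2) db by (auto simp: e_def)
  moreover have le: "e \<le> \<delta> j" if "j \<in> J" for j using r(1) that by (auto simp: e_def)
  moreover have "e \<le> \<epsilon>" using r(2) le db by fastforce
  moreover have "linear_rays J \<gamma> e f p b" unfolding linear_rays_def using db le by fastforce
  ultimately show ?thesis by blast
qed

lemma linear_rays_mono: "linear_rays J \<gamma> \<delta> f p b \<Longrightarrow> \<delta>' \<le> \<delta> \<Longrightarrow> linear_rays J \<gamma> \<delta>' f p b"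
  unfolding linear_rays_def by auto

lemma linear_rays_combination:
  assumes "linear_rays J \<gamma> \<delta> f p b" "linear_rays J \<gamma> \<delta> g p b'"
  shows "linear_rays J \<gamma> \<delta> (\<lambda>x. u * f x + v * g x) p (\<lambda>j. u * b j + v * b' j)"
  using assms unfolding linear_rays_def by (auto simp: algebra_simps)

context metrized_graph_set
begin

lemma slope_sum_chosen_chart:
  assumes "linear_rays (Vec \<Gamma> p) (translate \<Gamma> p) \<delta> f p b" "\<delta> > 0" "p \<in> \<Gamma>"
  shows "slope_sum \<Gamma> f p = (\<Sum>v\<in>Vec \<Gamma> p. b v)"
  unfolding slope_sum_def
proof (rule sum.cong)
  fix v assume v: "v \<in> Vec \<Gamma> p"
  have "\<forall>\<^sub>F t in at_right 0. b v = (f (translate \<Gamma> p v t) - f p) / of_real t"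
    using assms v unfolding eventually_at_right_field linear_rays_def by (intro exI[of _ \<delta>]) auto
  then have "((\<lambda>t. (f (translate \<Gamma> p v t) - f p) / of_real t) \<longlongrightarrow> b v) (at_right 0)"
    by (rule Lim_transform_eventually[OF tendsto_const])
  then show "dir_deriv \<Gamma> f p v = b v"
    unfolding dir_deriv_def by (intro tendsto_Lim) auto
qed simp

lemma slope_sum_eq:
  assumes p: "p \<in> \<Gamma>" and ch: "ray_chart \<Gamma> p J \<gamma> \<epsilon>" and lin: "linear_rays J \<gamma> \<delta> f p b" "\<delta> > 0"
  shows "slope_sum \<Gamma> f p = (\<Sum>j\<in>J. b j)"
proof -
  obtain \<epsilon>' where ch': "ray_chart \<Gamma> p (Vec \<Gamma> p) (translate \<Gamma> p) \<epsilon>'" using ray_chart_translate[OF p] by blast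
  define e where "e = min \<delta> (min \<epsilon> \<epsilon>')"
  have e: "0 < e" "e \<le> \<delta>" "e \<le> \<epsilon>" "e \<le> \<epsilon>'"
    using ray_chartD(3)[OF ch] ray_chartD(3)[OF ch'] lin by (auto simp: e_def)
  obtain h where h: "bij_betw h (Vec \<Gamma> p) J" "\<forall>i\<in>Vec \<Gamma> p. \<forall>s\<in>{0..<e}. translate \<Gamma> p i s = \<gamma> (h i) s"
    using ray_chart_bij[OF ray_chart_mono[OF ch' e(1,4)] ray_chart_mono[OF ch e(1,3)]] by blast
  have "linear_rays (Vec \<Gamma> p) (translate \<Gamma> p) e f p (\<lambda>v. b (h v))"
    unfolding linear_rays_def
    using h lin e(2) bij_betwE[OF h(1)] unfolding linear_rays_def by auto
  then have "slope_sum \<Gamma> f p = (\<Sum>v\<in>Vec \<Gamma> p. b (h v))" using e(1) p by (rule slope_sum_chosen_chart)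
  then show ?thesis using sum.reindex_bij_betw[OF h(1)] by simp
qed

lemma CPA_linear_chosen_rays:
  assumes "f \<in> CPA \<Gamma>" "p \<in> \<Gamma>"
  shows "\<exists>\<delta>>0. \<exists>b. linear_rays (Vec \<Gamma> p) (translate \<Gamma> p) \<delta> f p b"
  using ray_chart_translate[OF assms(2)] CPA_linear_rays[OF assms(1)] by meson

text \<open>On a punctured neighbourhood of any point the function is affine along the rays, so the two slopes
  at each point there cancel; compactness leaves finitely many exceptions.\<close>

lemma finite_slope_sum_nonzero:
  assumes f: "f \<in> CPA \<Gamma>"
  shows "finite {p\<in>\<Gamma>. slope_sum \<Gamma> f p \<noteq> 0}"
proof -
  have "\<exists>\<delta>>0. \<forall>q\<in>\<Gamma>. dist q p < \<delta> \<longrightarrow> q \<noteq> p \<longrightarrow> slope_sum \<Gamma> f q = 0" if p: "p \<in> \<Gamma>" for p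
  proof -
    obtain \<epsilon> where ch: "ray_chart \<Gamma> p (Vec \<Gamma> p) (translate \<Gamma> p) \<epsilon>" using ray_chart_translate[OF p] by blast
    obtain \<delta> b where d: "\<delta> > 0" "\<delta> \<le> \<epsilon>" and lin: "linear_rays (Vec \<Gamma> p) (translate \<Gamma> p) \<delta> f p b"
      using CPA_linear_rays[OF f ch] by blast
    have "slope_sum \<Gamma> f q = 0" if q: "q \<in> \<Gamma>" "dist q p < \<delta>" "q \<noteq> p" for q
    proof -
      define s where "s = dist q p"
      have s: "0 < s" "s < \<delta>" using q by (auto simp: s_def)
      obtain v where v: "v \<in> Vec \<Gamma> p" "q = translate \<Gamma> p v s"
        using ray_chartD(8)[OF ch q(1)] q d by (auto simp: s_def)
      have ch2: "ray_chart \<Gamma> q {-1, 1::real} (\<lambda>\<sigma> u. translate \<Gamma> p v (s + \<sigma> * u)) (min s (\<epsilon> - s))"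
        using ray_chart_interior[OF ch v(1), of s] s d v by simp
      have "linear_rays {-1, 1::real} (\<lambda>\<sigma> u. translate \<Gamma> p v (s + \<sigma> * u)) (min s (\<delta> - s)) f q (\<lambda>\<sigma>. of_real \<sigma> * b v)"
        unfolding linear_rays_def
      proof (intro ballI)
        fix \<sigma> u :: real assume su: "\<sigma> \<in> {-1, 1}" "u \<in> {0..<min s (\<delta> - s)}"
        then have "0 \<le> s + \<sigma> * u" "s + \<sigma> * u < \<delta>" using s by auto
        then have "f (translate \<Gamma> p v (s + \<sigma> * u)) = f p + of_real (s + \<sigma> * u) * b v"
          using lin v(1) unfolding linear_rays_def by auto
        moreover have "f q = f p + of_real s * b v" using lin v s unfolding linear_rays_def by auto
        ultimately show "f (translate \<Gamma> p v (s + \<sigma> * u)) = f q + of_real u * (of_real \<sigma> * b v)"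
          by (simp add: algebra_simps)
      qed
      then have "slope_sum \<Gamma> f q = (\<Sum>\<sigma>\<in>{-1, 1::real}. of_real \<sigma> * b v)"
        by (rule slope_sum_eq[OF q(1) ch2]) (use s in auto)
      then show ?thesis by simp
    qed
    then show ?thesis using d by blast
  qed
  then obtain \<delta> where dl: "\<And>p. p \<in> \<Gamma> \<Longrightarrow> \<delta> p > 0 \<and> (\<forall>q\<in>\<Gamma>. dist q p < \<delta> p \<longrightarrow> q \<noteq> p \<longrightarrow> slope_sum \<Gamma> f q = 0)"
    by metis
  have "\<Gamma> \<subseteq> (\<Union>p\<in>\<Gamma>. ball p (\<delta> p))" using dl by force
  then obtain C where C: "C \<subseteq> \<Gamma>" "finite C" "\<Gamma> \<subseteq> (\<Union>p\<in>C. ball p (\<delta> p))"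
    using compactE_image[OF compact, of \<Gamma> "\<lambda>p. ball p (\<delta> p)"] by auto
  have "{p\<in>\<Gamma>. slope_sum \<Gamma> f p \<noteq> 0} \<subseteq> C"
  proof
    fix q assume q: "q \<in> {p\<in>\<Gamma>. slope_sum \<Gamma> f p \<noteq> 0}"
    then obtain p where "p \<in> C" "q \<in> ball p (\<delta> p)" using C by blast
    then show "q \<in> C" using dl[of p] C q by (auto simp: dist_commute) (metis dist_commute subsetD)
  qed
  then show ?thesis using C(2) finite_subset by blast
qed

section \<open>The maximum principle\<close>

text \<open>At a maximum all slopes are nonpositive, so if their sum vanishes, the function is constant
  nearby. Hence the set of maxima is open and closed.\<close>

lemma harmonic_real_imp_constant:
  fixes u :: "'a \<Rightarrow> real"
  assumes cont: "continuous_on \<Gamma> u"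
    and harm: "\<And>p. p \<in> \<Gamma> \<Longrightarrow> \<exists>\<delta>>0. \<exists>b. (\<forall>v\<in>Vec \<Gamma> p. \<forall>s\<in>{0..<\<delta>}. u (translate \<Gamma> p v s) = u p + s * b v) \<and> (\<Sum>v\<in>Vec \<Gamma> p. b v) = 0"
    and "x \<in> \<Gamma>" "y \<in> \<Gamma>"
  shows "u x = u y"
proof -
  obtain m where m: "m \<in> \<Gamma>" "\<And>z. z \<in> \<Gamma> \<Longrightarrow> u z \<le> u m"
    using continuous_attains_sup[OF compact nonempty cont] by blast
  define A where "A = {z\<in>\<Gamma>. u z = u m}"
  have "closedin (top_of_set \<Gamma>) A"
    unfolding A_def by (rule continuous_closedin_preimage_constant[OF cont])
  moreover have "openin (top_of_set \<Gamma>) A"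
    unfolding openin_contains_ball
  proof (intro conjI ballI)
    fix p assume "p \<in> A"
    then have p: "p \<in> \<Gamma>" "u p = u m" by (auto simp: A_def)
    obtain \<epsilon> where ch: "ray_chart \<Gamma> p (Vec \<Gamma> p) (translate \<Gamma> p) \<epsilon>" using ray_chart_translate[OF p(1)] by blast
    obtain \<delta> b where d: "\<delta> > 0" and b: "\<And>v s. v \<in> Vec \<Gamma> p \<Longrightarrow> s \<in> {0..<\<delta>} \<Longrightarrow> u (translate \<Gamma> p v s) = u p + s * b v"
      and sum0: "(\<Sum>v\<in>Vec \<Gamma> p. b v) = 0" using harm[OF p(1)] by blast
    define e where "e = min \<epsilon> \<delta>"
    have e: "e > 0" "e \<le> \<epsilon>" "e \<le> \<delta>" using d ray_chartD(3)[OF ch] by (auto simp: e_def)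
    have "b v \<le> 0" if v: "v \<in> Vec \<Gamma> p" for v
    proof -
      have "translate \<Gamma> p v (e/2) \<in> \<Gamma>" using ray_chartD(5)[OF ch v, of "e/2"] e by simp
      then have "u p + (e/2) * b v \<le> u p" using m(2) p b[OF v, of "e/2"] e by fastforce
      then show ?thesis using e(1) by (simp add: mult_le_0_iff)
    qed
    then have "b v = 0" if "v \<in> Vec \<Gamma> p" for v
      using sum0 that sum_nonneg_eq_0_iff[OF ray_chartD(1)[OF ch], of "\<lambda>v. - b v"]
      by (auto simp: sum_negf)
    then have "z \<in> A" if z: "z \<in> ball p e \<inter> \<Gamma>" for z
    proof -
      have "dist z p < \<epsilon>" "dist z p \<in> {0..<\<delta>}" using z e by (auto simp: dist_commute)
      then obtain v where "v \<in> Vec \<Gamma> p" "z = translate \<Gamma> p v (dist z p)"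
        using ray_chartD(8)[OF ch, of z] z by blast
      then have "u z = u p" using b[of v "dist z p"] \<open>\<And>v. v \<in> Vec \<Gamma> p \<Longrightarrow> b v = 0\<close> \<open>dist z p \<in> {0..<\<delta>}\<close> by simp
      then show ?thesis using p z by (simp add: A_def)
    qed
    then show "\<exists>e>0. ball p e \<inter> \<Gamma> \<subseteq> A" using e by blast
  qed (auto simp: A_def)
  ultimately have "A = {} \<or> A = \<Gamma>" using connected connected_clopen by blast
  then have "A = \<Gamma>" using m by (auto simp: A_def)
  then have "x \<in> A" "y \<in> A" using assms by auto
  then show ?thesis by (simp add: A_def)
qed

lemma equal_slope_sums_imp_constant_difference:
  assumes f: "f \<in> CPA \<Gamma>" and g: "g \<in> CPA \<Gamma>"
    and eq: "\<And>p. p \<in> \<Gamma> \<Longrightarrow> slope_sum \<Gamma> f p = slope_sum \<Gamma> g p"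
    and xy: "x \<in> \<Gamma>" "y \<in> \<Gamma>"
  shows "f x - g x = f y - g y"
proof -
  define h where "h = (\<lambda>x. 1 * f x + (-1) * g x)"
  have cont: "continuous_on \<Gamma> h"
    using f g unfolding h_def CPA_def by (auto intro!: continuous_intros)
  have harm: "\<exists>\<delta>>0. \<exists>b. linear_rays (Vec \<Gamma> p) (translate \<Gamma> p) \<delta> h p b \<and> (\<Sum>v\<in>Vec \<Gamma> p. b v) = 0"
    if p: "p \<in> \<Gamma>" for p
  proof -
    obtain \<delta>1 b1 where 1: "\<delta>1 > 0" "linear_rays (Vec \<Gamma> p) (translate \<Gamma> p) \<delta>1 f p b1"
      using CPA_linear_chosen_rays[OF f p] by blast
    obtain \<delta>2 b2 where 2: "\<delta>2 > 0" "linear_rays (Vec \<Gamma> p) (translate \<Gamma> p) \<delta>2 g p b2"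
      using CPA_linear_chosen_rays[OF g p] by blast
    have "linear_rays (Vec \<Gamma> p) (translate \<Gamma> p) (min \<delta>1 \<delta>2) h p (\<lambda>j. 1 * b1 j + (-1) * b2 j)"
      unfolding h_def by (rule linear_rays_combination) (use 1 2 in \<open>auto intro: linear_rays_mono\<close>)
    moreover have "(\<Sum>v\<in>Vec \<Gamma> p. 1 * b1 v + (-1) * b2 v) = 0"
      using eq[OF p] slope_sum_chosen_chart[OF 1(2,1) p] slope_sum_chosen_chart[OF 2(2,1) p]
      by (simp add: sum_subtractf)
    moreover have "min \<delta>1 \<delta>2 > 0" using 1 2 by simp
    ultimately show ?thesis by blast
  qed
  have "Re (h x) = Re (h y)"
  proof (rule harmonic_real_imp_constant[OF _ _ xy])
    fix p assume p: "p \<in> \<Gamma>"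
    obtain \<delta> b where "\<delta> > 0" "linear_rays (Vec \<Gamma> p) (translate \<Gamma> p) \<delta> h p b" "(\<Sum>v\<in>Vec \<Gamma> p. b v) = 0"
      using harm[OF p] by blast
    then show "\<exists>\<delta>>0. \<exists>b. (\<forall>v\<in>Vec \<Gamma> p. \<forall>s\<in>{0..<\<delta>}. Re (h (translate \<Gamma> p v s)) = Re (h p) + s * b v) \<and> (\<Sum>v\<in>Vec \<Gamma> p. b v) = 0"
      by (intro exI[of _ \<delta>] conjI exI[of _ "\<lambda>v. Re (b v)"])
         (auto simp: linear_rays_def Re_sum[symmetric])
  qed (intro continuous_intros cont)
  moreover have "Im (h x) = Im (h y)"
  proof (rule harmonic_real_imp_constant[OF _ _ xy])
    fix p assume p: "p \<in> \<Gamma>"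
    obtain \<delta> b where "\<delta> > 0" "linear_rays (Vec \<Gamma> p) (translate \<Gamma> p) \<delta> h p b" "(\<Sum>v\<in>Vec \<Gamma> p. b v) = 0"
      using harm[OF p] by blast
    then show "\<exists>\<delta>>0. \<exists>b. (\<forall>v\<in>Vec \<Gamma> p. \<forall>s\<in>{0..<\<delta>}. Im (h (translate \<Gamma> p v s)) = Im (h p) + s * b v) \<and> (\<Sum>v\<in>Vec \<Gamma> p. b v) = 0"
      by (intro exI[of _ \<delta>] conjI exI[of _ "\<lambda>v. Im (b v)"])
         (auto simp: linear_rays_def Im_sum[symmetric])
  qed (intro continuous_intros cont)
  ultimately have "h x = h y" by (simp add: complex_eq_iff)
  then show ?thesis by (simp add: h_def)
qed

lemma singleton_in_borel_on: "p \<in> \<Gamma> \<Longrightarrow> {p} \<in> sets (borel_on \<Gamma>)"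
  by (subst sets_restrict_space_iff) (use compact in \<open>auto simp: borel_closed compact_imp_closed\<close>)

lemma laplacian_singleton:
  assumes "f \<in> CPA \<Gamma>" "p \<in> \<Gamma>"
  shows "laplacian \<Gamma> f {p} = - slope_sum \<Gamma> f p"
proof -
  have "(\<Sum>q\<in>{q\<in>\<Gamma>. slope_sum \<Gamma> f q \<noteq> 0}. slope_sum \<Gamma> f q * dirac \<Gamma> q {p})
      = (\<Sum>q\<in>{q\<in>\<Gamma>. slope_sum \<Gamma> f q \<noteq> 0}. if q = p then slope_sum \<Gamma> f q else 0)"
    using singleton_in_borel_on[OF assms(2)] by (intro sum.cong) (auto simp: dirac_def)
  also have "\<dots> = slope_sum \<Gamma> f p"
    using finite_slope_sum_nonzero[OF assms(1)] assms(2) by auto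
  finally show ?thesis by (simp add: laplacian_def)
qed

text \<open>Since only constants have Laplacian zero, any solution of the Laplace equation that vanishes at \<open>\<zeta>\<close>
  is the one in the definition of \<open>j_kernel\<close>.\<close>

lemma j_kernel_eq:
  assumes "\<zeta> \<in> \<Gamma>" "y \<in> \<Gamma>"
    and f: "f \<in> CPA \<Gamma>" "laplacian \<Gamma> f = (\<lambda>E. dirac \<Gamma> y E - dirac \<Gamma> \<zeta> E)" "f \<zeta> = 0"
  shows "j_kernel \<Gamma> \<zeta> x y = f x"
proof -
  have "(THE f. f \<in> CPA \<Gamma> \<and> laplacian \<Gamma> f = (\<lambda>E. dirac \<Gamma> y E - dirac \<Gamma> \<zeta> E) \<and> f \<zeta> = 0) = f"
  proof (rule the_equality)
    fix g assume g: "g \<in> CPA \<Gamma> \<and> laplacian \<Gamma> g = (\<lambda>E. dirac \<Gamma> y E - dirac \<Gamma> \<zeta> E) \<and> g \<zeta> = 0"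
    have "slope_sum \<Gamma> g p = slope_sum \<Gamma> f p" if "p \<in> \<Gamma>" for p
      using laplacian_singleton[OF f(1) that] laplacian_singleton[of g, OF _ that] g f(2) by simp
    then have "g x = f x" if "x \<in> \<Gamma>" for x
      using equal_slope_sums_imp_constant_difference[of g f x \<zeta>] g f that assms by simp
    moreover have "g \<in> extensional \<Gamma>" "f \<in> extensional \<Gamma>" using g f by (auto simp: CPA_def)
    ultimately show "g = f" by (auto intro: extensionalityI)
  qed (use f in auto)
  then show ?thesis by (simp add: j_kernel_def)
qed

end

section \<open>A metrized graph is a finite union of arcs\<close>

lemma open_line_shift:
  assumes "open_line \<Gamma> c a b"
  shows "open_line \<Gamma> (\<lambda>t. c (r + t)) (a - r) (b - r)"
  unfolding open_line_def
proof (intro conjI ballI)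
  fix s assume s: "s \<in> {a - r<..<b - r}"
  then have "r + s \<in> {a<..<b}" by auto
  then obtain \<eta> where "\<eta> > 0" "ray_chart \<Gamma> (c (r + s)) {-1, 1::real} (\<lambda>\<sigma> u. c (r + s + \<sigma> * u)) \<eta>"
    using assms unfolding open_line_def by blast
  then show "\<exists>\<eta>>0. ray_chart \<Gamma> (c (r + s)) {-1, 1::real} (\<lambda>\<sigma> u. c (r + (s + \<sigma> * u))) \<eta>"
    by (auto simp: add.assoc)
  fix t assume "t \<in> {a - r<..<b - r}"
  then show "dist (c (r + s)) (c (r + t)) = \<bar>s - t\<bar>"
    using s assms unfolding open_line_def by auto
qed

lemma isometric_arc_subarc:
  assumes "isometric_arc \<Gamma> c L" "0 \<le> a" "b \<le> L"
  shows "isometric_arc \<Gamma> (\<lambda>t. c (a + t)) (b - a)"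
  using assms unfolding isometric_arc_def by auto

lemma isometric_arc_closure:
  assumes "isometric_arc \<Gamma> c L" "0 < L"
  shows "c ` {0..L} = closure (c ` {0<..<L})"
proof
  have cl: "closure {0<..<L} = {0..L}" using assms(2) by (simp add: closure_greaterThanLessThan)
  show "c ` {0..L} \<subseteq> closure (c ` {0<..<L})"
    using image_closure_subset[of "{0<..<L}" c "closure (c ` {0<..<L})"]
      isometric_arc_continuous[OF assms(1)] cl closure_subset by (metis closed_closure)
  show "closure (c ` {0<..<L}) \<subseteq> c ` {0..L}"
    using isometric_arc_compact[OF assms(1)]
    by (intro closure_minimal) (auto intro: compact_imp_closed)
qed

definition consecutive :: "real set \<Rightarrow> real \<Rightarrow> real \<Rightarrow> bool" where
  "consecutive T a b \<longleftrightarrow> a \<in> T \<and> b \<in> T \<and> a < b \<and> T \<inter> {a<..<b} = {}"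

lemma consecutive_around:
  assumes "finite T" "lo \<in> T" "hi \<in> T" "lo < hi" "s \<in> {lo..hi}"
  shows "\<exists>a b. consecutive T a b \<and> s \<in> {a..b}"
proof (cases "s < hi")
  case True
  define a where "a = Max {t\<in>T. t \<le> s}"
  define b where "b = Min {t\<in>T. s < t}"
  have "a \<in> {t\<in>T. t \<le> s}" unfolding a_def by (rule Max_in) (use assms in auto)
  moreover have "b \<in> {t\<in>T. s < t}" unfolding b_def by (rule Min_in) (use assms True in auto)
  moreover have "t \<le> a" if "t \<in> T" "t \<le> s" for t
    using assms(1) that unfolding a_def by (intro Max_ge) auto
  moreover have "b \<le> t" if "t \<in> T" "s < t" for t
    using assms(1) that unfolding b_def by (intro Min_le) auto
  ultimately show ?thesis unfolding consecutive_def
    by (intro exI[of _ a] exI[of _ b]) force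
next
  case False
  define a where "a = Max {t\<in>T. t < hi}"
  have "a \<in> {t\<in>T. t < hi}" unfolding a_def by (rule Max_in) (use assms in auto)
  moreover have "t \<le> a" if "t \<in> T" "t < hi" for t
    using assms(1) that unfolding a_def by (intro Max_ge) auto
  ultimately show ?thesis using assms False unfolding consecutive_def
    by (intro exI[of _ a] exI[of _ hi]) force
qed

text \<open>An arc is a pair of a parametrization by arc length and a length. Loops do not occur: an
  arc is isometric, so its ends are distinct.\<close>

definition arc_system :: "'a::metric_space set \<Rightarrow> 'a set \<Rightarrow> ((real \<Rightarrow> 'a) \<times> real) set \<Rightarrow> bool" where
  "arc_system \<Gamma> V E \<longleftrightarrow> finite V \<and> V \<subseteq> \<Gamma> \<and> finite E \<and>
     (\<forall>(c, L)\<in>E. L > 0 \<and> isometric_arc \<Gamma> c L \<and> open_line \<Gamma> c 0 L \<and> c 0 \<in> V \<and> c L \<in> V \<and> c ` {0<..<L} \<inter> V = {}) \<and>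
     (\<forall>(c, L)\<in>E. \<forall>(d, M)\<in>E. (c, L) \<noteq> (d, M) \<longrightarrow> c ` {0<..<L} \<inter> d ` {0<..<M} = {}) \<and>
     \<Gamma> = (\<Union>(c, L)\<in>E. c ` {0..L})"

context metrized_graph_set
begin

text \<open>Finitely many stars cover the graph. The vertices are their centres and the ends of their
  rays; the rays are cut at the vertices. By \<open>open_line_dichotomy\<close>, two of the resulting pieces
  have the same interior or disjoint interiors, so it remains to keep one piece for each
  interior.\<close>

lemma arc_system_exists: "\<exists>V E. arc_system \<Gamma> V E"
proof -
  define \<gamma> where "\<gamma> = translate \<Gamma>"
  have "\<forall>p\<in>\<Gamma>. \<exists>\<epsilon>. ray_chart \<Gamma> p (Vec \<Gamma> p) (\<gamma> p) \<epsilon>" using ray_chart_translate by (simp add: \<gamma>_def)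
  then obtain \<epsilon> where ch: "\<And>p. p \<in> \<Gamma> \<Longrightarrow> ray_chart \<Gamma> p (Vec \<Gamma> p) (\<gamma> p) (\<epsilon> p)" by metis
  define \<rho> where "\<rho> p = \<epsilon> p / 2" for p
  have rho: "\<rho> p > 0" "\<rho> p < \<epsilon> p" if "p \<in> \<Gamma>" for p
    using ray_chartD(3)[OF ch[OF that]] by (auto simp: \<rho>_def)
  have "\<Gamma> \<subseteq> (\<Union>p\<in>\<Gamma>. ball p (\<rho> p))" using rho by force
  then obtain C where C: "C \<subseteq> \<Gamma>" "finite C" "\<Gamma> \<subseteq> (\<Union>p\<in>C. ball p (\<rho> p))"
    using compactE_image[OF compact, of \<Gamma> "\<lambda>p. ball p (\<rho> p)"] by auto
  define R where "R = (SIGMA p:C. Vec \<Gamma> p)"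
  have R: "finite R" using C ray_chartD(1)[OF ch] unfolding R_def by (intro finite_SigmaI) auto
  have Rmem: "p \<in> \<Gamma>" "p \<in> C" "j \<in> Vec \<Gamma> p" if "(p, j) \<in> R" for p j using that C by (auto simp: R_def)
  define V where "V = C \<union> (\<lambda>(p, j). \<gamma> p j (\<rho> p)) ` R"
  have V: "finite V" using C R by (simp add: V_def)
  have "\<gamma> p j (\<rho> p) \<in> \<Gamma>" if "(p, j) \<in> R" for p j
    using ray_chartD(5)[OF ch[OF Rmem(1)[OF that]] Rmem(3)[OF that], of "\<rho> p"] rho[OF Rmem(1)[OF that]] by simp
  then have VG: "V \<subseteq> \<Gamma>" using C by (auto simp: V_def)
  have arc: "isometric_arc \<Gamma> (\<gamma> p j) (\<rho> p)" if "(p, j) \<in> R" for p j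
    using ray_chartD(5,6)[OF ch[OF Rmem(1)[OF that]] Rmem(3)[OF that]] rho[OF Rmem(1)[OF that]]
    unfolding isometric_arc_def by auto
  define T where "T = (\<lambda>(p, j). {t\<in>{0..\<rho> p}. \<gamma> p j t \<in> V})"
  have T: "finite (T (p, j))" "0 \<in> T (p, j)" "\<rho> p \<in> T (p, j)" if "(p, j) \<in> R" for p j
  proof -
    have "finite (\<gamma> p j ` T (p, j))" using V by (rule finite_subset[rotated]) (auto simp: T_def)
    moreover have "inj_on (\<gamma> p j) (T (p, j))"
      using isometric_arc_inj[OF arc[OF that]] by (rule inj_on_subset) (auto simp: T_def)
    ultimately show "finite (T (p, j))" by (rule finite_imageD)
    show "0 \<in> T (p, j)" "\<rho> p \<in> T (p, j)"
      using ray_chartD(4)[OF ch[OF Rmem(1)[OF that]] Rmem(3)[OF that]] rho[OF Rmem(1)[OF that]] Rmem(2)[OF that] that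
      by (force simp: T_def V_def)+
  qed
  define Q where "Q = (\<lambda>((p, j), a, b). (\<lambda>t. \<gamma> p j (a + t), b - a)) `
    {((p, j), a, b). (p, j) \<in> R \<and> consecutive (T (p, j)) a b}"
  have "finite {((p, j), a, b). (p, j) \<in> R \<and> consecutive (T (p, j)) a b}"
    by (rule finite_subset[of _ "SIGMA r:R. T r \<times> T r"])
       (use R T in \<open>auto simp: consecutive_def intro!: finite_SigmaI\<close>)
  then have finQ: "finite Q" by (simp add: Q_def)
  have Q: "L > 0 \<and> isometric_arc \<Gamma> c L \<and> open_line \<Gamma> c 0 L \<and> c 0 \<in> V \<and> c L \<in> V \<and> c ` {0<..<L} \<inter> V = {}"
    if "(c, L) \<in> Q" for c L
  proof -
    obtain p j a b where pj: "(p, j) \<in> R" "consecutive (T (p, j)) a b" "c = (\<lambda>t. \<gamma> p j (a + t))" "L = b - a"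
      using \<open>(c, L) \<in> Q\<close> unfolding Q_def by auto
    then have ab: "0 \<le> a" "a < b" "b \<le> \<rho> p" "\<gamma> p j a \<in> V" "\<gamma> p j b \<in> V"
      by (auto simp: consecutive_def T_def)
    have no: "\<gamma> p j t \<notin> V" if "a < t" "t < b" for t
    proof -
      have "t \<notin> T (p, j)" "t \<in> {0..\<rho> p}" using pj(2) ab that by (auto simp: consecutive_def)
      then show ?thesis by (simp add: T_def)
    qed
    have "open_line \<Gamma> (\<gamma> p j) a b"
      by (rule open_line_mono[OF open_line_ray[OF ch]])
         (use Rmem[OF pj(1)] ab rho[of p] in auto)
    from open_line_shift[OF this, of a] have "open_line \<Gamma> c 0 L" by (simp add: pj)
    moreover have "isometric_arc \<Gamma> c L"
      unfolding pj by (rule isometric_arc_subarc[OF arc[OF pj(1)]]) (use ab in auto)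
    ultimately show ?thesis using ab no by (auto simp: pj)
  qed
  have sub: "c ` {0<..<L} \<subseteq> d ` {0<..<M}"
    if cd: "(c, L) \<in> Q" "(d, M) \<in> Q" "c ` {0<..<L} \<inter> d ` {0<..<M} \<noteq> {}" for c L d M
  proof -
    obtain s where s: "s \<in> {0<..<L}" "c s \<in> d ` {0..M}" using cd(3) by fastforce
    have ends: "d 0 \<notin> c ` {0<..<L}" "d M \<notin> c ` {0<..<L}" using Q[OF cd(1)] Q[OF cd(2)] by blast+
    then have *: "c ` {0<..<L} \<subseteq> d ` {0..M}"
      using open_line_dichotomy[of \<Gamma> c 0 L d M s] Q[OF cd(1)] Q[OF cd(2)] s by blast
    show ?thesis
    proof
      fix x assume x: "x \<in> c ` {0<..<L}"
      then obtain t where t: "t \<in> {0..M}" "x = d t" using * by blast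
      then have "t \<noteq> 0" "t \<noteq> M" using ends x by auto
      then show "x \<in> d ` {0<..<M}" using t by auto
    qed
  qed
  define F where "F = (\<lambda>(c :: real \<Rightarrow> 'a, L). c ` {0<..<L})"
  define E where "E = inv_into Q F ` F ` Q"
  have EQ: "E \<subseteq> Q"
  proof
    fix e assume "e \<in> E"
    then obtain q where "q \<in> Q" "e = inv_into Q F (F q)" by (auto simp: E_def simp del: split_paired_Ex)
    then show "e \<in> Q" by (simp add: inv_into_into)
  qed
  have injE: "e = e'" if "e \<in> E" "e' \<in> E" "F e = F e'" for e e'
    using that unfolding E_def by (auto simp: f_inv_into_f)
  have disj: "c ` {0<..<L} \<inter> d ` {0<..<M} = {}"
    if "(c, L) \<in> E" "(d, M) \<in> E" "(c, L) \<noteq> (d, M)" for c L d M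
  proof (rule ccontr)
    assume "c ` {0<..<L} \<inter> d ` {0<..<M} \<noteq> {}"
    then have "F (c, L) = F (d, M)"
      using sub[of c L d M] sub[of d M c L] that EQ by (auto simp: F_def)
    then show False using injE that by blast
  qed
  have cover: "x \<in> (\<Union>(c, L)\<in>E. c ` {0..L})" if x: "x \<in> \<Gamma>" for x
  proof -
    obtain p where p: "p \<in> C" "dist x p < \<rho> p" using C(3) x by (auto simp: dist_commute)
    then have pG: "p \<in> \<Gamma>" using C by auto
    obtain j where j: "j \<in> Vec \<Gamma> p" "x = \<gamma> p j (dist x p)"
      using ray_chartD(8)[OF ch[OF pG] x] p rho[OF pG] by auto
    have R': "(p, j) \<in> R" using p j by (auto simp: R_def)
    obtain a b where ab: "consecutive (T (p, j)) a b" "dist x p \<in> {a..b}"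
      using consecutive_around[OF T[OF R'] rho(1)[OF pG], of "dist x p"] p by auto
    define q where "q = (\<lambda>t. \<gamma> p j (a + t), b - a)"
    have q: "q \<in> Q" unfolding Q_def q_def using R' ab by force
    have xq: "x \<in> fst q ` {0..snd q}" using ab j by (auto simp: q_def intro!: image_eqI[of _ _ "dist x p - a"])
    have e: "inv_into Q F (F q) \<in> E" "F (inv_into Q F (F q)) = F q"
      using q by (auto simp: E_def f_inv_into_f)
    obtain c L where cL: "inv_into Q F (F q) = (c, L)" by fastforce
    have cl: "fst q ` {0..snd q} = closure (F q)" if "q \<in> Q" for q
    proof -
      obtain d M where [simp]: "q = (d, M)" by fastforce
      show ?thesis using Q[of d M] that isometric_arc_closure[of \<Gamma> d M] by (simp add: F_def)
    qed
    have "fst q ` {0..snd q} = c ` {0..L}"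
      using cl[OF q] cl[of "(c, L)"] e EQ cL by auto
    then show ?thesis using xq e(1) cL by auto
  qed
  have "\<Gamma> = (\<Union>(c, L)\<in>E. c ` {0..L})"
  proof
    show "\<Gamma> \<subseteq> (\<Union>(c, L)\<in>E. c ` {0..L})" using cover by blast
    show "(\<Union>(c, L)\<in>E. c ` {0..L}) \<subseteq> \<Gamma>" using Q EQ unfolding isometric_arc_def by fast
  qed
  then have "arc_system \<Gamma> V E"
    unfolding arc_system_def using V VG finQ EQ Q disj finite_subset[OF EQ finQ] by blast
  then show ?thesis by blast
qed

end

locale metrized_graph_arcs = metrized_graph_set +
  fixes V E
  assumes arcs: "arc_system \<Gamma> V E"
begin

lemma finite_V: "finite V" and V_subset: "V \<subseteq> \<Gamma>" and finite_E: "finite E"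
  and graph_eq: "\<Gamma> = (\<Union>(c, L)\<in>E. c ` {0..L})"
  using arcs by (auto simp: arc_system_def)

lemma arcD:
  assumes "(c, L) \<in> E"
  shows "L > 0" "isometric_arc \<Gamma> c L" "open_line \<Gamma> c 0 L" "c 0 \<in> V" "c L \<in> V"
    "s \<in> {0<..<L} \<Longrightarrow> c s \<notin> V" "s \<in> {0..L} \<Longrightarrow> c s \<in> \<Gamma>"
    "s \<in> {0..L} \<Longrightarrow> t \<in> {0..L} \<Longrightarrow> dist (c s) (c t) = \<bar>s - t\<bar>"
    "s \<in> {0..L} \<Longrightarrow> t \<in> {0..L} \<Longrightarrow> c s = c t \<longleftrightarrow> s = t"
proof -
  show 1: "L > 0" "isometric_arc \<Gamma> c L" "open_line \<Gamma> c 0 L" "c 0 \<in> V" "c L \<in> V"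
    "s \<in> {0<..<L} \<Longrightarrow> c s \<notin> V"
    using arcs assms unfolding arc_system_def by fast+
  then show "s \<in> {0..L} \<Longrightarrow> c s \<in> \<Gamma>" 
    "s \<in> {0..L} \<Longrightarrow> t \<in> {0..L} \<Longrightarrow> dist (c s) (c t) = \<bar>s - t\<bar>"
    by (auto simp: isometric_arc_def)
  show "s \<in> {0..L} \<Longrightarrow> t \<in> {0..L} \<Longrightarrow> c s = c t \<longleftrightarrow> s = t"
    using isometric_arc_inj[OF 1(2)] by (auto dest: inj_onD)
qed

lemma arcs_disjoint:
  assumes "(c, L) \<in> E" "(d, M) \<in> E" "s \<in> {0<..<L}" "t \<in> {0<..<M}" "c s = d t"
  shows "(c, L) = (d, M)"
proof (rule ccontr)
  assume "(c, L) \<noteq> (d, M)"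
  moreover have "\<forall>e\<in>E. \<forall>e'\<in>E. e \<noteq> e' \<longrightarrow> fst e ` {0<..<snd e} \<inter> fst e' ` {0<..<snd e'} = {}"
    using arcs by (simp add: arc_system_def case_prod_beta prod_eq_iff)
  ultimately have "c ` {0<..<L} \<inter> d ` {0<..<M} = {}" using assms(1,2) by fastforce
  then show False using assms by blast
qed

lemma arc_vertex_iff: "(c, L) \<in> E \<Longrightarrow> s \<in> {0..L} \<Longrightarrow> c s \<in> V \<longleftrightarrow> s = 0 \<or> s = L"
  using arcD(4-6) by (cases "s = 0"; cases "s = L") auto

definition ends_at :: "'a \<Rightarrow> (((real \<Rightarrow> 'a) \<times> real) \<times> bool) set" where
  "ends_at v = {(e, b). e \<in> E \<and> (if b then fst e (snd e) = v else fst e 0 = v)}"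

definition from_end :: "((real \<Rightarrow> 'a) \<times> real) \<times> bool \<Rightarrow> real \<Rightarrow> 'a" where
  "from_end = (\<lambda>((c, L), b) s. if b then c (L - s) else c s)"

text \<open>Near a vertex, the arcs that end there are the rays. That two of them form a geodesic is not
  part of the combinatorial data: it comes from the star chart at the vertex, whose rays these
  arcs must follow.\<close>

lemma ray_chart_vertex:
  assumes v: "v \<in> V"
  shows "\<exists>\<epsilon>. ray_chart \<Gamma> v (ends_at v) from_end \<epsilon>"
proof -
  have vG: "v \<in> \<Gamma>" using v V_subset by auto
  obtain \<epsilon>0 where ch: "ray_chart \<Gamma> v (Vec \<Gamma> v) (translate \<Gamma> v) \<epsilon>0" using ray_chart_translate[OF vG] by blast
  define K where "K = (\<Union>(c, L)\<in>{(c, L)\<in>E. v \<notin> c ` {0..L}}. c ` {0..L})"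
  have "closed K" unfolding K_def
    using finite_E isometric_arc_compact[OF arcD(2)]
    by (intro closed_UN) (auto intro: compact_imp_closed finite_subset[of _ E])
  moreover have "v \<notin> K" by (auto simp: K_def)
  ultimately obtain \<epsilon>1 where e1: "\<epsilon>1 > 0" "ball v \<epsilon>1 \<subseteq> - K"
    using openE[of "- K" v] by (auto simp: open_Compl)
  have ends: "s = 0 \<and> fst e 0 = v \<or> s = snd e \<and> fst e (snd e) = v" if "e \<in> E" "s \<in> {0..snd e}" "v = fst e s" for e s
    using arc_vertex_iff[of "fst e" "snd e" s] that v by auto
  have ne: "ends_at v \<noteq> {}"
  proof -
    obtain c L s where "(c, L) \<in> E" "s \<in> {0..L}" "v = c s" using graph_eq vG by blast
    then have "((c, L), False) \<in> ends_at v \<or> ((c, L), True) \<in> ends_at v"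
      using ends[of "(c, L)" s] by (auto simp: ends_at_def)
    then show ?thesis by blast
  qed
  then have neE: "E \<noteq> {}" by (auto simp: ends_at_def)
  \<comment> \<open>Half of the shortest length keeps rays at the two ends of one arc apart.\<close>
  define \<epsilon> where "\<epsilon> = min (min \<epsilon>0 \<epsilon>1) (Min (snd ` E) / 2)"
  have "Min (snd ` E) \<in> snd ` E" using finite_E neE by (intro Min_in) auto
  then have "Min (snd ` E) > 0" using arcD(1) by auto
  then have eps: "\<epsilon> > 0" "\<epsilon> \<le> \<epsilon>0" "\<epsilon> \<le> \<epsilon>1" using ray_chartD(3)[OF ch] e1 by (auto simp: \<epsilon>_def)
  have epsL: "\<epsilon> \<le> snd e / 2" if "e \<in> E" for e
  proof -
    have "Min (snd ` E) \<le> snd e" using finite_E that by (intro Min_le) auto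
    then show ?thesis by (simp add: \<epsilon>_def)
  qed
  note ch = ray_chart_mono[OF ch eps(1,2)]
  have ray: "from_end x 0 = v \<and> (\<forall>s\<in>{0..<\<epsilon>}. from_end x s \<in> \<Gamma>) \<and>
      (\<forall>s\<in>{0..<\<epsilon>}. \<forall>t\<in>{0..<\<epsilon>}. dist (from_end x s) (from_end x t) = \<bar>s - t\<bar>)" if x: "x \<in> ends_at v" for x
  proof -
    obtain c L b where [simp]: "x = ((c, L), b)" by (metis surj_pair)
    have E: "(c, L) \<in> E" using x by (simp add: ends_at_def)
    show ?thesis using arcD[OF E] epsL[OF E] x eps(1)
      by (auto simp: ends_at_def from_end_def split: if_splits)
  qed
  have "\<exists>!j. j \<in> Vec \<Gamma> v \<and> (\<forall>s\<in>{0..<\<epsilon>}. from_end x s = translate \<Gamma> v j s)" if "x \<in> ends_at v" for x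
    by (rule isometric_ray_match[OF ch]) (use ray[OF that] in auto)
  then obtain h where h: "\<And>x. x \<in> ends_at v \<Longrightarrow> h x \<in> Vec \<Gamma> v \<and> (\<forall>s\<in>{0..<\<epsilon>}. from_end x s = translate \<Gamma> v (h x) s)"
    by metis
  have distinct: "from_end x (\<epsilon>/2) \<noteq> from_end y (\<epsilon>/2)" if xy: "x \<in> ends_at v" "y \<in> ends_at v" "x \<noteq> y" for x y
  proof
    obtain c L b where [simp]: "x = ((c, L), b)" by (metis surj_pair)
    obtain d M b' where [simp]: "y = ((d, M), b')" by (metis surj_pair)
    have E: "(c, L) \<in> E" "(d, M) \<in> E" using xy by (auto simp: ends_at_def)
    define s where "s = (if b then L - \<epsilon>/2 else \<epsilon>/2)"
    define t where "t = (if b' then M - \<epsilon>/2 else \<epsilon>/2)"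
    have st: "s \<in> {0<..<L}" "t \<in> {0<..<M}" using epsL[OF E(1)] epsL[OF E(2)] eps(1) by (auto simp: s_def t_def)
    assume "from_end x (\<epsilon>/2) = from_end y (\<epsilon>/2)"
    then have eq: "c s = d t" by (auto simp: from_end_def s_def t_def split: if_splits)
    have same: "c = d" "L = M" using arcs_disjoint[OF E st eq] by auto
    then have "s = t" using eq arcD(9)[OF E(1), of s t] st by auto
    then have "b = b'" using epsL[OF E(1)] eps(1) same by (auto simp: s_def t_def split: if_splits)
    then show False using same xy by simp
  qed
  have "ray_chart \<Gamma> v (ends_at v) from_end \<epsilon>"
    unfolding ray_chart_def
  proof (intro conjI ballI impI)
    show "finite (ends_at v)"
      by (rule finite_subset[of _ "E \<times> UNIV"]) (use finite_E in \<open>auto simp: ends_at_def\<close>)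
    show "dist (from_end x s) (from_end y t) = s + t"
      if xy: "x \<in> ends_at v" "y \<in> ends_at v" "x \<noteq> y" "s \<in> {0..<\<epsilon>}" "t \<in> {0..<\<epsilon>}" for x y s t
    proof -
      have "from_end x s = translate \<Gamma> v (h x) s" "from_end y t = translate \<Gamma> v (h y) t"
        "from_end x (\<epsilon>/2) = translate \<Gamma> v (h x) (\<epsilon>/2)" "from_end y (\<epsilon>/2) = translate \<Gamma> v (h y) (\<epsilon>/2)"
        using h[OF xy(1)] h[OF xy(2)] xy eps(1) by auto
      moreover from this have "h x \<noteq> h y" using distinct[OF xy(1-3)] by auto
      ultimately show ?thesis using ray_chartD(7)[OF ch, of "h x" "h y" s t] h[OF xy(1)] h[OF xy(2)] xy by auto
    qed
    show "\<exists>j\<in>ends_at v. x = from_end j (dist x v)" if x: "x \<in> \<Gamma>" "dist x v < \<epsilon>" for x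
    proof -
      obtain c L s where cL: "(c, L) \<in> E" "s \<in> {0..L}" "x = c s" using graph_eq x(1) by blast
      have "x \<notin> K" using x(2) eps e1 by (auto simp: dist_commute subset_eq)
      then have "v \<in> c ` {0..L}" using cL unfolding K_def by blast
      then obtain r where "r \<in> {0..L}" "v = c r" by blast
      then consider "c 0 = v" | "c L = v" using ends[OF cL(1), of r] by auto
      then show ?thesis
      proof cases
        case 1
        then show ?thesis using arcD(8)[OF cL(1,2), of 0] cL arcD(1)[OF cL(1)]
          by (intro bexI[of _ "((c, L), False)"]) (auto simp: ends_at_def from_end_def)
      next
        case 2
        then show ?thesis using arcD(8)[OF cL(1,2), of L] cL arcD(1)[OF cL(1)]
          by (intro bexI[of _ "((c, L), True)"]) (auto simp: ends_at_def from_end_def)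
      qed
    qed
  qed (use eps ne ray in auto)
  then show ?thesis by blast
qed

lemma slope_sum_vertex:
  assumes v: "v \<in> V" and "\<delta> > 0"
    and out: "\<And>c L s. (c, L) \<in> E \<Longrightarrow> c 0 = v \<Longrightarrow> s \<in> {0..<\<delta>} \<Longrightarrow> f (c s) = f v + of_real s * b (c, L)"
    and into: "\<And>c L s. (c, L) \<in> E \<Longrightarrow> c L = v \<Longrightarrow> s \<in> {0..<\<delta>} \<Longrightarrow> f (c (L - s)) = f v + of_real s * b' (c, L)"
  shows "slope_sum \<Gamma> f v = (\<Sum>(c, L)\<in>E. (if c 0 = v then b (c, L) else 0) + (if c L = v then b' (c, L) else 0))"
proof -
  obtain \<epsilon> where ch: "ray_chart \<Gamma> v (ends_at v) from_end \<epsilon>" using ray_chart_vertex[OF v] by blast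
  define B where "B = (\<lambda>x :: ((real \<Rightarrow> 'a) \<times> real) \<times> bool. if snd x then b' (fst x) else b (fst x))"
  have "linear_rays (ends_at v) from_end \<delta> f v B"
    unfolding linear_rays_def using out into
    by (auto simp: ends_at_def from_end_def B_def split: if_splits)
  then have "slope_sum \<Gamma> f v = (\<Sum>x\<in>ends_at v. B x)"
    using slope_sum_eq[OF _ ch _ assms(2)] v V_subset by blast
  also have "ends_at v = {e\<in>E. fst e 0 = v} \<times> {False} \<union> {e\<in>E. fst e (snd e) = v} \<times> {True}"
    by (auto simp: ends_at_def split: if_splits)
  also have "(\<Sum>x\<in>\<dots>. B x) = (\<Sum>e\<in>{e\<in>E. fst e 0 = v}. b e) + (\<Sum>e\<in>{e\<in>E. fst e (snd e) = v}. b' e)"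
  proof (subst sum.union_disjoint)
    have "(\<Sum>x\<in>A \<times> {t}. B x) = (\<Sum>e\<in>A. B (e, t))" for A t
      by (rule sum.reindex_bij_witness[of _ "\<lambda>e. (e, t)" fst]) auto
    then show "sum B ({e \<in> E. fst e 0 = v} \<times> {False}) + sum B ({e \<in> E. fst e (snd e) = v} \<times> {True}) =
      (\<Sum>e\<in>{e\<in>E. fst e 0 = v}. b e) + (\<Sum>e\<in>{e\<in>E. fst e (snd e) = v}. b' e)"
      by (simp add: B_def)
  qed (use finite_E in auto)
  also have "\<dots> = (\<Sum>e\<in>E. (if fst e 0 = v then b e else 0) + (if fst e (snd e) = v then b' e else 0))"
    using finite_E by (simp add: sum.distrib sum.inter_filter)
  finally show ?thesis by (simp add: case_prod_beta cong: if_cong)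
qed

lemma slope_sum_interior:
  assumes cL: "(c, L) \<in> E" "t \<in> {0<..<L}" and "\<delta> > 0"
    and right: "\<And>s. s \<in> {0..<\<delta>} \<Longrightarrow> f (c (t + s)) = f (c t) + of_real s * b"
    and left: "\<And>s. s \<in> {0..<\<delta>} \<Longrightarrow> f (c (t - s)) = f (c t) + of_real s * b'"
  shows "slope_sum \<Gamma> f (c t) = b + b'"
proof -
  obtain \<eta> where eta: "ray_chart \<Gamma> (c t) {-1, 1::real} (\<lambda>\<sigma> u. c (t + \<sigma> * u)) \<eta>"
    using arcD(3)[OF cL(1)] cL(2) unfolding open_line_def by blast
  have "linear_rays {-1, 1::real} (\<lambda>\<sigma> u. c (t + \<sigma> * u)) \<delta> f (c t) (\<lambda>\<sigma>. if \<sigma> = 1 then b else b')"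
    unfolding linear_rays_def using right left by auto
  then have "slope_sum \<Gamma> f (c t) = (\<Sum>\<sigma>\<in>{-1, 1::real}. if \<sigma> = 1 then b else b')"
    using slope_sum_eq[OF _ eta _ assms(3)] arcD(7)[OF cL(1), of t] cL(2) by auto
  then show ?thesis by simp
qed

text \<open>The arcs are cut at the points of \<open>W\<close>; the resulting pieces witness piecewise affinity.\<close>

lemma CPA_I:
  assumes "f \<in> extensional \<Gamma>" "continuous_on \<Gamma> f" "finite W"
    and aff: "\<And>c L a b. (c, L) \<in> E \<Longrightarrow> 0 \<le> a \<Longrightarrow> a < b \<Longrightarrow> b \<le> L \<Longrightarrow> (\<And>t. t \<in> {a<..<b} \<Longrightarrow> c t \<notin> W) \<Longrightarrow>
      \<exists>\<alpha> \<beta>. \<forall>t\<in>{a..b}. f (c t) = \<alpha> + of_real t * \<beta>"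
  shows "f \<in> CPA \<Gamma>"
proof -
  define T where "T = (\<lambda>(c :: real \<Rightarrow> 'a, L). {0, L} \<union> {t\<in>{0..L}. c t \<in> W})"
  have T: "finite (T (c, L))" "0 \<in> T (c, L)" "L \<in> T (c, L)" if "(c, L) \<in> E" for c L
  proof -
    have "finite (c ` {t\<in>{0..L}. c t \<in> W})" using assms(3) by (rule finite_subset[rotated]) auto
    moreover have "inj_on c {t\<in>{0..L}. c t \<in> W}"
      using isometric_arc_inj[OF arcD(2)[OF that]] by (rule inj_on_subset) auto
    ultimately show "finite (T (c, L))" by (auto simp: T_def dest: finite_imageD)
  qed (auto simp: T_def)
  define S where "S = (\<lambda>((c :: real \<Rightarrow> 'a, L :: real), a :: real, b). (\<lambda>t. c (a + t), b - a)) `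
    {((c, L), a, b). (c, L) \<in> E \<and> consecutive (T (c, L)) a b}"
  have "finite {((c, L), a, b). (c, L) \<in> E \<and> consecutive (T (c, L)) a b}"
    by (rule finite_subset[of _ "SIGMA e:E. T e \<times> T e"])
       (use finite_E T in \<open>auto simp: consecutive_def intro!: finite_SigmaI\<close>)
  then have finS: "finite S" by (simp add: S_def)
  have mem: "(\<exists>c L a b. (c, L) \<in> E \<and> consecutive (T (c, L)) a b \<and> 0 \<le> a \<and> b \<le> L \<and> a < b \<and> d = (\<lambda>t. c (a + t)) \<and> M = b - a)"
    if "(d, M) \<in> S" for d M
  proof -
    obtain c L a b where *: "(c, L) \<in> E" "consecutive (T (c, L)) a b" "d = (\<lambda>t. c (a + t))" "M = b - a"
      using \<open>(d, M) \<in> S\<close> by (auto simp: S_def)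
    moreover have "0 \<le> a" "b \<le> L" "a < b" using * arcD(1)[OF *(1)] by (auto simp: consecutive_def T_def)
    ultimately show ?thesis by blast
  qed
  have "\<Gamma> = (\<Union>(d, M)\<in>S. d ` {0..M})"
  proof
    show "\<Gamma> \<subseteq> (\<Union>(d, M)\<in>S. d ` {0..M})"
    proof
      fix x assume "x \<in> \<Gamma>"
      then obtain c L s where cL: "(c, L) \<in> E" "s \<in> {0..L}" "x = c s" using graph_eq by blast
      obtain a b where ab: "consecutive (T (c, L)) a b" "s \<in> {a..b}"
        using consecutive_around[OF T[OF cL(1)] arcD(1)[OF cL(1)] cL(2)] by blast
      have "(\<lambda>t. c (a + t), b - a) \<in> S" unfolding S_def using cL ab by force
      moreover have "x \<in> (\<lambda>t. c (a + t)) ` {0..b - a}" using cL ab by (auto intro!: image_eqI[of _ _ "s - a"])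
      ultimately show "x \<in> (\<Union>(d, M)\<in>S. d ` {0..M})" by blast
    qed
    show "(\<Union>(d, M)\<in>S. d ` {0..M}) \<subseteq> \<Gamma>" using mem arcD(7) by fastforce
  qed
  moreover have "(\<forall>s\<in>{0..M}. \<forall>t\<in>{0..M}. dist (d s) (d t) = \<bar>s - t\<bar>) \<and> (\<exists>a b. \<forall>t\<in>{0..M}. f (d t) = a + of_real t * b)"
    if "(d, M) \<in> S" for d M
  proof -
    obtain c L a b where *: "(c, L) \<in> E" "consecutive (T (c, L)) a b" "0 \<le> a" "b \<le> L" "a < b" "d = (\<lambda>t. c (a + t))" "M = b - a"
      using mem[OF \<open>(d, M) \<in> S\<close>] by blast
    have "c t \<notin> W" if "t \<in> {a<..<b}" for t
    proof -
      have "t \<notin> T (c, L)" "t \<in> {0..L}" using *(2-5) that by (auto simp: consecutive_def)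
      then show ?thesis by (simp add: T_def)
    qed
    from aff[OF *(1,3,5,4) this] obtain \<alpha> \<beta> where ab: "\<forall>t\<in>{a..b}. f (c t) = \<alpha> + of_real t * \<beta>" by blast
    have "f (d t) = (\<alpha> + of_real a * \<beta>) + of_real t * \<beta>" if "t \<in> {0..M}" for t
    proof -
      have "f (d t) = \<alpha> + of_real (a + t) * \<beta>" using ab that * by auto
      then show ?thesis by (simp add: algebra_simps)
    qed
    then show ?thesis using *(3-7) arcD(8)[OF *(1)] by (intro conjI ballI) (auto intro!: exI)
  qed
  ultimately show ?thesis unfolding CPA_def using assms(1,2) finS
    by (intro CollectI conjI exI[of _ S]) auto
qed

end

section \<open>The Green kernel of a segment\<close>

text \<open>The Green function of \<open>-d\<^sup>2/ds\<^sup>2\<close> on \<open>[0, L]\<close> with boundary values \<open>0\<close>, which is also the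
  covariance of the Brownian bridge.\<close>

definition green :: "real \<Rightarrow> real \<Rightarrow> real \<Rightarrow> real" where
  "green L s t = min s t - s * t / L"

lemma green_commute: "green L s t = green L t s"
  by (simp add: green_def min.commute mult.commute)

lemma green_boundary: "0 \<le> t \<Longrightarrow> green L 0 t = 0" "t \<le> L \<Longrightarrow> L > 0 \<Longrightarrow> green L L t = 0"
  by (auto simp: green_def)

lemma has_integral_step:
  fixes L s :: real
  assumes "0 \<le> s" "s \<le> L"
  shows "((\<lambda>u. of_bool (u \<le> s)) has_integral s) {0..L}"
proof -
  have "((\<lambda>_. 1::real) has_integral (s - 0)) {0..s}"
    using has_integral_const_real[of "1::real" 0 s] assms by simp
  then have "((\<lambda>u. if u \<in> {0..s} then 1 else 0) has_integral s) {0..L}"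
    using assms by (subst has_integral_restrict) auto
  then show ?thesis by (rule has_integral_eq[rotated]) auto
qed

text \<open>\<open>green\<close> is the Gram kernel of the centred step functions: this is its positivity.\<close>

lemma green_has_integral:
  assumes "L > 0" "s \<in> {0..L}" "t \<in> {0..L}"
  shows "((\<lambda>u. (of_bool (u \<le> s) - s / L) * (of_bool (u \<le> t) - t / L)) has_integral green L s t) {0..L}"
proof -
  have "((\<lambda>u. (of_bool (u \<le> min s t) - (t / L) * of_bool (u \<le> s)) - (s / L) * of_bool (u \<le> t) + s * t / L\<^sup>2)
      has_integral (min s t - (t / L) * s) - (s / L) * t + (s * t / L\<^sup>2) * (L - 0)) {0..L}"
    by (intro has_integral_add has_integral_diff has_integral_mult_right has_integral_step)
       (use assms has_integral_const_real[of "s * t / L\<^sup>2" 0 L] in \<open>auto simp: mult.commute\<close>)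
  moreover have "(min s t - (t / L) * s) - (s / L) * t + (s * t / L\<^sup>2) * (L - 0) = green L s t"
    using assms(1) by (simp add: green_def power2_eq_square field_simps)
  moreover have "(of_bool (u \<le> min s t) - (t / L) * of_bool (u \<le> s)) - (s / L) * of_bool (u \<le> t) + s * t / L\<^sup>2 =
      (of_bool (u \<le> s) - s / L) * (of_bool (u \<le> t) - t / L)" for u
  proof -
    have "s * t / L\<^sup>2 = (s / L) * (t / L)" by (simp add: power2_eq_square)
    then show ?thesis by (auto simp: algebra_simps)
  qed
  ultimately show ?thesis by simp
qed

lemma green_psd:
  fixes a :: "'i \<Rightarrow> real"
  assumes "finite I" "L > 0" "\<And>i. i \<in> I \<Longrightarrow> s i \<in> {0..L}"
  shows "(\<Sum>i\<in>I. \<Sum>j\<in>I. a i * a j * green L (s i) (s j)) \<ge> 0"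
proof (rule has_integral_nonneg)
  show "((\<lambda>u. \<Sum>i\<in>I. \<Sum>j\<in>I. a i * a j * ((of_bool (u \<le> s i) - s i / L) * (of_bool (u \<le> s j) - s j / L)))
      has_integral (\<Sum>i\<in>I. \<Sum>j\<in>I. a i * a j * green L (s i) (s j))) {0..L}"
    by (intro has_integral_sum has_integral_mult_right green_has_integral) (use assms in auto)
  fix u :: real
  have "(\<Sum>i\<in>I. \<Sum>j\<in>I. a i * a j * ((of_bool (u \<le> s i) - s i / L) * (of_bool (u \<le> s j) - s j / L))) =
     (\<Sum>i\<in>I. a i * (of_bool (u \<le> s i) - s i / L))\<^sup>2"
    by (simp add: power2_eq_square sum_product algebra_simps)
  then show "0 \<le> (\<Sum>i\<in>I. \<Sum>j\<in>I. a i * a j * ((of_bool (u \<le> s i) - s i / L) * (of_bool (u \<le> s j) - s j / L)))"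
    by simp
qed

lemma green_slopes:
  assumes "t0 \<in> {0<..<L}" "t \<in> {0<..<L}"
  shows "\<exists>\<delta>>0. \<exists>b b'. (\<forall>u\<in>{0..<\<delta>}. green L (t0 + u) t = green L t0 t + u * b) \<and>
    (\<forall>u\<in>{0..<\<delta>}. green L (t0 - u) t = green L t0 t + u * b') \<and> b + b' = - of_bool (t0 = t)"
proof -
  consider "t0 < t" | "t0 > t" | "t0 = t" by linarith
  then show ?thesis
  proof cases
    case 1
    then show ?thesis
      by (intro exI[of _ "t - t0"] conjI exI[of _ "1 - t / L"] exI[of _ "- (1 - t / L)"])
         (auto simp: green_def min_def algebra_simps diff_divide_distrib add_divide_distrib)
  next
    case 2
    then show ?thesis
      by (intro exI[of _ "t0 - t"] conjI exI[of _ "- (t / L)"] exI[of _ "t / L"])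
         (auto simp: green_def min_def algebra_simps diff_divide_distrib add_divide_distrib)
  next
    case 3
    then show ?thesis
      by (intro exI[of _ 1] conjI exI[of _ "- (t / L)"] exI[of _ "- (1 - t / L)"])
         (auto simp: green_def min_def algebra_simps diff_divide_distrib add_divide_distrib)
  qed
qed

section \<open>The kernel of a metrized graph\<close>

context metrized_graph_arcs
begin

lemma V_nonempty: "V \<noteq> {}"
  using nonempty graph_eq arcD(4) by fastforce

definition base :: 'a where "base = (SOME v. v \<in> V)"

lemma base_in_V: "base \<in> V" unfolding base_def using V_nonempty by (simp add: some_in_eq)

text \<open>The matrix of \<open>f \<mapsto> (\<Sum>e. (difference of f along e)\<^sup>2 / length e) + (f base)\<^sup>2\<close>. The first sum
  is the discrete Dirichlet form; the last term removes the constants from its kernel.\<close>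

definition grounded_laplacian :: "'a \<Rightarrow> 'a \<Rightarrow> real" where
  "grounded_laplacian v w =
     (\<Sum>(c, L)\<in>E. (of_bool (v = c 0) - of_bool (v = c L)) * (of_bool (w = c 0) - of_bool (w = c L)) / L) +
     of_bool (v = base) * of_bool (w = base)"

lemma sum_of_bool:
  assumes "v \<in> V"
  shows "(\<Sum>w\<in>V. (f w :: real) * of_bool (w = v)) = f v" "(\<Sum>w\<in>V. of_bool (w = v) * (f w :: real)) = f v"
proof -
  show *: "(\<Sum>w\<in>V. f w * of_bool (w = v)) = f v"
    using finite_V assms by (simp add: of_bool_def if_distrib cong: if_cong)
  then show "(\<Sum>w\<in>V. of_bool (w = v) * f w) = f v" by (simp add: mult.commute)
qed

lemma grounded_laplacian_apply:
  "(\<Sum>w\<in>V. grounded_laplacian v w * f w) =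
    (\<Sum>(c, L)\<in>E. (of_bool (v = c 0) - of_bool (v = c L)) * (f (c 0) - f (c L)) / L) + of_bool (v = base) * f base"
proof -
  have "(\<Sum>w\<in>V. grounded_laplacian v w * f w) =
     (\<Sum>w\<in>V. \<Sum>(c, L)\<in>E. (of_bool (v = c 0) - of_bool (v = c L)) / L * (of_bool (w = c 0) * f w - of_bool (w = c L) * f w)) +
     (\<Sum>w\<in>V. of_bool (v = base) * (of_bool (w = base) * f w))"
    unfolding grounded_laplacian_def sum.distrib[symmetric]
    by (intro sum.cong refl) (simp add: distrib_right sum_distrib_right sum_distrib_left case_prod_beta
        algebra_simps add_divide_distrib diff_divide_distrib)
  also have "(\<Sum>w\<in>V. of_bool (v = base) * (of_bool (w = base) * f w)) = of_bool (v = base) * f base"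
    by (simp add: sum_distrib_left[symmetric] sum_of_bool base_in_V del: of_bool_eq_0_iff mult_eq_0_iff)
  also have "(\<Sum>w\<in>V. \<Sum>(c, L)\<in>E. (of_bool (v = c 0) - of_bool (v = c L)) / L * (of_bool (w = c 0) * f w - of_bool (w = c L) * f w)) =
     (\<Sum>e\<in>E. (of_bool (v = fst e 0) - of_bool (v = fst e (snd e))) / snd e *
        (\<Sum>w\<in>V. of_bool (w = fst e 0) * f w - of_bool (w = fst e (snd e)) * f w))"
    by (subst sum.swap) (simp add: case_prod_beta sum_distrib_left)
  also have "\<dots> = (\<Sum>e\<in>E. (of_bool (v = fst e 0) - of_bool (v = fst e (snd e))) / snd e * (f (fst e 0) - f (fst e (snd e))))"
    by (intro sum.cong refl) (use arcD(4,5) in \<open>auto simp: sum_subtractf sum_of_bool\<close>)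
  finally show ?thesis by (simp add: case_prod_beta)
qed

lemma grounded_laplacian_quadratic:
  "(\<Sum>v\<in>V. \<Sum>w\<in>V. f v * f w * grounded_laplacian v w) = (\<Sum>(c, L)\<in>E. (f (c 0) - f (c L))\<^sup>2 / L) + (f base)\<^sup>2"
proof -
  have "(\<Sum>v\<in>V. \<Sum>w\<in>V. f v * f w * grounded_laplacian v w) = (\<Sum>v\<in>V. f v * (\<Sum>w\<in>V. grounded_laplacian v w * f w))"
    by (simp add: sum_distrib_left algebra_simps)
  also have "\<dots> = (\<Sum>v\<in>V. \<Sum>e\<in>E. (f (fst e 0) - f (fst e (snd e))) / snd e * (f v * of_bool (v = fst e 0) - f v * of_bool (v = fst e (snd e))))
      + (\<Sum>v\<in>V. f v * of_bool (v = base) * f base)"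
    unfolding grounded_laplacian_apply sum.distrib[symmetric]
    by (intro sum.cong refl) (simp add: distrib_left sum_distrib_left case_prod_beta algebra_simps
        add_divide_distrib diff_divide_distrib)
  also have "(\<Sum>v\<in>V. f v * of_bool (v = base) * f base) = (f base)\<^sup>2"
    by (simp add: sum_distrib_right[symmetric] sum_of_bool base_in_V power2_eq_square del: of_bool_eq_0_iff mult_eq_0_iff)
  also have "(\<Sum>v\<in>V. \<Sum>e\<in>E. (f (fst e 0) - f (fst e (snd e))) / snd e * (f v * of_bool (v = fst e 0) - f v * of_bool (v = fst e (snd e)))) =
     (\<Sum>e\<in>E. (f (fst e 0) - f (fst e (snd e))) / snd e * (\<Sum>v\<in>V. f v * of_bool (v = fst e 0) - f v * of_bool (v = fst e (snd e))))"
    by (subst sum.swap) (simp add: sum_distrib_left)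
  also have "\<dots> = (\<Sum>e\<in>E. (f (fst e 0) - f (fst e (snd e)))\<^sup>2 / snd e)"
    by (intro sum.cong refl) (use arcD(4,5) in \<open>auto simp: sum_subtractf sum_of_bool power2_eq_square\<close>)
  finally show ?thesis by (simp add: case_prod_beta)
qed

text \<open>The arcs on which \<open>f\<close> has the value that it has at \<open>v\<close>, and the other arcs, are two closed
  sets without a common point, so by connectedness one of them is empty.\<close>

lemma equal_along_arcs_imp_constant:
  assumes eq: "\<And>c L. (c, L) \<in> E \<Longrightarrow> f (c 0) = f (c L)" and vw: "v \<in> V" "w \<in> V"
  shows "f v = f w"
proof (rule ccontr)
  assume ne: "f v \<noteq> f w"
  define part where "part S = (\<Union>(c, L)\<in>{(c, L)\<in>E. f (c 0) \<in> S}. c ` {0..L})" for S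
  have closed: "closed (part S)" for S unfolding part_def
    using finite_E isometric_arc_compact[OF arcD(2)]
    by (intro closed_UN) (auto intro: compact_imp_closed finite_subset[of _ E])
  have vertex: "f (c 0) = f u" if "(c, L) \<in> E" "s \<in> {0..L}" "c s = u" "u \<in> V" for c L s u
    using arc_vertex_iff[OF that(1,2)] that eq[OF that(1)] by auto
  have in_part: "u \<in> part S" if u: "u \<in> V" "f u \<in> S" for u S
  proof -
    have "u \<in> \<Gamma>" using u V_subset by auto
    then obtain c L s where "(c, L) \<in> E" "s \<in> {0..L}" "u = c s" using graph_eq by blast
    moreover from this have "f (c 0) \<in> S" using vertex[of c L s u] u by simp
    ultimately show ?thesis unfolding part_def by blast
  qed
  have sub: "part S \<subseteq> \<Gamma>" for S unfolding part_def using graph_eq by blast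
  have "part {f v} \<inter> part (- {f v}) = {}"
  proof (rule ccontr)
    assume "part {f v} \<inter> part (- {f v}) \<noteq> {}"
    then obtain x where "x \<in> part {f v}" "x \<in> part (- {f v})" by blast
    then obtain c L s d M t where "(c, L) \<in> E" "s \<in> {0..L}" "x = c s" "(d, M) \<in> E" "t \<in> {0..M}" "x = d t"
      "f (c 0) = f v" "f (d 0) \<noteq> f v" unfolding part_def by blast
    then have cd: "(c, L) \<in> E" "s \<in> {0..L}" "(d, M) \<in> E" "t \<in> {0..M}" "c s = d t"
      "f (c 0) = f v" "f (d 0) \<noteq> f v" by simp_all
    show False
    proof (cases "c s \<in> V")
      case True
      then show ?thesis using vertex[OF cd(1,2) refl] vertex[OF cd(3,4) refl] cd by simp
    next
      case False
      then have "s \<in> {0<..<L}" "t \<in> {0<..<M}"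
        using arc_vertex_iff[OF cd(1,2)] arc_vertex_iff[OF cd(3,4)] cd by auto
      then show ?thesis using arcs_disjoint[OF cd(1,3) _ _ cd(5)] cd by auto
    qed
  qed
  moreover have "\<Gamma> \<subseteq> part {f v} \<union> part (- {f v})"
    using graph_eq unfolding part_def by blast
  ultimately have "part {f v} \<inter> \<Gamma> = {} \<or> part (- {f v}) \<inter> \<Gamma> = {}"
    using connected closed unfolding connected_closed by blast
  moreover have "v \<in> part {f v}" "w \<in> part (- {f v})" using in_part vw ne by auto
  ultimately show False using sub by blast
qed

lemma vertex_kernel_exists:
  "\<exists>K. (\<forall>a\<in>V. \<forall>c\<in>V. (\<Sum>b\<in>V. grounded_laplacian a b * K b c) = (if a = c then 1 else 0)) \<and>
    (\<forall>a\<in>V. \<forall>b\<in>V. K a b = K b a) \<and> (\<forall>f. (\<Sum>a\<in>V. \<Sum>b\<in>V. f a * f b * K a b) \<ge> (0::real))"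
proof (rule positive_definite_inverse[OF finite_V])
  show "grounded_laplacian a b = grounded_laplacian b a" for a b
    by (simp add: grounded_laplacian_def mult.commute)
  have nonneg: "(\<Sum>(c, L)\<in>E. (f (c 0) - f (c L))\<^sup>2 / L) \<ge> 0" for f :: "'a \<Rightarrow> real"
    using arcD(1) by (intro sum_nonneg) (auto intro!: divide_nonneg_pos)
  show "(\<Sum>a\<in>V. \<Sum>b\<in>V. f a * f b * grounded_laplacian a b) \<ge> 0" for f
    using nonneg[of f] by (simp add: grounded_laplacian_quadratic)
  fix f :: "'a \<Rightarrow> real" and a
  assume "(\<Sum>a\<in>V. \<Sum>b\<in>V. f a * f b * grounded_laplacian a b) = 0" and a: "a \<in> V"
  then have zero: "(\<Sum>(c, L)\<in>E. (f (c 0) - f (c L))\<^sup>2 / L) = 0" "f base = 0"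
    using nonneg[of f] by (auto simp: grounded_laplacian_quadratic add_nonneg_eq_0_iff)
  have "\<forall>e\<in>E. (case e of (c, L) \<Rightarrow> (f (c 0) - f (c L))\<^sup>2 / L) = 0"
    using zero(1) arcD(1) by (subst (asm) sum_nonneg_eq_0_iff[OF finite_E]) (auto intro!: divide_nonneg_pos)
  then have "f (c 0) = f (c L)" if "(c, L) \<in> E" for c L
    using that arcD(1)[OF that] by fastforce
  then show "f a = 0" using equal_along_arcs_imp_constant[of f a base] a base_in_V zero by simp
qed

definition vertex_kernel :: "'a \<Rightarrow> 'a \<Rightarrow> real" where
  "vertex_kernel = (SOME K. (\<forall>a\<in>V. \<forall>c\<in>V. (\<Sum>b\<in>V. grounded_laplacian a b * K b c) = (if a = c then 1 else 0)) \<and>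
    (\<forall>a\<in>V. \<forall>b\<in>V. K a b = K b a) \<and> (\<forall>f. (\<Sum>a\<in>V. \<Sum>b\<in>V. f a * f b * K a b) \<ge> (0::real)))"

lemma vertex_kernel_inverse:
    "a \<in> V \<Longrightarrow> c \<in> V \<Longrightarrow> (\<Sum>b\<in>V. grounded_laplacian a b * vertex_kernel b c) = of_bool (a = c)"
  and vertex_kernel_commute: "a \<in> V \<Longrightarrow> b \<in> V \<Longrightarrow> vertex_kernel a b = vertex_kernel b a"
  and vertex_kernel_psd: "(\<Sum>a\<in>V. \<Sum>b\<in>V. f a * f b * vertex_kernel a b) \<ge> 0"
  using someI_ex[OF vertex_kernel_exists] unfolding vertex_kernel_def[symmetric] by auto

text \<open>Summing \<open>vertex_kernel_inverse\<close> over \<open>a\<close> shows that \<open>vertex_kernel base c = 1\<close>, because the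
  discrete Laplacian of any function has total mass \<open>0\<close>.\<close>

lemma vertex_kernel_laplacian:
  assumes "v \<in> V" "y \<in> V"
  shows "(\<Sum>(c, L)\<in>E. (of_bool (v = c 0) - of_bool (v = c L)) * (vertex_kernel (c 0) y - vertex_kernel (c L) y) / L) =
    of_bool (v = y) - of_bool (v = base)"
proof -
  define D where "D v = (\<Sum>(c, L)\<in>E. (of_bool (v = c 0) - of_bool (v = c L)) * (vertex_kernel (c 0) y - vertex_kernel (c L) y) / L)" for v
  have D: "D v + of_bool (v = base) * vertex_kernel base y = of_bool (v = y)" if "v \<in> V" for v
    using vertex_kernel_inverse[OF that assms(2)] unfolding grounded_laplacian_apply D_def .
  have "(\<Sum>v\<in>V. D v) = (\<Sum>e\<in>E. \<Sum>v\<in>V. (of_bool (v = fst e 0) - of_bool (v = fst e (snd e))) * ((vertex_kernel (fst e 0) y - vertex_kernel (fst e (snd e)) y) / snd e))"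
    unfolding D_def by (subst sum.swap) (simp add: case_prod_beta)
  also have "\<dots> = 0"
  proof (rule sum.neutral, rule ballI)
    fix e assume "e \<in> E"
    then have "fst e 0 \<in> V" "fst e (snd e) \<in> V" using arcD(4,5)[of "fst e" "snd e"] by auto
    then have "(\<Sum>v\<in>V. of_bool (v = fst e 0) - of_bool (v = fst e (snd e)) :: real) = 0"
      using sum_of_bool(1)[of _ "\<lambda>_. 1"] by (simp add: sum_subtractf)
    then show "(\<Sum>v\<in>V. (of_bool (v = fst e 0) - of_bool (v = fst e (snd e))) * ((vertex_kernel (fst e 0) y - vertex_kernel (fst e (snd e)) y) / snd e)) = 0"
      by (simp only: sum_distrib_right[symmetric] mult_zero_left)
  qed
  finally have "(\<Sum>v\<in>V. D v + of_bool (v = base) * vertex_kernel base y) = vertex_kernel base y"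
    using sum_of_bool(2)[OF base_in_V, of "\<lambda>_. vertex_kernel base y"] by (simp add: sum.distrib)
  moreover have "(\<Sum>v\<in>V. D v + of_bool (v = base) * vertex_kernel base y) = 1"
    using D sum_of_bool(1)[OF assms(2), of "\<lambda>_. 1"] by simp
  ultimately show ?thesis using D[OF assms(1)] unfolding D_def by simp
qed

lemma arc_interiors:
  assumes "(c, L) \<in> E" "(d, M) \<in> E" "(c, L) \<noteq> (d, M)" "s \<in> {0<..<L}"
  shows "c s \<notin> d ` {0<..<M}"
  using arcs_disjoint[OF assms(1,2,4)] assms(3) by blast

definition coord :: "(real \<Rightarrow> 'a) \<times> real \<Rightarrow> 'a \<Rightarrow> real" where
  "coord = (\<lambda>(c, L) x. inv_into {0..L} c x)"

lemma coord_arc: "(c, L) \<in> E \<Longrightarrow> t \<in> {0..L} \<Longrightarrow> coord (c, L) (c t) = t"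
  using isometric_arc_inj[OF arcD(2)] by (simp add: coord_def inv_into_f_f)

text \<open>The barycentric coordinates: \<open>hat v\<close> is affine on each arc, \<open>1\<close> at \<open>v\<close> and \<open>0\<close> at all other
  vertices.\<close>

definition hat :: "'a \<Rightarrow> 'a \<Rightarrow> real" where
  "hat v x = of_bool (x = v) + (\<Sum>(c, L)\<in>E. if x \<in> c ` {0<..<L}
     then (1 - coord (c, L) x / L) * of_bool (c 0 = v) + coord (c, L) x / L * of_bool (c L = v) else 0)"

lemma hat_arc:
  assumes E: "(c, L) \<in> E" "t \<in> {0..L}" and v: "v \<in> V"
  shows "hat v (c t) = (1 - t / L) * of_bool (c 0 = v) + t / L * of_bool (c L = v)"
proof (cases "c t \<in> V")
  case True
  then have "c t \<notin> d ` {0<..<M}" if "(d, M) \<in> E" for d M using arcD(6)[OF that] by auto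
  then have "hat v (c t) = of_bool (c t = v)" unfolding hat_def by (auto intro!: sum.neutral)
  moreover have "t = 0 \<or> t = L" using arc_vertex_iff[OF E] True by simp
  ultimately show ?thesis using arcD(1)[OF E(1)] by auto
next
  case False
  then have t: "t \<in> {0<..<L}" using arc_vertex_iff[OF E] E(2) by auto
  have "hat v (c t) = (\<Sum>e\<in>E. if e = (c, L) then (1 - t / L) * of_bool (c 0 = v) + t / L * of_bool (c L = v) else 0)"
    unfolding hat_def
  proof -
    have "(case e of (d, M) \<Rightarrow> if c t \<in> d ` {0<..<M} then (1 - coord (d, M) (c t) / M) * of_bool (d 0 = v) + coord (d, M) (c t) / M * of_bool (d M = v) else 0)
       = (if e = (c, L) then (1 - t / L) * of_bool (c 0 = v) + t / L * of_bool (c L = v) else 0)" if e: "e \<in> E" for e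
    proof (cases "e = (c, L)")
      case True
      then show ?thesis using t coord_arc[OF E] by auto
    next
      case ne: False
      obtain d M where [simp]: "e = (d, M)" by fastforce
      have "(d, M) \<in> E" "(c, L) \<noteq> (d, M)" using e ne by auto
      then have "c t \<notin> d ` {0<..<M}" by (rule arc_interiors[OF E(1) _ _ t])
      then show ?thesis by (subst if_not_P[OF ne]) simp
    qed
    moreover have "c t \<noteq> v" using False v by auto
    ultimately show "of_bool (c t = v) + (\<Sum>(d, M)\<in>E. if c t \<in> d ` {0<..<M} then (1 - coord (d, M) (c t) / M) * of_bool (d 0 = v) + coord (d, M) (c t) / M * of_bool (d M = v) else 0)
      = (\<Sum>e\<in>E. if e = (c, L) then (1 - t / L) * of_bool (c 0 = v) + t / L * of_bool (c L = v) else 0)" by simp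
  qed
  then show ?thesis using E(1) finite_E by simp
qed

lemma hat_vertex: "v \<in> V \<Longrightarrow> w \<in> V \<Longrightarrow> hat v w = of_bool (v = w)"
  unfolding hat_def using arcD(6) by (fastforce intro!: sum.neutral)

lemma sum_hat:
  assumes "x \<in> \<Gamma>" shows "(\<Sum>v\<in>V. hat v x) = 1"
proof -
  obtain c L t where E: "(c, L) \<in> E" "t \<in> {0..L}" "x = c t" using graph_eq assms by blast
  have "(\<Sum>v\<in>V. hat v x) = (1 - t / L) * (\<Sum>v\<in>V. of_bool (c 0 = v)) + t / L * (\<Sum>v\<in>V. of_bool (c L = v))"
    using hat_arc[OF E(1,2)] E(3) by (simp add: sum.distrib sum_distrib_left)
  moreover have "(\<Sum>v\<in>V. of_bool (u = v)) = (1 :: real)" if "u \<in> V" for u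
    using sum_of_bool(1)[OF that, of "\<lambda>_. 1"] by (simp only: mult_1 eq_commute[of u])
  ultimately show ?thesis using arcD(4,5)[OF E(1)] by simp
qed

definition bridge :: "(real \<Rightarrow> 'a) \<times> real \<Rightarrow> 'a \<Rightarrow> 'a \<Rightarrow> real" where
  "bridge = (\<lambda>(c, L) x y. if x \<in> c ` {0..L} \<and> y \<in> c ` {0..L} then green L (coord (c, L) x) (coord (c, L) y) else 0)"

lemma bridge_commute: "bridge e x y = bridge e y x"
  by (auto simp: bridge_def green_commute split: prod.split)

lemma bridge_arc:
  "(c, L) \<in> E \<Longrightarrow> s \<in> {0..L} \<Longrightarrow> t \<in> {0..L} \<Longrightarrow> bridge (c, L) (c s) (c t) = green L s t"
  by (simp add: bridge_def coord_arc)

lemma bridge_off_arc: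
  assumes E: "(c, L) \<in> E" and x: "x \<notin> c ` {0<..<L}"
  shows "bridge (c, L) x y = 0" "bridge (c, L) y x = 0"
proof -
  show "bridge (c, L) x y = 0"
  proof (cases "x \<in> c ` {0..L} \<and> y \<in> c ` {0..L}")
    case True
    then obtain s t where st: "x = c s" "s \<in> {0..L}" "y = c t" "t \<in> {0..L}" by blast
    then have "s = 0 \<or> s = L" using x by auto
    then show ?thesis using bridge_arc[OF E st(2,4)] st arcD(1)[OF E] green_boundary[of t L] by auto
  qed (auto simp: bridge_def)
  then show "bridge (c, L) y x = 0" by (simp add: bridge_commute)
qed

text \<open>The kernel is the interpolation of its values at the vertices, with the Green kernel of each
  arc added on the diagonal blocks. It is \<open>j\<^sub>\<zeta>\<close> with \<open>\<zeta> = base\<close> up to a constant.\<close>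

definition potential :: "'a \<Rightarrow> 'a \<Rightarrow> real" where
  "potential x y = (\<Sum>v\<in>V. \<Sum>w\<in>V. hat v x * hat w y * vertex_kernel v w) + (\<Sum>e\<in>E. bridge e x y)"

lemma potential_commute: "potential x y = potential y x"
proof -
  have "(\<Sum>v\<in>V. \<Sum>w\<in>V. hat v x * hat w y * vertex_kernel v w) = (\<Sum>v\<in>V. \<Sum>w\<in>V. hat v y * hat w x * vertex_kernel v w)"
    by (subst sum.swap) (auto intro!: sum.cong simp: vertex_kernel_commute)
  then show ?thesis by (simp add: potential_def bridge_commute)
qed

lemma sum_bridge_arc:
  assumes "(c, L) \<in> E" "s \<in> {0..L}"
  shows "(\<Sum>e\<in>E. bridge e (c s) y) = bridge (c, L) (c s) y"
proof -
  have "bridge e (c s) y = (if e = (c, L) then bridge (c, L) (c s) y else 0)" if e: "e \<in> E" for e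
  proof (cases "e = (c, L)")
    case False
    obtain d M where [simp]: "e = (d, M)" by fastforce
    have "c s \<notin> d ` {0<..<M}"
    proof
      assume *: "c s \<in> d ` {0<..<M}"
      then have "c s \<notin> V" using arcD(6)[of d M] e by auto
      then have "s \<in> {0<..<L}" using arc_vertex_iff[OF assms] assms(2) by auto
      moreover have "(d, M) \<in> E" "(c, L) \<noteq> (d, M)" using e False by auto
      ultimately show False using * arc_interiors[OF assms(1)] by blast
    qed
    moreover have "(d, M) \<in> E" using e by simp
    ultimately show ?thesis using bridge_off_arc(1)[of d M "c s" y] by (subst if_not_P[OF False]) simp
  qed simp
  then have "(\<Sum>e\<in>E. bridge e (c s) y) = (\<Sum>e\<in>E. if e = (c, L) then bridge (c, L) (c s) y else 0)"
    by (intro sum.cong) auto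
  then show ?thesis using finite_E assms(1) by simp
qed

lemma potential_vertex:
  assumes "v \<in> V"
  shows "potential v y = (\<Sum>w\<in>V. hat w y * vertex_kernel v w)"
proof -
  have "(\<Sum>e\<in>E. bridge e v y) = 0"
  proof (rule sum.neutral, rule ballI)
    fix e assume "e \<in> E"
    moreover obtain c L where "e = (c, L)" by fastforce
    moreover have "v \<notin> c ` {0<..<L}" if "(c, L) \<in> E" using arcD(6)[OF that] assms by auto
    ultimately show "bridge e v y = 0" using bridge_off_arc(1) by simp
  qed
  moreover have "(\<Sum>u\<in>V. \<Sum>w\<in>V. hat u v * hat w y * vertex_kernel u w) =
      (\<Sum>u\<in>V. of_bool (u = v) * (\<Sum>w\<in>V. hat w y * vertex_kernel u w))"
    using hat_vertex assms by (intro sum.cong refl) (simp add: sum_distrib_left mult.assoc)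
  ultimately show ?thesis using sum_of_bool(2)[OF assms] by (simp add: potential_def)
qed

lemma potential_arc:
  assumes E: "(c, L) \<in> E" "s \<in> {0..L}"
  shows "potential (c s) y = (1 - s / L) * potential (c 0) y + s / L * potential (c L) y + bridge (c, L) (c s) y"
proof -
  have "(\<Sum>u\<in>V. \<Sum>w\<in>V. hat u (c s) * hat w y * vertex_kernel u w) =
     (\<Sum>u\<in>V. ((1 - s / L) * of_bool (c 0 = u) + s / L * of_bool (c L = u)) * (\<Sum>w\<in>V. hat w y * vertex_kernel u w))"
    using hat_arc[OF E] by (intro sum.cong refl) (simp add: sum_distrib_left mult.assoc)
  also have "\<dots> = (1 - s / L) * (\<Sum>u\<in>V. of_bool (u = c 0) * (\<Sum>w\<in>V. hat w y * vertex_kernel u w)) +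
      s / L * (\<Sum>u\<in>V. of_bool (u = c L) * (\<Sum>w\<in>V. hat w y * vertex_kernel u w))"
    by (simp add: distrib_right sum.distrib sum_distrib_left mult.assoc eq_commute[of "c 0"] eq_commute[of "c L"])
  also have "\<dots> = (1 - s / L) * potential (c 0) y + s / L * potential (c L) y"
    using arcD(4,5)[OF E(1)] by (simp add: sum_of_bool potential_vertex)
  finally show ?thesis using sum_bridge_arc[OF E] by (simp add: potential_def)
qed

lemma potential_psd:
  fixes a :: "'i \<Rightarrow> real"
  assumes "finite I"
  shows "(\<Sum>i\<in>I. \<Sum>j\<in>I. a i * a j * potential (x i) (x j)) \<ge> 0"
proof -
  define b where "b v = (\<Sum>i\<in>I. a i * hat v (x i))" for v
  have "(\<Sum>i\<in>I. \<Sum>j\<in>I. a i * a j * (\<Sum>v\<in>V. \<Sum>w\<in>V. hat v (x i) * hat w (x j) * vertex_kernel v w)) =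
     (\<Sum>v\<in>V. \<Sum>w\<in>V. b v * b w * vertex_kernel v w)"
  proof -
    have "(\<Sum>i\<in>I. \<Sum>j\<in>I. a i * a j * (\<Sum>v\<in>V. \<Sum>w\<in>V. hat v (x i) * hat w (x j) * vertex_kernel v w)) =
       (\<Sum>i\<in>I. \<Sum>j\<in>I. \<Sum>v\<in>V. \<Sum>w\<in>V. (a i * hat v (x i)) * (a j * hat w (x j)) * vertex_kernel v w)"
      by (simp add: sum_distrib_left algebra_simps)
    also have "\<dots> = (\<Sum>i\<in>I. \<Sum>v\<in>V. \<Sum>j\<in>I. \<Sum>w\<in>V. (a i * hat v (x i)) * (a j * hat w (x j)) * vertex_kernel v w)"
      by (intro sum.cong refl sum.swap)
    also have "\<dots> = (\<Sum>v\<in>V. \<Sum>i\<in>I. \<Sum>w\<in>V. \<Sum>j\<in>I. (a i * hat v (x i)) * (a j * hat w (x j)) * vertex_kernel v w)"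
      by (subst sum.swap) (intro sum.cong refl sum.swap)
    also have "\<dots> = (\<Sum>v\<in>V. \<Sum>w\<in>V. \<Sum>i\<in>I. \<Sum>j\<in>I. (a i * hat v (x i)) * (a j * hat w (x j)) * vertex_kernel v w)"
      by (intro sum.cong refl sum.swap)
    also have "\<dots> = (\<Sum>v\<in>V. \<Sum>w\<in>V. b v * b w * vertex_kernel v w)"
      unfolding b_def sum_product by (simp add: sum_distrib_right)
    finally show ?thesis .
  qed
  then have 1: "(\<Sum>i\<in>I. \<Sum>j\<in>I. a i * a j * (\<Sum>v\<in>V. \<Sum>w\<in>V. hat v (x i) * hat w (x j) * vertex_kernel v w)) \<ge> 0"
    by (simp add: vertex_kernel_psd)
  have br: "(\<Sum>i\<in>I. \<Sum>j\<in>I. a i * a j * bridge e (x i) (x j)) \<ge> 0" if "e \<in> E" for e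
  proof -
    obtain c L where [simp]: "e = (c, L)" by fastforce
    define I' where "I' = {i\<in>I. x i \<in> c ` {0..L}}"
    have mem: "coord (c, L) (x i) \<in> {0..L}" if "i \<in> I'" for i
    proof -
      obtain t where "t \<in> {0..L}" "x i = c t" using \<open>i \<in> I'\<close> by (auto simp: I'_def)
      then show ?thesis using coord_arc \<open>e \<in> E\<close> by simp
    qed
    have inner: "(\<Sum>j\<in>I. a i * a j * bridge e (x i) (x j)) =
        (if i \<in> I' then \<Sum>j\<in>I'. a i * a j * green L (coord (c, L) (x i)) (coord (c, L) (x j)) else 0)"
      if "i \<in> I" for i
      using assms that by (auto simp: bridge_def I'_def sum.inter_filter intro!: sum.cong)
    have "(\<Sum>i\<in>I. \<Sum>j\<in>I. a i * a j * bridge e (x i) (x j)) =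
        (\<Sum>i\<in>I. if i \<in> I' then \<Sum>j\<in>I'. a i * a j * green L (coord (c, L) (x i)) (coord (c, L) (x j)) else 0)"
      by (rule sum.cong[OF refl]) (fact inner)
    also have "\<dots> = (\<Sum>i\<in>I'. \<Sum>j\<in>I'. a i * a j * green L (coord (c, L) (x i)) (coord (c, L) (x j)))"
    proof -
      have "I \<inter> I' = I'" by (auto simp: I'_def)
      then show ?thesis by (simp only: sum.inter_restrict[OF assms, symmetric])
    qed
    also have "\<dots> \<ge> 0"
      by (rule green_psd) (use assms mem arcD(1) that in \<open>auto simp: I'_def\<close>)
    finally show ?thesis .
  qed
  have "(\<Sum>i\<in>I. \<Sum>j\<in>I. a i * a j * (\<Sum>e\<in>E. bridge e (x i) (x j))) =
      (\<Sum>e\<in>E. \<Sum>i\<in>I. \<Sum>j\<in>I. a i * a j * bridge e (x i) (x j))"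
  proof -
    have "(\<Sum>i\<in>I. \<Sum>j\<in>I. a i * a j * (\<Sum>e\<in>E. bridge e (x i) (x j))) =
        (\<Sum>i\<in>I. \<Sum>e\<in>E. \<Sum>j\<in>I. a i * a j * bridge e (x i) (x j))"
      unfolding sum_distrib_left by (intro sum.cong refl sum.swap)
    also have "\<dots> = (\<Sum>e\<in>E. \<Sum>i\<in>I. \<Sum>j\<in>I. a i * a j * bridge e (x i) (x j))"
      by (rule sum.swap)
    finally show ?thesis .
  qed
  then have 2: "(\<Sum>i\<in>I. \<Sum>j\<in>I. a i * a j * (\<Sum>e\<in>E. bridge e (x i) (x j))) \<ge> 0"
    using br by (simp add: sum_nonneg)
  show ?thesis unfolding potential_def distrib_left sum.distrib using 1 2 by simp
qed

text \<open>The graph is covered by finitely many arcs, which are closed sets, so continuity can be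
  checked in arc coordinates.\<close>

lemma continuous_on_product_of_arcs:
  fixes F :: "'a \<Rightarrow> 'a \<Rightarrow> real"
  assumes "\<And>c L d M. (c, L) \<in> E \<Longrightarrow> (d, M) \<in> E \<Longrightarrow> continuous_on ({0..L} \<times> {0..M}) (\<lambda>p. F (c (fst p)) (d (snd p)))"
  shows "continuous_on (\<Gamma> \<times> \<Gamma>) (\<lambda>p. F (fst p) (snd p))"
proof -
  have "continuous_on (\<Union>(e, e')\<in>E \<times> E. (fst e ` {0..snd e}) \<times> (fst e' ` {0..snd e'})) (\<lambda>p. F (fst p) (snd p))"
  proof (rule continuous_on_closed_Union)
    fix q assume "q \<in> E \<times> E"
    then obtain c L d M where [simp]: "q = ((c, L), (d, M))" and E: "(c, L) \<in> E" "(d, M) \<in> E" by fastforce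
    have compact: "compact (c ` {0..L})" "compact (d ` {0..M})"
      using isometric_arc_compact arcD(2) E by blast+
    then show "closed (case q of (e, e') \<Rightarrow> (fst e ` {0..snd e}) \<times> (fst e' ` {0..snd e'}))"
      by (simp add: closed_Times compact_imp_closed)
    have coords: "continuous_on (c ` {0..L}) (coord (c, L))" "continuous_on (d ` {0..M}) (coord (d, M))"
      using isometric_arc_continuous[OF arcD(2)] coord_arc E by (auto intro!: continuous_on_inv)
    have cont: "continuous_on ((c ` {0..L}) \<times> (d ` {0..M})) (\<lambda>p. (coord (c, L) (fst p), coord (d, M) (snd p)))"
      by (intro continuous_intros continuous_on_compose2[OF coords(1)] continuous_on_compose2[OF coords(2)]) auto
    have "(\<lambda>p. (coord (c, L) (fst p), coord (d, M) (snd p))) ` ((c ` {0..L}) \<times> (d ` {0..M})) \<subseteq> {0..L} \<times> {0..M}"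
      using coord_arc E by auto
    from continuous_on_compose2[OF assms[OF E] cont this]
    have "continuous_on ((c ` {0..L}) \<times> (d ` {0..M}))
       (\<lambda>p. F (c (coord (c, L) (fst p))) (d (coord (d, M) (snd p))))"
      by simp
    then have "continuous_on ((c ` {0..L}) \<times> (d ` {0..M})) (\<lambda>p. F (fst p) (snd p))"
      by (rule continuous_on_eq) (use coord_arc E in auto)
    then show "continuous_on (case q of (e, e') \<Rightarrow> (fst e ` {0..snd e}) \<times> (fst e' ` {0..snd e'})) (\<lambda>p. F (fst p) (snd p))"
      by simp
  qed (use finite_E in auto)
  moreover have "\<Gamma> \<times> \<Gamma> = (\<Union>(e, e')\<in>E \<times> E. (fst e ` {0..snd e}) \<times> (fst e' ` {0..snd e'}))"
    by (subst (1 2) graph_eq) (auto simp: case_prod_beta)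
  ultimately show ?thesis by simp
qed

lemma continuous_on_potential: "continuous_on (\<Gamma> \<times> \<Gamma>) (\<lambda>p. potential (fst p) (snd p))"
proof (rule continuous_on_product_of_arcs)
  fix c L d M assume E: "(c, L) \<in> E" "(d, M) \<in> E"
  have Lpos: "L > 0" "M > 0" using arcD(1) E by auto
  define G where "G = (\<lambda>p :: real \<times> real. (\<Sum>v\<in>V. \<Sum>w\<in>V.
     ((1 - fst p / L) * of_bool (c 0 = v) + fst p / L * of_bool (c L = v)) *
     ((1 - snd p / M) * of_bool (d 0 = w) + snd p / M * of_bool (d M = w)) * vertex_kernel v w) +
     (if (c, L) = (d, M) then green L (fst p) (snd p) else 0))"
  have "continuous_on ({0..L} \<times> {0..M}) (\<lambda>p. if (c, L) = (d, M) then green L (fst p) (snd p) else 0)"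
    unfolding green_def using Lpos by (cases "(c, L) = (d, M)") (auto intro!: continuous_intros)
  then have "continuous_on ({0..L} \<times> {0..M}) G"
    unfolding G_def using Lpos by (intro continuous_on_add) (auto intro!: continuous_intros)
  moreover have "G p = potential (c (fst p)) (d (snd p))" if "p \<in> {0..L} \<times> {0..M}" for p
  proof -
    have st: "fst p \<in> {0..L}" "snd p \<in> {0..M}" using that by auto
    have "bridge (c, L) (c (fst p)) (d (snd p)) = (if (c, L) = (d, M) then green L (fst p) (snd p) else 0)"
      using bridge_arc[OF E(1), of "fst p" "snd p"] st sum_bridge_arc[OF E(1) st(1), of "d (snd p)"] sum_bridge_arc[OF E(2) st(2), of "c (fst p)"]
    proof (cases "(c, L) = (d, M)")
      case False
      have "d (snd p) \<notin> c ` {0<..<L}"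
      proof
        assume *: "d (snd p) \<in> c ` {0<..<L}"
        then have "d (snd p) \<notin> V" using arcD(6)[OF E(1)] by auto
        then have "snd p \<in> {0<..<M}" using arc_vertex_iff[OF E(2) st(2)] st(2) by auto
        then show False using * arc_interiors[OF E(2,1)] False by blast
      qed
      then show ?thesis using bridge_off_arc(2)[OF E(1)] by (subst if_not_P[OF False]) simp
    qed auto
    then show ?thesis
      unfolding potential_def sum_bridge_arc[OF E(1) st(1)] G_def
      using hat_arc[OF E(1) st(1)] hat_arc[OF E(2) st(2)] by simp
  qed
  ultimately show "continuous_on ({0..L} \<times> {0..M}) (\<lambda>p. potential (c (fst p)) (d (snd p)))"
    by (rule continuous_on_eq)
qed

lemma continuous_on_potential_section:
  assumes "y \<in> \<Gamma>" shows "continuous_on \<Gamma> (\<lambda>x. potential x y)"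
proof -
  have "continuous_on \<Gamma> (\<lambda>x. (x, y))" by (intro continuous_intros)
  from continuous_on_compose2[OF continuous_on_potential this] show ?thesis using assms by auto
qed

end

context metrized_graph_arcs
begin

section \<open>The Laplacian of the kernel\<close>

lemma potential_affine:
  assumes E: "(c, L) \<in> E" and ab: "0 \<le> a" "b \<le> L" and no: "\<And>t. t \<in> {a<..<b} \<Longrightarrow> c t \<noteq> y"
  shows "\<exists>\<alpha> \<beta>. \<forall>t\<in>{a..b}. potential (c t) y = \<alpha> + t * \<beta>"
proof -
  have L: "L > 0" by (rule arcD(1)[OF E])
  have "\<exists>\<alpha> \<beta>. \<forall>t\<in>{a..b}. bridge (c, L) (c t) y = \<alpha> + t * \<beta>"
  proof (cases "y \<in> c ` {0<..<L}")
    case False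
    then show ?thesis using bridge_off_arc(2)[OF E] by (intro exI[of _ 0]) simp
  next
    case True
    then obtain r where r: "r \<in> {0<..<L}" "y = c r" by blast
    then have "r \<le> a \<or> b \<le> r" using no[of r] by force
    moreover have "bridge (c, L) (c t) y = green L t r" if "t \<in> {a..b}" for t
      using bridge_arc[OF E, of t r] that r ab by auto
    ultimately show ?thesis
    proof (elim disjE)
      assume "r \<le> a"
      then show ?thesis using \<open>\<And>t. t \<in> {a..b} \<Longrightarrow> bridge (c, L) (c t) y = green L t r\<close>
        by (intro exI[of _ r] exI[of _ "- r / L"]) (auto simp: green_def)
    next
      assume "b \<le> r"
      then show ?thesis using \<open>\<And>t. t \<in> {a..b} \<Longrightarrow> bridge (c, L) (c t) y = green L t r\<close> L
        by (intro exI[of _ 0] exI[of _ "1 - r / L"]) (auto simp: green_def right_diff_distrib)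
    qed
  qed
  then obtain \<alpha> \<beta> where br: "\<And>t. t \<in> {a..b} \<Longrightarrow> bridge (c, L) (c t) y = \<alpha> + t * \<beta>" by blast
  have "potential (c t) y = (potential (c 0) y + \<alpha>) + t * ((potential (c L) y - potential (c 0) y) / L + \<beta>)"
    if "t \<in> {a..b}" for t
    using potential_arc[OF E, of t y] br[OF that] ab that L by (auto simp: field_simps)
  then show ?thesis by blast
qed

lemma potential_combination_CPA:
  assumes "finite I" "\<And>i. i \<in> I \<Longrightarrow> y i \<in> \<Gamma>"
  shows "restrict (\<lambda>x. complex_of_real ((\<Sum>i\<in>I. a i * potential x (y i)) + C)) \<Gamma> \<in> CPA \<Gamma>"
proof (rule CPA_I[where W = "y ` I"])
  have "continuous_on \<Gamma> (\<lambda>x. complex_of_real ((\<Sum>i\<in>I. a i * potential x (y i)) + C))"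
    using assms(2) by (intro continuous_intros continuous_on_potential_section) auto
  then show "continuous_on \<Gamma> (restrict (\<lambda>x. complex_of_real ((\<Sum>i\<in>I. a i * potential x (y i)) + C)) \<Gamma>)"
    by (rule continuous_on_eq) auto
  fix c L r s assume E: "(c, L) \<in> E" and rs: "0 \<le> r" "r < s" "s \<le> L" and no: "\<And>t. t \<in> {r<..<s} \<Longrightarrow> c t \<notin> y ` I"
  have "\<forall>i\<in>I. \<exists>\<alpha> \<beta>. \<forall>t\<in>{r..s}. potential (c t) (y i) = \<alpha> + t * \<beta>"
    using potential_affine[OF E rs(1,3)] no by blast
  then obtain \<alpha> \<beta> where ab: "\<And>i t. i \<in> I \<Longrightarrow> t \<in> {r..s} \<Longrightarrow> potential (c t) (y i) = \<alpha> i + t * \<beta> i" by metis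
  have "restrict (\<lambda>x. complex_of_real ((\<Sum>i\<in>I. a i * potential x (y i)) + C)) \<Gamma> (c t) =
      complex_of_real ((\<Sum>i\<in>I. a i * \<alpha> i) + C) + of_real t * complex_of_real (\<Sum>i\<in>I. a i * \<beta> i)" if t: "t \<in> {r..s}" for t
  proof -
    have "c t \<in> \<Gamma>" using arcD(7)[OF E, of t] t rs by auto
    moreover have "(\<Sum>i\<in>I. a i * potential (c t) (y i)) = (\<Sum>i\<in>I. a i * \<alpha> i) + t * (\<Sum>i\<in>I. a i * \<beta> i)"
      using ab t by (simp add: sum_distrib_left sum.distrib[symmetric] algebra_simps)
    ultimately have "restrict (\<lambda>x. complex_of_real ((\<Sum>i\<in>I. a i * potential x (y i)) + C)) \<Gamma> (c t) =
        complex_of_real ((\<Sum>i\<in>I. a i * \<alpha> i) + t * (\<Sum>i\<in>I. a i * \<beta> i) + C)" by (simp only: restrict_apply if_True)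
    then show ?thesis by (simp del: of_real_sum)
  qed
  then show "\<exists>\<alpha> \<beta>. \<forall>t\<in>{r..s}. restrict (\<lambda>x. complex_of_real ((\<Sum>i\<in>I. a i * potential x (y i)) + C)) \<Gamma> (c t) = \<alpha> + of_real t * \<beta>"
    by blast
qed (use assms in auto)

text \<open>The potential at the points of the graph of a unit charge at \<open>y\<close>, with the opposite charge at
  \<open>base\<close>; it is undefined off the graph because the elements of \<open>CPA\<close> are extensional.\<close>

definition source :: "'a \<Rightarrow> 'a \<Rightarrow> complex" where
  "source y = restrict (\<lambda>x. complex_of_real (potential x y)) \<Gamma>"

lemma source_CPA: "y \<in> \<Gamma> \<Longrightarrow> source y \<in> CPA \<Gamma>"
  using potential_combination_CPA[of "{()}" "\<lambda>_. y" "\<lambda>_. 1" 0] by (simp add: source_def)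

text \<open>At a vertex, the slopes of the Green kernel of the arc through \<open>y\<close> add the weights of \<open>y\<close> at
  the ends of this arc; these cancel against the discrete Laplacian of the interpolated part.\<close>

lemma slope_sum_source_vertex:
  assumes y: "y \<in> \<Gamma>" and p: "p \<in> V"
  shows "slope_sum \<Gamma> (source y) p = of_bool (p = base) - of_bool (p = y)"
proof -
  define out where "out = (\<lambda>(c, L). if y \<in> c ` {0<..<L} then 1 - coord (c, L) y / L else 0)"
  define inw where "inw = (\<lambda>(c, L). if y \<in> c ` {0<..<L} then coord (c, L) y / L else 0)"
  define D where "D = (\<lambda>(c, L). (potential (c L) y - potential (c 0) y) / L)"
  have pG: "p \<in> \<Gamma>" using p V_subset by auto
  have "\<exists>\<delta>>0. \<delta> \<le> snd e \<and> (\<forall>s\<in>{0..<\<delta>}. bridge e (fst e s) y = s * out e \<and> bridge e (fst e (snd e - s)) y = s * inw e)"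
    if e: "e \<in> E" for e
  proof -
    obtain c L where [simp]: "e = (c, L)" by fastforce
    have E: "(c, L) \<in> E" using e by simp
    show ?thesis
    proof (cases "y \<in> c ` {0<..<L}")
      case False
      then show ?thesis using bridge_off_arc(2)[OF E False] arcD(1)[OF E]
        by (intro exI[of _ L]) (auto simp: out_def inw_def)
    next
      case True
      then obtain t where t: "t \<in> {0<..<L}" "y = c t" by blast
      have "bridge e (c s) y = s * out e \<and> bridge e (c (L - s)) y = s * inw e" if s: "s \<in> {0..<min t (L - t)}" for s
      proof -
        have "bridge e (c s) y = green L s t" "bridge e (c (L - s)) y = green L (L - s) t"
          using bridge_arc[OF E, of _ t] t s by auto
        moreover have "out e = 1 - t / L" "inw e = t / L"
          using True coord_arc[OF E, of t] t by (auto simp: out_def inw_def)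
        moreover have "green L s t = s * (1 - t / L)"
          using s by (simp add: green_def right_diff_distrib)
        moreover have "green L (L - s) t = s * (t / L)"
          using s arcD(1)[OF E] by (simp add: green_def left_diff_distrib diff_divide_distrib)
        ultimately show ?thesis by simp
      qed
      then show ?thesis using t by (intro exI[of _ "min t (L - t)"]) auto
    qed
  qed
  then obtain \<delta>0 where d0: "\<And>e. e \<in> E \<Longrightarrow> \<delta>0 e > 0 \<and> \<delta>0 e \<le> snd e \<and>
      (\<forall>s\<in>{0..<\<delta>0 e}. bridge e (fst e s) y = s * out e \<and> bridge e (fst e (snd e - s)) y = s * inw e)" by metis
  have "E \<noteq> {}" using nonempty graph_eq by auto
  define \<delta> where "\<delta> = Min (\<delta>0 ` E)"
  have "\<delta> > 0" using d0 finite_E \<open>E \<noteq> {}\<close> by (auto simp: \<delta>_def)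
  have le: "\<delta> \<le> \<delta>0 e" if "e \<in> E" for e using finite_E that by (auto simp: \<delta>_def)
  have near: "potential (c s) y = potential (c 0) y + s * (D (c, L) + out (c, L)) \<and>
      potential (c (L - s)) y = potential (c L) y + s * (- D (c, L) + inw (c, L))"
    if E: "(c, L) \<in> E" and s: "s \<in> {0..<\<delta>}" for c L s
  proof -
    have sL: "s \<in> {0..<\<delta>0 (c, L)}" "s \<in> {0..L}" "L - s \<in> {0..L}" using le[OF E] d0[OF E] s by auto
    show ?thesis
      using potential_arc[OF E sL(2), of y] potential_arc[OF E sL(3), of y] d0[OF E] sL(1) arcD(1)[OF E]
      by (simp add: D_def field_simps)
  qed
  have "slope_sum \<Gamma> (source y) p = (\<Sum>(c, L)\<in>E. (if c 0 = p then complex_of_real (D (c, L) + out (c, L)) else 0) +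
      (if c L = p then complex_of_real (- D (c, L) + inw (c, L)) else 0))"
  proof (rule slope_sum_vertex[OF p \<open>\<delta> > 0\<close>])
    fix c L s assume E: "(c, L) \<in> E" and s: "s \<in> {0..<\<delta>}"
    have in\<Gamma>: "c s \<in> \<Gamma>" "c (L - s) \<in> \<Gamma>"
      using arcD(7)[OF E, of s] arcD(7)[OF E, of "L - s"] le[OF E] d0[OF E] s by auto
    show "source y (c s) = source y p + of_real s * complex_of_real (D (c, L) + out (c, L))" if "c 0 = p"
      using near[OF E s] in\<Gamma> pG that by (simp add: source_def)
    show "source y (c (L - s)) = source y p + of_real s * complex_of_real (- D (c, L) + inw (c, L))" if "c L = p"
      using near[OF E s] in\<Gamma> pG that by (simp add: source_def)
  qed
  also have "\<dots> = complex_of_real ((\<Sum>(c, L)\<in>E. of_bool (c 0 = p) * out (c, L) + of_bool (c L = p) * inw (c, L)) -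
      (\<Sum>(c, L)\<in>E. (of_bool (p = c 0) - of_bool (p = c L)) * (potential (c 0) y - potential (c L) y) / L))"
    unfolding of_real_diff of_real_sum sum_subtractf[symmetric]
    by (intro sum.cong refl) (auto simp: D_def diff_divide_distrib)
  also have "(\<Sum>(c, L)\<in>E. of_bool (c 0 = p) * out (c, L) + of_bool (c L = p) * inw (c, L)) = hat p y - of_bool (p = y)"
  proof -
    have "(\<Sum>(c, L)\<in>E. of_bool (c 0 = p) * out (c, L) + of_bool (c L = p) * inw (c, L)) =
       (\<Sum>(c, L)\<in>E. if y \<in> c ` {0<..<L} then (1 - coord (c, L) y / L) * of_bool (c 0 = p) + coord (c, L) y / L * of_bool (c L = p) else 0)"
      by (intro sum.cong refl) (auto simp: out_def inw_def)
    then show ?thesis by (auto simp: hat_def)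
  qed
  also have "(\<Sum>(c, L)\<in>E. (of_bool (p = c 0) - of_bool (p = c L)) * (potential (c 0) y - potential (c L) y) / L) = hat p y - of_bool (p = base)"
  proof -
    have "(\<Sum>(c, L)\<in>E. (of_bool (p = c 0) - of_bool (p = c L)) * (potential (c 0) y - potential (c L) y) / L) =
        (\<Sum>e\<in>E. \<Sum>w\<in>V. hat w y * ((of_bool (p = fst e 0) - of_bool (p = fst e (snd e))) * (vertex_kernel (fst e 0) w - vertex_kernel (fst e (snd e)) w) / snd e))"
      unfolding case_prod_beta
    proof (intro sum.cong refl)
      fix e assume "e \<in> E"
      then have v: "fst e 0 \<in> V" "fst e (snd e) \<in> V" using arcD(4,5)[of "fst e" "snd e"] by auto
      have "potential (fst e 0) y - potential (fst e (snd e)) y = (\<Sum>w\<in>V. hat w y * (vertex_kernel (fst e 0) w - vertex_kernel (fst e (snd e)) w))"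
        by (simp add: potential_vertex v sum_subtractf right_diff_distrib)
      then show "(of_bool (p = fst e 0) - of_bool (p = fst e (snd e))) * (potential (fst e 0) y - potential (fst e (snd e)) y) / snd e =
          (\<Sum>w\<in>V. hat w y * ((of_bool (p = fst e 0) - of_bool (p = fst e (snd e))) * (vertex_kernel (fst e 0) w - vertex_kernel (fst e (snd e)) w) / snd e))"
        by (simp only: sum_distrib_left sum_divide_distrib) (simp add: mult_ac)
    qed
    also have "\<dots> = (\<Sum>w\<in>V. \<Sum>e\<in>E. hat w y * ((of_bool (p = fst e 0) - of_bool (p = fst e (snd e))) * (vertex_kernel (fst e 0) w - vertex_kernel (fst e (snd e)) w) / snd e))"
      by (rule sum.swap)
    also have "\<dots> = (\<Sum>w\<in>V. hat w y * (of_bool (p = w) - of_bool (p = base)))"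
      by (intro sum.cong refl)
         (simp only: sum_distrib_left[symmetric] vertex_kernel_laplacian[OF p, unfolded case_prod_beta])
    also have "\<dots> = (\<Sum>w\<in>V. hat w y * of_bool (w = p)) - (\<Sum>w\<in>V. hat w y) * of_bool (p = base)"
      by (simp only: right_diff_distrib sum_subtractf sum_distrib_right eq_commute[of p])
    finally show ?thesis using sum_hat[OF y] sum_of_bool(1)[OF p] by simp
  qed
  finally show ?thesis by simp
qed

text \<open>Away from \<open>y\<close> the kernel is affine; at \<open>y\<close> the Green kernel has a corner with slopes of sum \<open>-1\<close>.\<close>

lemma slope_sum_source_interior:
  assumes E: "(c, L) \<in> E" and t0: "t0 \<in> {0<..<L}"
  shows "slope_sum \<Gamma> (source y) (c t0) = - of_bool (c t0 = y)"
proof -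
  have "\<exists>\<delta>>0. \<exists>b b'. (\<forall>u\<in>{0..<\<delta>}. bridge (c, L) (c (t0 + u)) y = bridge (c, L) (c t0) y + u * b) \<and>
    (\<forall>u\<in>{0..<\<delta>}. bridge (c, L) (c (t0 - u)) y = bridge (c, L) (c t0) y + u * b') \<and> b + b' = - of_bool (c t0 = y)"
  proof (cases "y \<in> c ` {0<..<L}")
    case False
    then show ?thesis using bridge_off_arc(2)[OF E False] t0 by (intro exI[of _ 1] conjI exI[of _ 0]) auto
  next
    case True
    then obtain t where t: "t \<in> {0<..<L}" "y = c t" by blast
    obtain \<delta> b b' where d: "\<delta> > 0" "\<forall>u\<in>{0..<\<delta>}. green L (t0 + u) t = green L t0 t + u * b"
      "\<forall>u\<in>{0..<\<delta>}. green L (t0 - u) t = green L t0 t + u * b'" "b + b' = - of_bool (t0 = t)"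
      using green_slopes[OF t0 t(1)] by blast
    have "bridge (c, L) (c s) y = green L s t" if "s \<in> {0..L}" for s
      using bridge_arc[OF E that, of t] t by auto
    moreover have "t0 = t \<longleftrightarrow> c t0 = y" using arcD(9)[OF E, of t0 t] t t0 by auto
    ultimately show ?thesis using d t0
      by (intro exI[of _ "min \<delta> (min t0 (L - t0))"] conjI exI[of _ b] exI[of _ b']) auto
  qed
  then obtain \<delta> b b' where d: "\<delta> > 0" "\<forall>u\<in>{0..<\<delta>}. bridge (c, L) (c (t0 + u)) y = bridge (c, L) (c t0) y + u * b"
    "\<forall>u\<in>{0..<\<delta>}. bridge (c, L) (c (t0 - u)) y = bridge (c, L) (c t0) y + u * b'" "b + b' = - of_bool (c t0 = y)"
    by blast
  define D where "D = (potential (c L) y - potential (c 0) y) / L"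
  define \<delta>' where "\<delta>' = min \<delta> (min t0 (L - t0))"
  have d': "\<delta>' > 0" using d t0 by (auto simp: \<delta>'_def)
  have L: "L > 0" by (rule arcD(1)[OF E])
  have pot: "potential (c s) y = potential (c 0) y + s * D + bridge (c, L) (c s) y" if "s \<in> {0..L}" for s
    using potential_arc[OF E that, of y] L by (simp add: D_def field_simps)
  have "slope_sum \<Gamma> (source y) (c t0) = complex_of_real (D + b) + complex_of_real (- D + b')"
  proof (rule slope_sum_interior[OF E t0 d'])
    fix s assume s: "s \<in> {0..<\<delta>'}"
    then have in01: "t0 + s \<in> {0..L}" "t0 - s \<in> {0..L}" "t0 \<in> {0..L}" "s \<in> {0..<\<delta>}" using t0 by (auto simp: \<delta>'_def)
    then have in\<Gamma>: "c (t0 + s) \<in> \<Gamma>" "c (t0 - s) \<in> \<Gamma>" "c t0 \<in> \<Gamma>" using arcD(7)[OF E] by auto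
    have "potential (c (t0 + s)) y = potential (c t0) y + s * (D + b)"
      "potential (c (t0 - s)) y = potential (c t0) y + s * (- D + b')"
      using pot[OF in01(1)] pot[OF in01(2)] pot[OF in01(3)] d(2,3) in01(4) by (auto simp: algebra_simps)
    then show "source y (c (t0 + s)) = source y (c t0) + of_real s * complex_of_real (D + b)"
      "source y (c (t0 - s)) = source y (c t0) + of_real s * complex_of_real (- D + b')"
      using in\<Gamma> by (simp_all add: source_def)
  qed
  also have "\<dots> = complex_of_real (b + b')" by simp
  also have "\<dots> = - of_bool (c t0 = y)" unfolding d(4) by simp
  finally show ?thesis .
qed

lemma slope_sum_source:
  assumes "y \<in> \<Gamma>" "p \<in> \<Gamma>"
  shows "slope_sum \<Gamma> (source y) p = of_bool (p = base) - of_bool (p = y)"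
proof (cases "p \<in> V")
  case True
  then show ?thesis using slope_sum_source_vertex assms by simp
next
  case False
  obtain c L s where E: "(c, L) \<in> E" "s \<in> {0..L}" "p = c s" using graph_eq assms(2) by blast
  then have "s \<in> {0<..<L}" using arc_vertex_iff[OF E(1,2)] False by auto
  moreover have "p \<noteq> base" using False base_in_V by auto
  ultimately show ?thesis using slope_sum_source_interior[OF E(1)] E(3) by simp
qed

lemma slope_sum_diff:
  assumes f: "f \<in> CPA \<Gamma>" and g: "g \<in> CPA \<Gamma>" and h: "\<And>x. x \<in> \<Gamma> \<Longrightarrow> h x = f x - g x + C" and p: "p \<in> \<Gamma>"
  shows "slope_sum \<Gamma> h p = slope_sum \<Gamma> f p - slope_sum \<Gamma> g p"
proof -
  obtain \<epsilon> where ch: "ray_chart \<Gamma> p (Vec \<Gamma> p) (translate \<Gamma> p) \<epsilon>" using ray_chart_translate[OF p] by blast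
  obtain \<delta>1 b1 where 1: "\<delta>1 > 0" "\<delta>1 \<le> \<epsilon>" "linear_rays (Vec \<Gamma> p) (translate \<Gamma> p) \<delta>1 f p b1"
    using CPA_linear_rays[OF f ch] by blast
  obtain \<delta>2 b2 where 2: "\<delta>2 > 0" "\<delta>2 \<le> \<epsilon>" "linear_rays (Vec \<Gamma> p) (translate \<Gamma> p) \<delta>2 g p b2"
    using CPA_linear_rays[OF g ch] by blast
  have "linear_rays (Vec \<Gamma> p) (translate \<Gamma> p) (min \<delta>1 \<delta>2) h p (\<lambda>v. b1 v - b2 v)"
    unfolding linear_rays_def
  proof (intro ballI)
    fix v s assume v: "v \<in> Vec \<Gamma> p" and s: "s \<in> {0..<min \<delta>1 \<delta>2}"
    then have "translate \<Gamma> p v s \<in> \<Gamma>" using ray_chartD(5)[OF ch v, of s] 1 by auto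
    note h[OF p] h[OF this]
    moreover have "f (translate \<Gamma> p v s) = f p + of_real s * b1 v" "g (translate \<Gamma> p v s) = g p + of_real s * b2 v"
      using 1(3) 2(3) v s by (auto simp: linear_rays_def)
    ultimately show "h (translate \<Gamma> p v s) = h p + of_real s * (b1 v - b2 v)"
      by (simp only:) (simp add: algebra_simps)
  qed
  then have "slope_sum \<Gamma> h p = (\<Sum>v\<in>Vec \<Gamma> p. b1 v - b2 v)"
    using slope_sum_chosen_chart[OF _ _ p] 1 2 by simp
  then show ?thesis
    using slope_sum_chosen_chart[OF 1(3,1) p] slope_sum_chosen_chart[OF 2(3,1) p] by (simp add: sum_subtractf)
qed

text \<open>The difference of the sources at \<open>y\<close> and \<open>\<zeta>\<close> solves the Laplace equation; the last two terms are
  the constant that makes it vanish at \<open>\<zeta>\<close>.\<close>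

lemma j_kernel_potential:
  assumes "\<zeta> \<in> \<Gamma>" "x \<in> \<Gamma>" "y \<in> \<Gamma>"
  shows "j_kernel \<Gamma> \<zeta> x y = complex_of_real (potential x y - potential x \<zeta> - potential \<zeta> y + potential \<zeta> \<zeta>)"
proof -
  define f where "f = restrict (\<lambda>x. complex_of_real ((\<Sum>i\<in>{True, False}. (if i then 1 else - 1) * potential x (if i then y else \<zeta>))
     + (potential \<zeta> \<zeta> - potential \<zeta> y))) \<Gamma>"
  have f_eq: "f x = complex_of_real (potential x y - potential x \<zeta> - potential \<zeta> y + potential \<zeta> \<zeta>)" if "x \<in> \<Gamma>" for x
    using that by (simp add: f_def)
  have "f \<in> CPA \<Gamma>" unfolding f_def by (rule potential_combination_CPA) (use assms in auto)
  moreover have slope: "slope_sum \<Gamma> f p = of_bool (p = \<zeta>) - of_bool (p = y)" if "p \<in> \<Gamma>" for p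
  proof -
    have "slope_sum \<Gamma> f p = slope_sum \<Gamma> (source y) p - slope_sum \<Gamma> (source \<zeta>) p"
      by (rule slope_sum_diff[where C = "complex_of_real (potential \<zeta> \<zeta> - potential \<zeta> y)"])
         (use assms that source_CPA f_eq in \<open>auto simp: source_def\<close>)
    then show ?thesis using slope_sum_source assms that by simp
  qed
  have "laplacian \<Gamma> f E = dirac \<Gamma> y E - dirac \<Gamma> \<zeta> E" for E
  proof -
    have "{p\<in>\<Gamma>. slope_sum \<Gamma> f p \<noteq> 0} = (if \<zeta> = y then {} else {\<zeta>, y})"
      using slope assms by auto
    then show ?thesis using slope assms by (auto simp: laplacian_def)
  qed
  then have "laplacian \<Gamma> f = (\<lambda>E. dirac \<Gamma> y E - dirac \<Gamma> \<zeta> E)" by (rule ext)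
  moreover have "f \<zeta> = 0" using assms f_eq by simp
  ultimately have "j_kernel \<Gamma> \<zeta> x y = f x" using assms by (intro j_kernel_eq)
  then show ?thesis using f_eq assms by simp
qed

end

section \<open>The Jordan decomposition of a signed measure\<close>

locale signed_measure_on =
  fixes M :: "'a measure" and \<rho> :: "'a set \<Rightarrow> real" and B :: real
  assumes empty: "\<rho> {} = 0"
    and sums: "\<And>A :: nat \<Rightarrow> 'a set. range A \<subseteq> sets M \<Longrightarrow> disjoint_family A \<Longrightarrow> (\<lambda>i. \<rho> (A i)) sums \<rho> (\<Union>i. A i)"
    and bound: "\<And>A. A \<in> sets M \<Longrightarrow> \<bar>\<rho> A\<bar> \<le> B"
begin

lemma additive:
  assumes "A \<in> sets M" "C \<in> sets M" "A \<inter> C = {}"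
  shows "\<rho> (A \<union> C) = \<rho> A + \<rho> C"
proof -
  have "disjoint_family (binaryset A C)"
    using assms(3) by (auto simp: disjoint_family_on_def binaryset_def)
  then have "(\<lambda>i. \<rho> (binaryset A C i)) sums \<rho> (A \<union> C)"
    using sums[of "binaryset A C"] assms by (simp add: range_binaryset_eq UN_binaryset_eq)
  then show ?thesis using binaryset_sums[of \<rho>, OF empty, of A C] sums_unique2 by blast
qed

definition pos :: "'a set \<Rightarrow> real" where
  "pos E = (SUP A\<in>{A\<in>sets M. A \<subseteq> E}. \<rho> A)"

lemma pos_upper: "A \<in> sets M \<Longrightarrow> A \<subseteq> E \<Longrightarrow> \<rho> A \<le> pos E"
  unfolding pos_def by (rule cSUP_upper) (use bound in \<open>auto intro!: bdd_aboveI2[of _ _ B] simp: abs_le_iff\<close>)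

lemma pos_least: "(\<And>A. A \<in> sets M \<Longrightarrow> A \<subseteq> E \<Longrightarrow> \<rho> A \<le> b) \<Longrightarrow> pos E \<le> b"
  unfolding pos_def by (rule cSUP_least) (auto intro!: exI[of _ "{}"])

lemma pos_nonneg: "0 \<le> pos E" using pos_upper[of "{}" E] empty by simp

lemma pos_mono: "E \<subseteq> F \<Longrightarrow> pos E \<le> pos F" by (rule pos_least) (auto intro: pos_upper)

lemma SUP_ennreal_eq_pos: "(SUP A\<in>{A\<in>sets M. A \<subseteq> E}. ennreal (\<rho> A)) = ennreal (pos E)"
proof (rule antisym)
  show "(SUP A\<in>{A\<in>sets M. A \<subseteq> E}. ennreal (\<rho> A)) \<le> ennreal (pos E)"
    by (rule SUP_least) (auto intro!: ennreal_leI pos_upper)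
  show "ennreal (pos E) \<le> (SUP A\<in>{A\<in>sets M. A \<subseteq> E}. ennreal (\<rho> A))"
  proof (cases "(SUP A\<in>{A\<in>sets M. A \<subseteq> E}. ennreal (\<rho> A))")
    case (real r)
    have "\<rho> A \<le> r" if "A \<in> sets M" "A \<subseteq> E" for A
    proof -
      have "ennreal (\<rho> A) \<le> (SUP A\<in>{A\<in>sets M. A \<subseteq> E}. ennreal (\<rho> A))"
        by (rule SUP_upper) (use that in auto)
      then show ?thesis using real by (simp add: ennreal_le_iff)
    qed
    then have "pos E \<le> r" by (rule pos_least)
    then show ?thesis using real by (simp add: ennreal_leI)
  next
    case top
    then show ?thesis by (metis top_greatest)
  qed
qed

lemma pos_superadditive:
  assumes "E \<inter> F = {}"
  shows "pos E + pos F \<le> pos (E \<union> F)"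
proof -
  have "pos F \<le> pos (E \<union> F) - pos E"
  proof (rule pos_least)
    fix C assume C: "C \<in> sets M" "C \<subseteq> F"
    have "pos E \<le> pos (E \<union> F) - \<rho> C"
    proof (rule pos_least)
      fix A assume A: "A \<in> sets M" "A \<subseteq> E"
      have "\<rho> A + \<rho> C = \<rho> (A \<union> C)" using A C assms by (intro additive[symmetric]) auto
      also have "\<dots> \<le> pos (E \<union> F)" using A C by (intro pos_upper) auto
      finally show "\<rho> A \<le> pos (E \<union> F) - \<rho> C" by simp
    qed
    then show "\<rho> C \<le> pos (E \<union> F) - pos E" by simp
  qed
  then show ?thesis by simp
qed

lemma pos_sums:
  assumes E: "range (E :: nat \<Rightarrow> 'a set) \<subseteq> sets M" "disjoint_family E"
  shows "(\<lambda>i. pos (E i)) sums pos (\<Union>i. E i)"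
proof -
  have partial: "(\<Sum>i<n. pos (E i)) \<le> pos (\<Union>i<n. E i)" for n
  proof (induction n)
    case (Suc n)
    have "E i \<inter> E n = {}" if "i < n" for i using E(2) that by (simp add: disjoint_family_on_def)
    then have "(\<Union>i<n. E i) \<inter> E n = {}" by blast
    from pos_superadditive[OF this] Suc show ?case by (simp add: lessThan_Suc Un_commute)
  qed (simp add: pos_nonneg)
  have le: "(\<Sum>i<n. pos (E i)) \<le> pos (\<Union>i. E i)" for n
    using partial[of n] pos_mono[of "\<Union>i<n. E i" "\<Union>i. E i"] by (meson UN_mono order_trans subset_UNIV order_refl)
  have summable: "summable (\<lambda>i. pos (E i))"
    by (rule summableI_nonneg_bounded[OF pos_nonneg le])
  have "pos (\<Union>i. E i) \<le> (\<Sum>i. pos (E i))"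
  proof (rule pos_least)
    fix A assume A: "A \<in> sets M" "A \<subseteq> (\<Union>i. E i)"
    have "(\<lambda>i. \<rho> (A \<inter> E i)) sums \<rho> (\<Union>i. A \<inter> E i)"
    proof (rule sums)
      show "range (\<lambda>i. A \<inter> E i) \<subseteq> sets M" using A E by auto
      show "disjoint_family (\<lambda>i. A \<inter> E i)" using E(2) unfolding disjoint_family_on_def by blast
    qed
    moreover have "(\<Union>i. A \<inter> E i) = A" using A by auto
    ultimately have *: "(\<lambda>i. \<rho> (A \<inter> E i)) sums \<rho> A" by simp
    show "\<rho> A \<le> (\<Sum>i. pos (E i))"
      by (rule sums_le[OF _ * summable_sums[OF summable]]) (use A E in \<open>auto intro!: pos_upper\<close>)
  qed
  moreover have "(\<Sum>i. pos (E i)) \<le> pos (\<Union>i. E i)"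
    using suminf_le_const[OF summable le] .
  ultimately have "pos (\<Union>i. E i) = (\<Sum>i. pos (E i))" by (rule antisym)
  then show ?thesis using summable_sums[OF summable] by (simp only:)
qed

lemma sets_upper_variation: "sets (upper_variation M \<rho>) = sets M"
  and space_upper_variation: "space (upper_variation M \<rho>) = space M"
  unfolding upper_variation_def by (simp_all add: sets.space_closed)

lemma emeasure_upper_variation:
  assumes "E \<in> sets M"
  shows "emeasure (upper_variation M \<rho>) E = ennreal (pos E)"
proof -
  have eq: "upper_variation M \<rho> = measure_of (space M) (sets M) (\<lambda>E. ennreal (pos E))"
    by (simp add: upper_variation_def SUP_ennreal_eq_pos)
  show ?thesis
  proof (rule emeasure_measure_of[OF eq])
  show "positive (sets (upper_variation M \<rho>)) (\<lambda>E. ennreal (pos E))"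
    using pos_least[of "{}" 0] empty pos_nonneg[of "{}"] by (auto simp: positive_def)
  show "countably_additive (sets (upper_variation M \<rho>)) (\<lambda>E. ennreal (pos E))"
    unfolding countably_additive_def sets_upper_variation
    using pos_sums suminf_ennreal_eq[OF pos_nonneg] by blast
  qed (use assms sets.space_closed in \<open>auto simp: sets_upper_variation\<close>)
qed

lemma measure_upper_variation: "E \<in> sets M \<Longrightarrow> measure (upper_variation M \<rho>) E = pos E"
  using emeasure_upper_variation pos_nonneg by (simp add: measure_def)

lemma finite_upper_variation: "finite_measure (upper_variation M \<rho>)"
  by (rule finite_measureI) (simp add: space_upper_variation emeasure_upper_variation)

end

lemma signed_measure_on_minus:
  assumes "signed_measure_on M \<rho> B" shows "signed_measure_on M (\<lambda>E. - \<rho> E) B"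
proof -
  interpret signed_measure_on M \<rho> B by fact
  show ?thesis by unfold_locales (use empty bound in \<open>auto intro!: sums_minus sums\<close>)
qed

text \<open>Since \<open>\<rho>(A) = \<rho>(E) - \<rho>(E - A)\<close>, the supremum of \<open>\<rho>\<close> over the subsets of \<open>E\<close> is \<open>\<rho>(E)\<close> plus the
  supremum of \<open>- \<rho>\<close>.\<close>

lemma jordan_decomposition:
  assumes "signed_measure_on M \<rho> B" "E \<in> sets M"
  shows "measure (upper_variation M \<rho>) E - measure (upper_variation M (\<lambda>E. - \<rho> E)) E = \<rho> E"
proof -
  interpret p: signed_measure_on M \<rho> B by fact
  interpret n: signed_measure_on M "\<lambda>E. - \<rho> E" B by (rule signed_measure_on_minus) fact
  have split: "\<rho> E = \<rho> A + \<rho> (E - A)" if "A \<in> sets M" "A \<subseteq> E" for A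
    using p.additive[of A "E - A"] that assms(2) by (simp add: Un_absorb1)
  have "p.pos E \<le> \<rho> E + n.pos E"
  proof (rule p.pos_least)
    fix A assume "A \<in> sets M" "A \<subseteq> E"
    then show "\<rho> A \<le> \<rho> E + n.pos E" using split n.pos_upper[of "E - A" E] assms(2) by fastforce
  qed
  moreover have "n.pos E \<le> p.pos E - \<rho> E"
  proof (rule n.pos_least)
    fix A assume "A \<in> sets M" "A \<subseteq> E"
    then show "- \<rho> A \<le> p.pos E - \<rho> E" using split p.pos_upper[of "E - A" E] assms(2) by fastforce
  qed
  ultimately show ?thesis using assms(2) by (simp add: p.measure_upper_variation n.measure_upper_variation)
qed

section \<open>Integration against a complex measure\<close>

definition tagged_partition :: "'a measure \<Rightarrow> nat \<Rightarrow> (nat \<Rightarrow> 'a set) \<Rightarrow> bool" where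
  "tagged_partition M N A \<longleftrightarrow> (\<forall>i<N. A i \<in> sets M) \<and> disjoint_family_on A {..<N} \<and> (\<Union>i<N. A i) = space M"

text \<open>A functional \<open>\<Lambda>\<close> is integration against \<open>\<nu>\<close> if it is close to the integral of each
  step function that is uniformly close to \<open>f\<close>. Stated like this, the property is inherited by
  differences and complex combinations of measures.\<close>

definition step_bound :: "'a measure \<Rightarrow> ('a set \<Rightarrow> complex) \<Rightarrow> (('a \<Rightarrow> complex) \<Rightarrow> complex) \<Rightarrow> real \<Rightarrow> bool" where
  "step_bound M \<nu> \<Lambda> K \<longleftrightarrow> K \<ge> 0 \<and>
     (\<forall>f b N A \<epsilon> z. f \<in> borel_measurable M \<longrightarrow> (\<forall>x\<in>space M. cmod (f x) \<le> b) \<longrightarrow> tagged_partition M N A \<longrightarrow>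
        \<epsilon> \<ge> 0 \<longrightarrow> (\<forall>i<N. \<forall>x\<in>A i. cmod (f x - z i) \<le> \<epsilon>) \<longrightarrow>
        cmod (\<Lambda> f - (\<Sum>i<N. z i * \<nu> (A i))) \<le> K * \<epsilon>)"

lemma step_boundD:
  assumes "step_bound M \<nu> \<Lambda> K"
  shows "K \<ge> 0"
    "f \<in> borel_measurable M \<Longrightarrow> \<forall>x\<in>space M. cmod (f x) \<le> b \<Longrightarrow> tagged_partition M N A \<Longrightarrow> \<epsilon> \<ge> 0 \<Longrightarrow>
       \<forall>i<N. \<forall>x\<in>A i. cmod (f x - z i) \<le> \<epsilon> \<Longrightarrow> cmod (\<Lambda> f - (\<Sum>i<N. z i * \<nu> (A i))) \<le> K * \<epsilon>"
  using assms unfolding step_bound_def by blast+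

lemma integral_step_estimate:
  fixes f :: "'a \<Rightarrow> complex"
  assumes fin: "finite_measure M" and f: "f \<in> borel_measurable M" and bd: "\<And>x. x \<in> space M \<Longrightarrow> cmod (f x) \<le> b"
    and A: "tagged_partition M N A" and eps: "\<epsilon> \<ge> 0" "\<And>i x. i < N \<Longrightarrow> x \<in> A i \<Longrightarrow> cmod (f x - z i) \<le> \<epsilon>"
  shows "cmod ((LINT x|M. f x) - (\<Sum>i<N. z i * of_real (measure M (A i)))) \<le> \<epsilon> * measure M (space M)"
proof -
  interpret finite_measure M by fact
  have intf: "integrable M f"
    by (rule integrable_const_bound[of _ b]) (use f bd in auto)
  define g where "g = (\<lambda>x. \<Sum>i<N. indicator (A i) x *\<^sub>R z i)"
  have Ai: "A i \<in> sets M" if "i < N" for i using A that by (simp add: tagged_partition_def)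
  have hb: "has_bochner_integral M (\<lambda>x. indicator (A i) x *\<^sub>R z i) (measure M (A i) *\<^sub>R z i)" if "i < N" for i
    using Ai[OF that] by (intro has_bochner_integral_indicator) (auto simp: emeasure_finite less_top[symmetric])
  then have hg: "has_bochner_integral M g (\<Sum>i<N. measure M (A i) *\<^sub>R z i)"
    unfolding g_def by (intro has_bochner_integral_sum) auto
  then have intg: "integrable M g" by (rule integrable.intros)
  have "(LINT x|M. g x) = (\<Sum>i<N. measure M (A i) *\<^sub>R z i)"
    using hg by (rule has_bochner_integral_integral_eq)
  also have "\<dots> = (\<Sum>i<N. z i * of_real (measure M (A i)))"
    by (simp add: scaleR_conv_of_real mult.commute)
  finally have ig: "(LINT x|M. g x) = (\<Sum>i<N. z i * of_real (measure M (A i)))" .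
  have close: "cmod (f x - g x) \<le> \<epsilon>" if x: "x \<in> space M" for x
  proof -
    obtain i where i: "i < N" "x \<in> A i" using A x unfolding tagged_partition_def by blast
    have "indicator (A j) x *\<^sub>R z j = (if j = i then z i else 0)" if "j < N" for j
      using A i that by (auto simp: tagged_partition_def disjoint_family_on_def indicator_def)
    then have "g x = (\<Sum>j<N. if j = i then z i else 0)" unfolding g_def by (intro sum.cong) auto
    then have "g x = z i" using i by simp
    then show ?thesis using eps i by simp
  qed
  have "(LINT x|M. f x) - (LINT x|M. g x) = (LINT x|M. f x - g x)"
    using intf intg by (simp add: Bochner_Integration.integral_diff)
  also have "cmod \<dots> \<le> (LINT x|M. cmod (f x - g x))" by (rule integral_norm_bound)
  also have "\<dots> \<le> (LINT x|M. \<epsilon>)"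
    using close intf intg by (intro integral_mono) auto
  finally show ?thesis by (simp add: ig mult.commute)
qed

lemma signed_integral_step_estimate:
  assumes "signed_measure_on M \<rho> B"
  shows "\<exists>K. step_bound M (\<lambda>E. of_real (\<rho> E)) (signed_integral M \<rho>) K"
proof -
  interpret p: signed_measure_on M \<rho> B by fact
  interpret n: signed_measure_on M "\<lambda>E. - \<rho> E" B by (rule signed_measure_on_minus) fact
  define P where "P = upper_variation M \<rho>"
  define Q where "Q = upper_variation M (\<lambda>E. - \<rho> E)"
  have sets: "sets P = sets M" "sets Q = sets M" "space P = space M" "space Q = space M"
    by (simp_all add: P_def Q_def p.sets_upper_variation n.sets_upper_variation p.space_upper_variation n.space_upper_variation)
  have fin: "finite_measure P" "finite_measure Q"
    by (simp_all add: P_def Q_def p.finite_upper_variation n.finite_upper_variation)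
  have diff: "\<rho> E = measure P E - measure Q E" if "E \<in> sets M" for E
    using jordan_decomposition[OF assms that] by (simp add: P_def Q_def)
  have "cmod (signed_integral M \<rho> f - (\<Sum>i<N. z i * of_real (\<rho> (A i)))) \<le> (measure P (space M) + measure Q (space M)) * \<epsilon>"
    if H: "f \<in> borel_measurable M" "\<forall>x\<in>space M. cmod (f x) \<le> b" "tagged_partition M N A" "\<epsilon> \<ge> 0" "\<forall>i<N. \<forall>x\<in>A i. cmod (f x - z i) \<le> \<epsilon>"
    for f b N A \<epsilon> z
  proof -
    have part: "tagged_partition P N A" "tagged_partition Q N A"
      using H(3) by (simp_all add: tagged_partition_def sets)
    have meas: "f \<in> borel_measurable P" "f \<in> borel_measurable Q"
      using H(1) measurable_cong_sets[OF sets(1) refl] measurable_cong_sets[OF sets(2) refl] by auto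
    have "(\<Sum>i<N. z i * of_real (\<rho> (A i))) = (\<Sum>i<N. z i * of_real (measure P (A i))) - (\<Sum>i<N. z i * of_real (measure Q (A i)))"
      using H(3) diff by (simp add: tagged_partition_def sum_subtractf[symmetric] right_diff_distrib)
    then have "signed_integral M \<rho> f - (\<Sum>i<N. z i * of_real (\<rho> (A i))) =
        ((LINT x|P. f x) - (\<Sum>i<N. z i * of_real (measure P (A i)))) - ((LINT x|Q. f x) - (\<Sum>i<N. z i * of_real (measure Q (A i))))"
      by (simp add: signed_integral_def P_def Q_def)
    moreover have "cmod ((LINT x|P. f x) - (\<Sum>i<N. z i * of_real (measure P (A i)))) \<le> \<epsilon> * measure P (space P)"
      by (rule integral_step_estimate[OF fin(1) meas(1) _ part(1) H(4)]) (use H sets in auto)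
    moreover have "cmod ((LINT x|Q. f x) - (\<Sum>i<N. z i * of_real (measure Q (A i)))) \<le> \<epsilon> * measure Q (space Q)"
      by (rule integral_step_estimate[OF fin(2) meas(2) _ part(2) H(4)]) (use H sets in auto)
    ultimately show ?thesis
      using norm_triangle_ineq4 by (smt (verit) distrib_left mult.commute sets(3,4))
  qed
  then have "step_bound M (\<lambda>E. of_real (\<rho> E)) (signed_integral M \<rho>) (measure P (space M) + measure Q (space M))"
    unfolding step_bound_def by simp
  then show ?thesis by blast
qed

lemma bounded_complex_measureD:
  assumes "bounded_complex_measure M \<nu>"
  shows "E \<notin> sets M \<Longrightarrow> \<nu> E = 0" "\<nu> {} = 0"
    "range (A :: nat \<Rightarrow> 'a set) \<subseteq> sets M \<Longrightarrow> disjoint_family A \<Longrightarrow> (\<lambda>i. \<nu> (A i)) sums \<nu> (\<Union>i. A i)"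
    "\<exists>T\<ge>0. total_variation M \<nu> (space M) = ennreal T"
  using assms unfolding bounded_complex_measure_def by (auto simp: less_top[symmetric]) (metis ennreal_cases)

lemma sum_cmod_partition_le:
  assumes A: "tagged_partition M N A" and T: "total_variation M \<nu> (space M) \<le> ennreal T" "T \<ge> 0" and "\<nu> {} = 0"
  shows "(\<Sum>i<N. cmod (\<nu> (A i))) \<le> T"
proof -
  have "disjoint (A ` {..<N})" using A unfolding tagged_partition_def
    by (intro disjoint_family_on_disjoint_image) auto
  then have "A ` {..<N} \<in> {P. finite P \<and> P \<subseteq> sets M \<and> disjoint P \<and> \<Union>P = space M}"
    using A by (auto simp: tagged_partition_def)
  then have "(\<Sum>C\<in>A ` {..<N}. ennreal (cmod (\<nu> C))) \<le> total_variation M \<nu> (space M)"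
    unfolding total_variation_def by (rule SUP_upper)
  also have "(\<Sum>C\<in>A ` {..<N}. ennreal (cmod (\<nu> C))) = (\<Sum>i<N. ennreal (cmod (\<nu> (A i))))"
  proof (rule trans[OF sum.reindex_nontrivial])
    fix i j assume "i \<in> {..<N}" "j \<in> {..<N}" "i \<noteq> j" "A i = A j"
    then have "A i = {}" using A unfolding tagged_partition_def disjoint_family_on_def by blast
    then show "ennreal (cmod (\<nu> (A i))) = 0" using assms(4) by simp
  qed auto
  finally have "ennreal (\<Sum>i<N. cmod (\<nu> (A i))) \<le> ennreal T" using T by (simp add: sum_ennreal order_trans)
  then show ?thesis using T(2) by (simp add: ennreal_le_iff)
qed

lemma two_set_partition:
  assumes "E \<in> sets M"
  shows "tagged_partition M 2 (\<lambda>i. if i = 0 then E else space M - E)"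
  using assms sets.sets_into_space[OF assms]
  by (auto simp: tagged_partition_def disjoint_family_on_def less_2_cases_iff)

lemma bounded_complex_measure_bound:
  assumes "bounded_complex_measure M \<nu>"
  shows "\<exists>B. \<forall>E\<in>sets M. cmod (\<nu> E) \<le> B"
proof -
  obtain T where T: "T \<ge> 0" "total_variation M \<nu> (space M) = ennreal T" using bounded_complex_measureD(4)[OF assms] by blast
  have "cmod (\<nu> E) \<le> T" if "E \<in> sets M" for E
    using sum_cmod_partition_le[OF two_set_partition[OF that], of \<nu> T] T bounded_complex_measureD(2)[OF assms]
    by (simp add: numeral_2_eq_2) (smt (verit) norm_ge_zero)
  then show ?thesis by blast
qed

lemma signed_parts:
  assumes "bounded_complex_measure M \<nu>"
  shows "\<exists>B. signed_measure_on M (\<lambda>E. Re (\<nu> E)) B \<and> signed_measure_on M (\<lambda>E. Im (\<nu> E)) B"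
proof -
  obtain B where B: "\<And>E. E \<in> sets M \<Longrightarrow> cmod (\<nu> E) \<le> B" using bounded_complex_measure_bound[OF assms] by blast
  have "signed_measure_on M (\<lambda>E. Re (\<nu> E)) B" "signed_measure_on M (\<lambda>E. Im (\<nu> E)) B"
    using bounded_complex_measureD(2,3)[OF assms] sums_Re sums_Im B
    by (unfold_locales; fastforce intro: order_trans[OF abs_Re_le_cmod] order_trans[OF abs_Im_le_cmod])+
  then show ?thesis by blast
qed

text \<open>The integral is determined, with an error bound, by the values of \<open>\<nu>\<close> on the cells of a
  partition on which \<open>f\<close> is nearly constant. All algebraic rules for the integral follow from
  this estimate.\<close>

lemma complex_integral_step_estimate:
  assumes nu: "bounded_complex_measure M \<nu>"
  shows "\<exists>K. step_bound M \<nu> (complex_integral M \<nu>) K"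
proof -
  obtain B where B: "signed_measure_on M (\<lambda>E. Re (\<nu> E)) B" "signed_measure_on M (\<lambda>E. Im (\<nu> E)) B"
    using signed_parts[OF nu] by blast
  obtain K1 where "step_bound M (\<lambda>E. of_real (Re (\<nu> E))) (signed_integral M (\<lambda>E. Re (\<nu> E))) K1"
    using signed_integral_step_estimate[OF B(1)] by blast
  note K1 = step_boundD[OF this]
  obtain K2 where "step_bound M (\<lambda>E. of_real (Im (\<nu> E))) (signed_integral M (\<lambda>E. Im (\<nu> E))) K2"
    using signed_integral_step_estimate[OF B(2)] by blast
  note K2 = step_boundD[OF this]
  have "cmod (complex_integral M \<nu> f - (\<Sum>i<N. z i * \<nu> (A i))) \<le> (K1 + K2) * \<epsilon>"
    if H: "f \<in> borel_measurable M" "\<forall>x\<in>space M. cmod (f x) \<le> b" "tagged_partition M N A" "\<epsilon> \<ge> 0" "\<forall>i<N. \<forall>x\<in>A i. cmod (f x - z i) \<le> \<epsilon>"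
    for f b N A \<epsilon> z
  proof -
    define u where "u = signed_integral M (\<lambda>E. Re (\<nu> E)) f - (\<Sum>i<N. z i * of_real (Re (\<nu> (A i))))"
    define v where "v = signed_integral M (\<lambda>E. Im (\<nu> E)) f - (\<Sum>i<N. z i * of_real (Im (\<nu> (A i))))"
    have "(\<Sum>i<N. z i * \<nu> (A i)) = (\<Sum>i<N. z i * of_real (Re (\<nu> (A i)))) + \<i> * (\<Sum>i<N. z i * of_real (Im (\<nu> (A i))))"
      unfolding sum_distrib_left sum.distrib[symmetric]
      by (intro sum.cong refl) (subst (1) complex_eq, simp add: algebra_simps)
    then have "complex_integral M \<nu> f - (\<Sum>i<N. z i * \<nu> (A i)) = u + \<i> * v"
      by (simp add: complex_integral_def u_def v_def algebra_simps)
    moreover have "cmod (u + \<i> * v) \<le> cmod u + cmod v" using norm_triangle_ineq[of u "\<i> * v"] by (simp add: norm_mult)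
    ultimately show ?thesis using K1(2)[OF H] K2(2)[OF H] by (simp add: u_def v_def distrib_right)
  qed
  then have "step_bound M \<nu> (complex_integral M \<nu>) (K1 + K2)"
    unfolding step_bound_def using K1(1) K2(1) by simp
  then show ?thesis by blast
qed

lemma complex_integral_indicator:
  assumes "bounded_complex_measure M \<nu>" "E \<in> sets M"
  shows "complex_integral M \<nu> (indicator E) = \<nu> E"
proof -
  obtain K where K: "step_bound M \<nu> (complex_integral M \<nu>) K"
    using complex_integral_step_estimate[OF assms(1)] by blast
  have "cmod (complex_integral M \<nu> (indicator E) - (\<Sum>i<2::nat. (if i = 0 then 1 else 0) * \<nu> (if i = 0 then E else space M - E))) \<le> K * 0"
    by (rule step_boundD(2)[OF K _ _ two_set_partition[OF assms(2)], of _ 1]) (use assms(2) in \<open>auto split: split_indicator\<close>)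
  then show ?thesis by (simp add: numeral_2_eq_2)
qed

lemma signed_integral_dominated_convergence:
  fixes f :: "nat \<Rightarrow> 'a \<Rightarrow> complex"
  assumes "signed_measure_on M \<rho> B" and meas: "\<And>n. f n \<in> borel_measurable M" "g \<in> borel_measurable M"
    and lim: "\<And>x. x \<in> space M \<Longrightarrow> (\<lambda>n. f n x) \<longlonglongrightarrow> g x" and bd: "\<And>n x. x \<in> space M \<Longrightarrow> cmod (f n x) \<le> b"
  shows "(\<lambda>n. signed_integral M \<rho> (f n)) \<longlonglongrightarrow> signed_integral M \<rho> g"
proof -
  have "(\<lambda>n. LINT x|upper_variation M \<rho>'. f n x) \<longlonglongrightarrow> (LINT x|upper_variation M \<rho>'. g x)"
    if "signed_measure_on M \<rho>' B" for \<rho>'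
  proof -
    interpret s: signed_measure_on M \<rho>' B by fact
    interpret finite_measure "upper_variation M \<rho>'" by (rule s.finite_upper_variation)
    show ?thesis
    proof (rule integral_dominated_convergence[where w = "\<lambda>_. b"])
      show "g \<in> borel_measurable (upper_variation M \<rho>')" "f n \<in> borel_measurable (upper_variation M \<rho>')" for n
        using meas measurable_cong_sets[OF s.sets_upper_variation refl] by auto
    qed (use lim bd in \<open>auto simp: s.space_upper_variation\<close>)
  qed
  from this[OF assms(1)] this[OF signed_measure_on_minus[OF assms(1)]]
  show ?thesis unfolding signed_integral_def by (rule tendsto_diff)
qed

lemma complex_integral_dominated_convergence:
  fixes f :: "nat \<Rightarrow> 'a \<Rightarrow> complex"
  assumes "bounded_complex_measure M \<nu>" and "\<And>n. f n \<in> borel_measurable M" "g \<in> borel_measurable M"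
    and "\<And>x. x \<in> space M \<Longrightarrow> (\<lambda>n. f n x) \<longlonglongrightarrow> g x" and "\<And>n x. x \<in> space M \<Longrightarrow> cmod (f n x) \<le> b"
  shows "(\<lambda>n. complex_integral M \<nu> (f n)) \<longlonglongrightarrow> complex_integral M \<nu> g"
proof -
  obtain B where B: "signed_measure_on M (\<lambda>E. Re (\<nu> E)) B" "signed_measure_on M (\<lambda>E. Im (\<nu> E)) B"
    using signed_parts[OF assms(1)] by blast
  show ?thesis unfolding complex_integral_def
    by (intro tendsto_intros signed_integral_dominated_convergence[OF B(1) assms(2-5)] signed_integral_dominated_convergence[OF B(2) assms(2-5)])
qed

lemma total_variation_le:
  assumes "\<And>N A. tagged_partition M N A \<Longrightarrow> (\<Sum>i<N. cmod (\<nu> (A i))) \<le> T" "T \<ge> 0"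
  shows "total_variation M \<nu> (space M) \<le> ennreal T"
  unfolding total_variation_def
proof (rule SUP_least)
  fix P assume P: "P \<in> {P. finite P \<and> P \<subseteq> sets M \<and> disjoint P \<and> \<Union>P = space M}"
  then obtain h where h: "bij_betw h {..<card P} P" using ex_bij_betw_nat_finite[of P] by (auto simp: atLeast0LessThan)
  have "tagged_partition M (card P) h"
    unfolding tagged_partition_def
  proof (intro conjI allI impI)
    show "h i \<in> sets M" if "i < card P" for i using h P that by (auto simp: bij_betw_def)
    show "disjoint_family_on h {..<card P}"
      using h P by (intro disjoint_image_disjoint_family_on) (auto simp: bij_betw_def)
    show "(\<Union>i<card P. h i) = space M" using h P by (auto simp: bij_betw_def)
  qed
  then have "(\<Sum>i<card P. cmod (\<nu> (h i))) \<le> T" by (rule assms(1))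
  moreover have "(\<Sum>A\<in>P. ennreal (cmod (\<nu> A))) = ennreal (\<Sum>i<card P. cmod (\<nu> (h i)))"
    using sum.reindex_bij_betw[OF h, of "\<lambda>A. ennreal (cmod (\<nu> A))"] by (simp add: sum_ennreal)
  ultimately show "(\<Sum>A\<in>P. ennreal (cmod (\<nu> A))) \<le> ennreal T" by (simp add: ennreal_leI)
qed

lemma bounded_complex_measure_combination:
  assumes nu: "bounded_complex_measure M \<nu>" and om: "bounded_complex_measure M \<omega>"
  shows "bounded_complex_measure M (\<lambda>E. u * \<nu> E + v * \<omega> E)"
proof -
  obtain S where S: "S \<ge> 0" "total_variation M \<nu> (space M) = ennreal S" using bounded_complex_measureD(4)[OF nu] by blast
  obtain T where T: "T \<ge> 0" "total_variation M \<omega> (space M) = ennreal T" using bounded_complex_measureD(4)[OF om] by blast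
  have "(\<Sum>i<N. cmod (u * \<nu> (A i) + v * \<omega> (A i))) \<le> cmod u * S + cmod v * T" if A: "tagged_partition M N A" for N A
  proof -
    have "(\<Sum>i<N. cmod (u * \<nu> (A i) + v * \<omega> (A i))) \<le> cmod u * (\<Sum>i<N. cmod (\<nu> (A i))) + cmod v * (\<Sum>i<N. cmod (\<omega> (A i)))"
      unfolding sum_distrib_left sum.distrib[symmetric]
      by (intro sum_mono) (metis norm_mult norm_triangle_ineq)
    also have "\<dots> \<le> cmod u * S + cmod v * T"
      using sum_cmod_partition_le[OF A, of \<nu> S] sum_cmod_partition_le[OF A, of \<omega> T] S T
        bounded_complex_measureD(2)[OF nu] bounded_complex_measureD(2)[OF om]
      by (intro add_mono mult_left_mono) auto
    finally show ?thesis .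
  qed
  then have "total_variation M (\<lambda>E. u * \<nu> E + v * \<omega> E) (space M) \<le> ennreal (cmod u * S + cmod v * T)"
    using S T by (intro total_variation_le) auto
  then have "total_variation M (\<lambda>E. u * \<nu> E + v * \<omega> E) (space M) < \<infinity>" by (simp add: le_less_trans)
  then show ?thesis
    using bounded_complex_measureD(1-3)[OF nu] bounded_complex_measureD(1-3)[OF om]
    unfolding bounded_complex_measure_def by (auto intro!: sums_add sums_mult)
qed

lemma bounded_complex_measure_cnj:
  assumes "bounded_complex_measure M \<nu>"
  shows "bounded_complex_measure M (\<lambda>E. cnj (\<nu> E))"
proof -
  have "total_variation M (\<lambda>E. cnj (\<nu> E)) (space M) = total_variation M \<nu> (space M)"
    by (simp add: total_variation_def)
  then show ?thesis using assms unfolding bounded_complex_measure_def by (auto simp: sums_cnj)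
qed

lemma complex_integral_cong:
  assumes "\<And>x. x \<in> space M \<Longrightarrow> f x = g x"
  shows "complex_integral M \<nu> f = complex_integral M \<nu> g"
proof -
  have "(LINT x|upper_variation M \<rho>. f x) = (LINT x|upper_variation M \<rho>. g x)" for \<rho>
    by (rule Bochner_Integration.integral_cong)
       (use assms in \<open>auto simp: upper_variation_def sets.space_closed\<close>)
  then show ?thesis by (simp add: complex_integral_def signed_integral_def)
qed

section \<open>Riemann sums on a compact metric space\<close>

locale compact_metric_set =
  fixes \<Gamma> :: "'a::metric_space set"
  assumes compact_set: "compact \<Gamma>"
begin

abbreviation cint where "cint \<nu> f \<equiv> complex_integral (borel_on \<Gamma>) \<nu> f"

lemma space_borel_on: "space (borel_on \<Gamma>) = \<Gamma>" by (simp add: space_restrict_space)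

lemma closed_in_borel_on: "closed C \<Longrightarrow> C \<subseteq> \<Gamma> \<Longrightarrow> C \<in> sets (borel_on \<Gamma>)"
  by (subst sets_restrict_space_iff) (use compact_set in \<open>auto simp: compact_imp_closed borel_closed\<close>)

lemma MeasD: "\<nu> \<in> Meas \<Gamma> \<Longrightarrow> bounded_complex_measure (borel_on \<Gamma>) \<nu>" by (simp add: Meas_def)

definition fine_partition :: "real \<Rightarrow> nat \<Rightarrow> (nat \<Rightarrow> 'a set) \<Rightarrow> (nat \<Rightarrow> 'a) \<Rightarrow> bool" where
  "fine_partition \<delta> N A x \<longleftrightarrow> tagged_partition (borel_on \<Gamma>) N A \<and>
     (\<forall>i<N. x i \<in> \<Gamma> \<and> (\<forall>y\<in>A i. dist y (x i) < \<delta>))"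

lemma fine_partition_exists:
  assumes "\<delta> > 0" shows "\<exists>N A x. fine_partition \<delta> N A x"
proof -
  have "\<Gamma> \<subseteq> (\<Union>x\<in>\<Gamma>. ball x \<delta>)" using assms by auto
  then obtain k where k: "k \<subseteq> \<Gamma>" "finite k" "\<Gamma> \<subseteq> (\<Union>x\<in>k. ball x \<delta>)"
    using compactE_image[OF compact_set, of \<Gamma> "\<lambda>x. ball x \<delta>"] by auto
  obtain h where h: "bij_betw h {..<card k} k"
    using ex_bij_betw_nat_finite[OF k(2)] by (auto simp: atLeast0LessThan)
  define A where "A i = \<Gamma> \<inter> (ball (h i) \<delta> - (\<Union>j<i. ball (h j) \<delta>))" for i
  have "A i \<in> sets (borel_on \<Gamma>)" for i
    unfolding A_def by (auto simp: sets_restrict_space)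
  moreover have "disjoint_family_on A {..<card k}"
    unfolding disjoint_family_on_def
  proof (intro ballI impI)
    fix i j :: nat assume "i \<noteq> j"
    then consider "i < j" | "j < i" by linarith
    then show "A i \<inter> A j = {}" by cases (auto simp: A_def)
  qed
  moreover have "\<Gamma> \<subseteq> (\<Union>i<card k. A i)"
  proof
    fix y assume y: "y \<in> \<Gamma>"
    then obtain z where z: "z \<in> k" "y \<in> ball z \<delta>" using k(3) by blast
    then have "z \<in> h ` {..<card k}" by (simp only: bij_betw_imp_surj_on[OF h])
    then obtain i where i: "i < card k" "y \<in> ball (h i) \<delta>" using z(2) by blast
    define m where "m = (LEAST i. y \<in> ball (h i) \<delta>)"
    have "y \<in> ball (h m) \<delta>" "m \<le> i"
      unfolding m_def by (rule LeastI[of _ i], rule i(2)) (rule Least_le, rule i(2))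
    moreover have "y \<notin> ball (h j) \<delta>" if "j < m" for j
      using not_less_Least[of j "\<lambda>i. y \<in> ball (h i) \<delta>"] that unfolding m_def by blast
    ultimately show "y \<in> (\<Union>i<card k. A i)" using y i(1) by (auto simp: A_def intro!: bexI[of _ m])
  qed
  moreover have "(\<Union>i<card k. A i) \<subseteq> \<Gamma>" by (auto simp: A_def)
  moreover have "h i \<in> \<Gamma> \<and> (\<forall>y\<in>A i. dist y (h i) < \<delta>)" if "i < card k" for i
    using h k(1) that by (auto simp: A_def bij_betw_def dist_commute)
  ultimately have "fine_partition \<delta> (card k) A h"
    by (auto simp: fine_partition_def tagged_partition_def space_borel_on)
  then show ?thesis by blast
qed

text \<open>One sequence of tagged partitions with mesh tending to \<open>0\<close> is fixed. Every integral of a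
  continuous function is the limit of its sums over this sequence, so identities between
  integrals, including Fubini's theorem, follow from uniqueness of limits.\<close>

definition num :: "nat \<Rightarrow> nat" where
  "num n = (SOME N. \<exists>A x. fine_partition (inverse (real (Suc n))) N A x)"

definition cell :: "nat \<Rightarrow> nat \<Rightarrow> 'a set" where
  "cell n = (SOME A. \<exists>x. fine_partition (inverse (real (Suc n))) (num n) A x)"

definition tag :: "nat \<Rightarrow> nat \<Rightarrow> 'a" where
  "tag n = (SOME x. fine_partition (inverse (real (Suc n))) (num n) (cell n) x)"

lemma fine_partition: "fine_partition (inverse (real (Suc n))) (num n) (cell n) (tag n)"
proof -
  have "\<exists>A x. fine_partition (inverse (real (Suc n))) (num n) A x"
    unfolding num_def by (rule someI_ex) (rule fine_partition_exists, simp)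
  then have "\<exists>x. fine_partition (inverse (real (Suc n))) (num n) (cell n) x"
    unfolding cell_def by (rule someI_ex)
  then show ?thesis unfolding tag_def by (rule someI_ex)
qed

lemma partition: "tagged_partition (borel_on \<Gamma>) (num n) (cell n)"
  and tag_in: "i < num n \<Longrightarrow> tag n i \<in> \<Gamma>"
  and dist_tag: "i < num n \<Longrightarrow> y \<in> cell n i \<Longrightarrow> dist y (tag n i) < inverse (real (Suc n))"
  using fine_partition[of n] by (auto simp: fine_partition_def)

lemma cell_subset: "i < num n \<Longrightarrow> cell n i \<subseteq> \<Gamma>"
  using partition[of n] by (auto simp: tagged_partition_def space_borel_on)

definition riemann :: "('a set \<Rightarrow> complex) \<Rightarrow> ('a \<Rightarrow> complex) \<Rightarrow> nat \<Rightarrow> complex" where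
  "riemann \<nu> f n = (\<Sum>i<num n. f (tag n i) * \<nu> (cell n i))"

lemma continuous_measurable:
  "continuous_on \<Gamma> f \<Longrightarrow> (f :: 'a \<Rightarrow> complex) \<in> borel_measurable (borel_on \<Gamma>)"
  by (rule borel_measurable_continuous_on_restrict)

lemma continuous_bounded:
  assumes "continuous_on \<Gamma> (f :: 'a \<Rightarrow> complex)" shows "\<exists>b. \<forall>x\<in>\<Gamma>. cmod (f x) \<le> b"
  using compact_imp_bounded[OF compact_continuous_image[OF assms compact_set]] by (auto simp: bounded_iff)

lemma continuous_section:
  assumes "continuous_on (\<Gamma> \<times> \<Gamma>) (\<lambda>p. F (fst p) (snd p))" "y \<in> \<Gamma>"
  shows "continuous_on \<Gamma> (\<lambda>x. F x y)"
  using continuous_on_compose2[OF assms(1), of \<Gamma> "\<lambda>x. (x, y)"] assms(2) by (force intro: continuous_intros)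

lemma riemann_uniform_limit:
  assumes nu: "\<nu> \<in> Meas \<Gamma>" and F: "continuous_on (\<Gamma> \<times> \<Gamma>) (\<lambda>p. F (fst p) (snd p))" and "e > 0"
  shows "\<exists>n0. \<forall>n\<ge>n0. \<forall>y\<in>\<Gamma>. cmod (cint \<nu> (\<lambda>x. F x y) - riemann \<nu> (\<lambda>x. F x y) n) \<le> e"
proof -
  obtain K where "step_bound (borel_on \<Gamma>) \<nu> (complex_integral (borel_on \<Gamma>) \<nu>) K"
    using complex_integral_step_estimate[OF MeasD[OF nu]] by blast
  note K = step_boundD[OF this]
  define \<epsilon> where "\<epsilon> = e / (K + 1)"
  have eps: "\<epsilon> > 0" "K * \<epsilon> \<le> e" using K(1) \<open>e > 0\<close> by (auto simp: \<epsilon>_def field_simps)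
  obtain d where d: "d > 0" "\<And>p q. p \<in> \<Gamma> \<times> \<Gamma> \<Longrightarrow> q \<in> \<Gamma> \<times> \<Gamma> \<Longrightarrow> dist q p < d \<Longrightarrow> dist (F (fst q) (snd q)) (F (fst p) (snd p)) < \<epsilon>"
    using compact_uniformly_continuous[OF F compact_Times[OF compact_set compact_set]] eps(1)
    unfolding uniformly_continuous_on_def by blast
  obtain n0 where n0: "inverse (real (Suc n0)) < d" using reals_Archimedean[OF d(1)] by blast
  have "cmod (cint \<nu> (\<lambda>x. F x y) - riemann \<nu> (\<lambda>x. F x y) n) \<le> e" if n: "n \<ge> n0" and y: "y \<in> \<Gamma>" for n y
  proof -
    have cont: "continuous_on \<Gamma> (\<lambda>x. F x y)" by (rule continuous_section[OF F y])
    obtain b where b: "\<forall>x\<in>\<Gamma>. cmod (F x y) \<le> b" using continuous_bounded[OF cont] by blast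
    have "inverse (real (Suc n)) \<le> inverse (real (Suc n0))" using n by (simp add: field_simps)
    then have small: "inverse (real (Suc n)) < d" using n0 by (rule le_less_trans)
    have "cmod (cint \<nu> (\<lambda>x. F x y) - riemann \<nu> (\<lambda>x. F x y) n) \<le> K * \<epsilon>"
      unfolding riemann_def
    proof (rule K(2)[OF continuous_measurable[OF cont] _ partition])
      show "\<forall>x\<in>space (borel_on \<Gamma>). cmod (F x y) \<le> b" using b by (simp add: space_borel_on)
      show "\<forall>i<num n. \<forall>x\<in>cell n i. cmod (F x y - F (tag n i) y) \<le> \<epsilon>"
      proof (intro allI impI ballI)
        fix i x assume i: "i < num n" and x: "x \<in> cell n i"
        have "dist (x, y) (tag n i, y) < d" using dist_tag[OF i x] small by (simp add: dist_Pair_Pair)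
        then have "dist (F x y) (F (tag n i) y) < \<epsilon>"
          using d(2)[of "(tag n i, y)" "(x, y)"] tag_in[OF i] cell_subset[OF i] x y by auto
        then show "cmod (F x y - F (tag n i) y) \<le> \<epsilon>" by (simp add: dist_norm)
      qed
    qed (use eps in auto)
    then show ?thesis using eps by simp
  qed
  then show ?thesis by blast
qed

lemma riemann_limit:
  assumes nu: "\<nu> \<in> Meas \<Gamma>" and f: "continuous_on \<Gamma> f"
  shows "riemann \<nu> f \<longlonglongrightarrow> cint \<nu> f"
proof (cases "\<Gamma> = {}")
  case True
  have "cint \<nu> f = cint \<nu> (\<lambda>_. 0)" by (rule complex_integral_cong) (simp add: space_borel_on True)
  then have "cint \<nu> f = 0" by (simp add: complex_integral_def signed_integral_def)
  moreover have "num n = 0" for n using tag_in[of 0 n] True by auto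
  ultimately show ?thesis by (simp add: riemann_def[abs_def])
next
  case False
  then obtain y where y: "y \<in> \<Gamma>" by blast
  have "continuous_on (\<Gamma> \<times> \<Gamma>) (\<lambda>p. f (fst p))"
    by (rule continuous_on_compose2[OF f]) (auto intro: continuous_intros)
  from riemann_uniform_limit[OF nu, of "\<lambda>x _. f x", OF this] y
  have "\<exists>n0. \<forall>n\<ge>n0. cmod (cint \<nu> f - riemann \<nu> f n) \<le> e" if "e > 0" for e using that by blast
  then show ?thesis unfolding LIMSEQ_iff
    by (metis dense_order_class.dense le_less_trans norm_minus_commute)
qed

lemma cint_linear:
  assumes "\<nu> \<in> Meas \<Gamma>" "continuous_on \<Gamma> f" "continuous_on \<Gamma> g"
  shows "cint \<nu> (\<lambda>x. a * f x + b * g x) = a * cint \<nu> f + b * cint \<nu> g"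
proof (rule LIMSEQ_unique)
  show "riemann \<nu> (\<lambda>x. a * f x + b * g x) \<longlonglongrightarrow> cint \<nu> (\<lambda>x. a * f x + b * g x)"
    by (intro riemann_limit assms continuous_intros)
  have "riemann \<nu> (\<lambda>x. a * f x + b * g x) = (\<lambda>n. a * riemann \<nu> f n + b * riemann \<nu> g n)"
    by (rule ext) (simp add: riemann_def sum_distrib_left sum.distrib[symmetric] algebra_simps)
  then show "riemann \<nu> (\<lambda>x. a * f x + b * g x) \<longlonglongrightarrow> a * cint \<nu> f + b * cint \<nu> g"
    using assms by (auto intro!: tendsto_intros riemann_limit)
qed

lemma cint_const:
  assumes "\<nu> \<in> Meas \<Gamma>" shows "cint \<nu> (\<lambda>_. a) = a * \<nu> \<Gamma>"
proof -
  have "\<Gamma> \<in> sets (borel_on \<Gamma>)" by (rule closed_in_borel_on) (use compact_set compact_imp_closed in auto)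
  then have "cint \<nu> (indicator \<Gamma>) = \<nu> \<Gamma>" using complex_integral_indicator[OF MeasD[OF assms]] by blast
  moreover have "cint \<nu> (indicator \<Gamma>) = cint \<nu> (\<lambda>_. 1)"
    by (rule complex_integral_cong) (simp add: space_borel_on)
  ultimately show ?thesis using cint_linear[OF assms, of "\<lambda>_. 1" "\<lambda>_. 1" a 0] by simp
qed

lemma continuous_on_cint:
  assumes nu: "\<nu> \<in> Meas \<Gamma>" and F: "continuous_on (\<Gamma> \<times> \<Gamma>) (\<lambda>p. F (fst p) (snd p))"
  shows "continuous_on \<Gamma> (\<lambda>y. cint \<nu> (\<lambda>x. F x y))"
proof (rule uniform_limit_theorem[of _ "\<lambda>n y. riemann \<nu> (\<lambda>x. F x y) n" sequentially])
  have "continuous_on \<Gamma> (\<lambda>y. F x y)" if "x \<in> \<Gamma>" for x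
    using continuous_on_compose2[OF F, of \<Gamma> "\<lambda>y. (x, y)"] that by (force intro: continuous_intros)
  then have "continuous_on \<Gamma> (\<lambda>y. riemann \<nu> (\<lambda>x. F x y) n)" for n
    unfolding riemann_def using tag_in by (auto intro!: continuous_intros)
  then show "\<forall>\<^sub>F n in sequentially. continuous_on \<Gamma> (\<lambda>y. riemann \<nu> (\<lambda>x. F x y) n)" by simp
  show "uniform_limit \<Gamma> (\<lambda>n y. riemann \<nu> (\<lambda>x. F x y) n) (\<lambda>y. cint \<nu> (\<lambda>x. F x y)) sequentially"
  proof (rule uniform_limitI)
    fix e :: real assume "e > 0"
    then obtain n0 where n0: "\<forall>n\<ge>n0. \<forall>y\<in>\<Gamma>. cmod (cint \<nu> (\<lambda>x. F x y) - riemann \<nu> (\<lambda>x. F x y) n) \<le> e / 2"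
      using riemann_uniform_limit[OF nu F, of "e / 2"] by auto
    have "\<forall>n\<ge>n0. \<forall>y\<in>\<Gamma>. dist (riemann \<nu> (\<lambda>x. F x y) n) (cint \<nu> (\<lambda>x. F x y)) < e"
      using n0 \<open>e > 0\<close> by (fastforce simp: dist_norm norm_minus_commute)
    then show "\<forall>\<^sub>F n in sequentially. \<forall>y\<in>\<Gamma>. dist (riemann \<nu> (\<lambda>x. F x y) n) (cint \<nu> (\<lambda>x. F x y)) < e"
      by (auto simp: eventually_sequentially)
  qed
qed simp

definition double_sum :: "('a \<Rightarrow> 'a \<Rightarrow> complex) \<Rightarrow> ('a set \<Rightarrow> complex) \<Rightarrow> ('a set \<Rightarrow> complex) \<Rightarrow> nat \<Rightarrow> complex" where
  "double_sum F \<nu> \<omega> n = (\<Sum>i<num n. \<Sum>j<num n. F (tag n i) (tag n j) * \<nu> (cell n i) * \<omega> (cell n j))"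

text \<open>The inner sums converge uniformly in \<open>y\<close>, and the total variation of \<open>\<omega>\<close> bounds the effect of
  this on the outer sums.\<close>

lemma double_sum_limit:
  assumes nu: "\<nu> \<in> Meas \<Gamma>" and om: "\<omega> \<in> Meas \<Gamma>" and F: "continuous_on (\<Gamma> \<times> \<Gamma>) (\<lambda>p. F (fst p) (snd p))"
  shows "double_sum F \<nu> \<omega> \<longlonglongrightarrow> cint \<omega> (\<lambda>y. cint \<nu> (\<lambda>x. F x y))"
proof -
  define U where "U y = cint \<nu> (\<lambda>x. F x y)" for y
  obtain T where T: "T \<ge> 0" "total_variation (borel_on \<Gamma>) \<omega> (space (borel_on \<Gamma>)) = ennreal T"
    using bounded_complex_measureD(4)[OF MeasD[OF om]] by blast
  have lim: "riemann \<omega> U \<longlonglongrightarrow> cint \<omega> U"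
    unfolding U_def by (rule riemann_limit[OF om continuous_on_cint[OF nu F]])
  have "(\<lambda>n. double_sum F \<nu> \<omega> n - riemann \<omega> U n) \<longlonglongrightarrow> 0"
  proof (rule LIMSEQ_I)
    fix e :: real assume "e > 0"
    define \<epsilon> where "\<epsilon> = e / (T + 1)"
    have eps: "\<epsilon> > 0" "\<epsilon> * T < e" using T(1) \<open>e > 0\<close> by (auto simp: \<epsilon>_def field_simps)
    obtain n0 where n0: "\<forall>n\<ge>n0. \<forall>y\<in>\<Gamma>. cmod (U y - riemann \<nu> (\<lambda>x. F x y) n) \<le> \<epsilon>"
      using riemann_uniform_limit[OF nu F eps(1)] unfolding U_def by blast
    have "cmod (double_sum F \<nu> \<omega> n - riemann \<omega> U n - 0) < e" if n: "n \<ge> n0" for n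
    proof -
      have "double_sum F \<nu> \<omega> n - riemann \<omega> U n = (\<Sum>j<num n. (riemann \<nu> (\<lambda>x. F x (tag n j)) n - U (tag n j)) * \<omega> (cell n j))"
        unfolding double_sum_def riemann_def
        by (subst sum.swap) (simp add: sum_distrib_right sum_subtractf left_diff_distrib)
      also have "cmod \<dots> \<le> (\<Sum>j<num n. \<epsilon> * cmod (\<omega> (cell n j)))"
      proof (intro order_trans[OF norm_sum] sum_mono)
        fix j assume "j \<in> {..<num n}"
        then have "cmod (riemann \<nu> (\<lambda>x. F x (tag n j)) n - U (tag n j)) \<le> \<epsilon>"
          using n0 n tag_in by (simp add: norm_minus_commute)
        then show "cmod ((riemann \<nu> (\<lambda>x. F x (tag n j)) n - U (tag n j)) * \<omega> (cell n j)) \<le> \<epsilon> * cmod (\<omega> (cell n j))"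
          by (simp add: norm_mult mult_right_mono)
      qed
      also have "\<dots> \<le> \<epsilon> * T"
        unfolding sum_distrib_left[symmetric]
        using sum_cmod_partition_le[OF partition, of \<omega> T n] T bounded_complex_measureD(2)[OF MeasD[OF om]] eps(1)
        by (intro mult_left_mono) auto
      finally show ?thesis using eps(2) by simp
    qed
    then show "\<exists>n0. \<forall>n\<ge>n0. cmod (double_sum F \<nu> \<omega> n - riemann \<omega> U n - 0) < e" by blast
  qed
  from tendsto_add[OF this lim] show ?thesis by (simp add: U_def[abs_def])
qed

lemma cint_swap:
  assumes nu: "\<nu> \<in> Meas \<Gamma>" and om: "\<omega> \<in> Meas \<Gamma>" and F: "continuous_on (\<Gamma> \<times> \<Gamma>) (\<lambda>p. F (fst p) (snd p))"
  shows "cint \<omega> (\<lambda>y. cint \<nu> (\<lambda>x. F x y)) = cint \<nu> (\<lambda>x. cint \<omega> (\<lambda>y. F x y))"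
proof (rule LIMSEQ_unique[OF double_sum_limit[OF assms]])
  have "continuous_on (\<Gamma> \<times> \<Gamma>) (\<lambda>p. F (fst (prod.swap p)) (snd (prod.swap p)))"
    by (rule continuous_on_compose2[OF F]) (auto intro!: continuous_intros continuous_on_swap)
  then have "continuous_on (\<Gamma> \<times> \<Gamma>) (\<lambda>p. F (snd p) (fst p))" by simp
  from double_sum_limit[OF om nu, of "\<lambda>y x. F x y", OF this]
  have "double_sum (\<lambda>y x. F x y) \<omega> \<nu> \<longlonglongrightarrow> cint \<nu> (\<lambda>x. cint \<omega> (\<lambda>y. F x y))" .
  moreover have "double_sum (\<lambda>y x. F x y) \<omega> \<nu> = double_sum F \<nu> \<omega>"
    unfolding double_sum_def by (rule ext, subst sum.swap) (simp add: mult_ac)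
  ultimately show "double_sum F \<nu> \<omega> \<longlonglongrightarrow> cint \<nu> (\<lambda>x. cint \<omega> (\<lambda>y. F x y))" by simp
qed

lemma dirac_Meas:
  assumes "p \<in> \<Gamma>" shows "dirac \<Gamma> p \<in> Meas \<Gamma>" "dirac \<Gamma> p \<Gamma> = 1"
proof -
  have "(\<Sum>i<N. cmod (dirac \<Gamma> p (A i))) \<le> 1" if A: "tagged_partition (borel_on \<Gamma>) N A" for N A
  proof -
    obtain k where k: "k < N" "p \<in> A k" using A assms by (auto simp: tagged_partition_def space_borel_on)
    have "p \<notin> A i" if "i < N" "i \<noteq> k" for i
      using A k that unfolding tagged_partition_def disjoint_family_on_def by blast
    then have "(\<Sum>i<N. cmod (dirac \<Gamma> p (A i))) \<le> (\<Sum>i<N. if i = k then 1 else 0)"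
      by (intro sum_mono) (auto simp: dirac_def)
    then show ?thesis using k by simp
  qed
  from total_variation_le[OF this]
  have "total_variation (borel_on \<Gamma>) (dirac \<Gamma> p) (space (borel_on \<Gamma>)) \<le> ennreal 1" by simp
  then have tv: "total_variation (borel_on \<Gamma>) (dirac \<Gamma> p) (space (borel_on \<Gamma>)) < \<infinity>" by (simp add: le_less_trans)
  have "(\<lambda>i. dirac \<Gamma> p (A i)) sums dirac \<Gamma> p (\<Union>i. A i)"
    if A: "range (A :: nat \<Rightarrow> 'a set) \<subseteq> sets (borel_on \<Gamma>)" "disjoint_family A" for A
  proof (cases "\<exists>k. p \<in> A k")
    case True
    then obtain k where k: "p \<in> A k" by blast
    have "p \<notin> A i" if "i \<noteq> k" for i using A(2) k that unfolding disjoint_family_on_def by blast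
    then have "(\<lambda>i. dirac \<Gamma> p (A i)) = (\<lambda>i. if i = k then 1 else 0)"
      using A(1) k by (auto simp: dirac_def)
    moreover have "dirac \<Gamma> p (\<Union>i. A i) = 1" using A(1) k by (auto simp: dirac_def intro: sets.countable_UN)
    ultimately show ?thesis using sums_single[of k "\<lambda>_. 1 :: complex"] by simp
  next
    case False
    then show ?thesis by (simp add: dirac_def)
  qed
  then show "dirac \<Gamma> p \<in> Meas \<Gamma>" using tv by (simp add: Meas_def bounded_complex_measure_def dirac_def)
  show "dirac \<Gamma> p \<Gamma> = 1"
    using assms closed_in_borel_on[of \<Gamma>] compact_set compact_imp_closed by (auto simp: dirac_def)
qed

text \<open>In the step estimate the value on the cell that contains \<open>p\<close> is taken to be \<open>f p\<close>, so that the
  sum is exact.\<close>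

lemma cint_dirac:
  assumes p: "p \<in> \<Gamma>" and f: "continuous_on \<Gamma> f"
  shows "cint (dirac \<Gamma> p) f = f p"
proof -
  obtain K where "step_bound (borel_on \<Gamma>) (dirac \<Gamma> p) (complex_integral (borel_on \<Gamma>) (dirac \<Gamma> p)) K"
    using complex_integral_step_estimate[OF MeasD[OF dirac_Meas(1)[OF p]]] by blast
  note K = step_boundD[OF this]
  obtain b where b: "\<forall>x\<in>\<Gamma>. cmod (f x) \<le> b" using continuous_bounded[OF f] by blast
  have "cmod (cint (dirac \<Gamma> p) f - f p) \<le> e" if "e > 0" for e
  proof -
    define \<epsilon> where "\<epsilon> = e / (K + 1)"
    have eps: "\<epsilon> > 0" "K * \<epsilon> \<le> e" using K(1) \<open>e > 0\<close> by (auto simp: \<epsilon>_def field_simps)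
    obtain d where d: "d > 0" "\<And>x y. x \<in> \<Gamma> \<Longrightarrow> y \<in> \<Gamma> \<Longrightarrow> dist y x < d \<Longrightarrow> dist (f y) (f x) < \<epsilon>"
      using compact_uniformly_continuous[OF f compact_set] eps(1) unfolding uniformly_continuous_on_def by blast
    obtain N A x where A: "fine_partition (d / 2) N A x" using fine_partition_exists[of "d / 2"] d by auto
    then have part: "tagged_partition (borel_on \<Gamma>) N A" by (simp add: fine_partition_def)
    then have sub: "A i \<subseteq> \<Gamma>" if "i < N" for i using that by (auto simp: tagged_partition_def space_borel_on)
    obtain k where k: "k < N" "p \<in> A k" using part p by (auto simp: tagged_partition_def space_borel_on)
    define z where "z i = (if p \<in> A i then f p else f (x i))" for i
    have "cmod (f y - z i) \<le> \<epsilon>" if i: "i < N" and y: "y \<in> A i" for i y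
    proof -
      have dy: "dist y (x i) < d / 2" "x i \<in> \<Gamma>" using A i y by (auto simp: fine_partition_def)
      have "dist y (if p \<in> A i then p else x i) < d"
      proof (cases "p \<in> A i")
        case True
        then have "dist p (x i) < d / 2" using A i by (auto simp: fine_partition_def)
        then show ?thesis using True dy dist_triangle2[of y p "x i"] by simp
      qed (use dy d(1) in simp)
      then have "dist (f y) (f (if p \<in> A i then p else x i)) < \<epsilon>"
        using d(2)[of "if p \<in> A i then p else x i" y] dy sub[OF i] y p by auto
      then show ?thesis by (auto simp: z_def dist_norm split: if_splits)
    qed
    then have "cmod (cint (dirac \<Gamma> p) f - (\<Sum>i<N. z i * dirac \<Gamma> p (A i))) \<le> K * \<epsilon>"
      using K(2)[OF continuous_measurable[OF f] _ part, of b \<epsilon> z] b eps by (simp add: space_borel_on)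
    moreover have "(\<Sum>i<N. z i * dirac \<Gamma> p (A i)) = (\<Sum>i<N. if i = k then f p else 0)"
    proof (intro sum.cong refl)
      fix i assume i: "i \<in> {..<N}"
      show "z i * dirac \<Gamma> p (A i) = (if i = k then f p else 0)"
      proof (cases "i = k")
        case True
        then show ?thesis using k part by (simp add: z_def dirac_def tagged_partition_def)
      next
        case False
        then have "p \<notin> A i" using part i k unfolding tagged_partition_def disjoint_family_on_def by blast
        then show ?thesis using False by (simp add: dirac_def)
      qed
    qed
    ultimately show ?thesis using k eps by simp
  qed
  then have "cmod (cint (dirac \<Gamma> p) f - f p) \<le> 0" by (rule field_le_epsilon[of _ 0, simplified])
  then show ?thesis by simp
qed

end

section \<open>The sesquilinear form of a positive semidefinite kernel\<close>

locale psd_kernel = compact_metric_set +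
  fixes k :: "'a \<Rightarrow> 'a \<Rightarrow> real"
  assumes continuous_kernel: "continuous_on (\<Gamma> \<times> \<Gamma>) (\<lambda>p. k (fst p) (snd p))"
    and kernel_commute: "k x y = k y x"
    and kernel_psd: "\<And>(a :: nat \<Rightarrow> real) x n. (\<Sum>i<n. \<Sum>j<n. a i * a j * k (x i) (x j)) \<ge> 0"
begin

lemma continuous_complex_kernel: "continuous_on (\<Gamma> \<times> \<Gamma>) (\<lambda>p. complex_of_real (k (fst p) (snd p)))"
  by (intro continuous_intros continuous_kernel)

definition form :: "('a set \<Rightarrow> complex) \<Rightarrow> ('a set \<Rightarrow> complex) \<Rightarrow> complex" where
  "form \<nu> \<omega> = cint (\<lambda>E. cnj (\<omega> E)) (\<lambda>y. cint \<nu> (\<lambda>x. complex_of_real (k x y)))"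

lemma cnj_Meas: "\<nu> \<in> Meas \<Gamma> \<Longrightarrow> (\<lambda>E. cnj (\<nu> E)) \<in> Meas \<Gamma>"
  by (simp add: Meas_def bounded_complex_measure_cnj)

lemma combination_Meas: "\<nu> \<in> Meas \<Gamma> \<Longrightarrow> \<omega> \<in> Meas \<Gamma> \<Longrightarrow> (\<lambda>E. a * \<nu> E + b * \<omega> E) \<in> Meas \<Gamma>"
  by (simp add: Meas_def bounded_complex_measure_combination)

abbreviation kernel_sum where
  "kernel_sum \<nu> \<omega> \<equiv> double_sum (\<lambda>x y. complex_of_real (k x y)) \<nu> (\<lambda>E. cnj (\<omega> E))"

lemma form_limit: "\<nu> \<in> Meas \<Gamma> \<Longrightarrow> \<omega> \<in> Meas \<Gamma> \<Longrightarrow> kernel_sum \<nu> \<omega> \<longlonglongrightarrow> form \<nu> \<omega>"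
  unfolding form_def by (intro double_sum_limit cnj_Meas continuous_complex_kernel)

lemma form_linear_left:
  assumes "\<nu> \<in> Meas \<Gamma>" "\<nu>' \<in> Meas \<Gamma>" "\<omega> \<in> Meas \<Gamma>"
  shows "form (\<lambda>E. a * \<nu> E + b * \<nu>' E) \<omega> = a * form \<nu> \<omega> + b * form \<nu>' \<omega>"
proof (rule LIMSEQ_unique[OF form_limit[OF combination_Meas]])
  have "kernel_sum (\<lambda>E. a * \<nu> E + b * \<nu>' E) \<omega> = (\<lambda>n. a * kernel_sum \<nu> \<omega> n + b * kernel_sum \<nu>' \<omega> n)"
    by (rule ext) (simp add: double_sum_def sum_distrib_left sum.distrib[symmetric] algebra_simps)
  then show "kernel_sum (\<lambda>E. a * \<nu> E + b * \<nu>' E) \<omega> \<longlonglongrightarrow> a * form \<nu> \<omega> + b * form \<nu>' \<omega>"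
    using assms by (auto intro!: tendsto_intros form_limit)
qed (use assms in auto)

lemma form_hermitian:
  assumes "\<nu> \<in> Meas \<Gamma>" "\<omega> \<in> Meas \<Gamma>"
  shows "form \<omega> \<nu> = cnj (form \<nu> \<omega>)"
proof (rule LIMSEQ_unique[OF form_limit[OF assms(2,1)]])
  have "kernel_sum \<omega> \<nu> n = cnj (kernel_sum \<nu> \<omega> n)" for n
  proof -
    have "kernel_sum \<omega> \<nu> n = (\<Sum>j<num n. \<Sum>i<num n. complex_of_real (k (tag n i) (tag n j)) * \<omega> (cell n i) * cnj (\<nu> (cell n j)))"
      unfolding double_sum_def by (rule sum.swap)
    also have "\<dots> = cnj (kernel_sum \<nu> \<omega> n)"
      by (simp add: double_sum_def kernel_commute mult_ac)
    finally show ?thesis .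
  qed
  then have "kernel_sum \<omega> \<nu> = (\<lambda>n. cnj (kernel_sum \<nu> \<omega> n))" by (rule ext)
  then show "kernel_sum \<omega> \<nu> \<longlonglongrightarrow> cnj (form \<nu> \<omega>)"
    using tendsto_cnj[OF form_limit[OF assms]] by simp
qed

lemma form_linear_right:
  assumes "\<nu> \<in> Meas \<Gamma>" "\<omega> \<in> Meas \<Gamma>" "\<omega>' \<in> Meas \<Gamma>"
  shows "form \<nu> (\<lambda>E. a * \<omega> E + b * \<omega>' E) = cnj a * form \<nu> \<omega> + cnj b * form \<nu> \<omega>'"
proof -
  have "form \<nu> (\<lambda>E. a * \<omega> E + b * \<omega>' E) = cnj (form (\<lambda>E. a * \<omega> E + b * \<omega>' E) \<nu>)"
    using assms by (intro form_hermitian combination_Meas)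
  also have "\<dots> = cnj a * cnj (form \<omega> \<nu>) + cnj b * cnj (form \<omega>' \<nu>)"
    using assms by (simp add: form_linear_left)
  also have "\<dots> = cnj a * form \<nu> \<omega> + cnj b * form \<nu> \<omega>'"
    using form_hermitian[OF assms(2,1)] form_hermitian[OF assms(3,1)] by simp
  finally show ?thesis .
qed

text \<open>The products of a real and an imaginary part of two weights drop out of the real part of the
  double sums, which leaves two real quadratic forms.\<close>

lemma form_psd:
  assumes "\<nu> \<in> Meas \<Gamma>"
  shows "form \<nu> \<nu> \<in> \<real>" "0 \<le> Re (form \<nu> \<nu>)"
proof -
  show "form \<nu> \<nu> \<in> \<real>" using form_hermitian[OF assms assms] by (metis Reals_cnj_iff)
  have "Re (kernel_sum \<nu> \<nu> n) \<ge> 0" for n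
  proof -
    have "Re (kernel_sum \<nu> \<nu> n) =
        (\<Sum>i<num n. \<Sum>j<num n. Re (\<nu> (cell n i)) * Re (\<nu> (cell n j)) * k (tag n i) (tag n j)) +
        (\<Sum>i<num n. \<Sum>j<num n. Im (\<nu> (cell n i)) * Im (\<nu> (cell n j)) * k (tag n i) (tag n j))"
      unfolding double_sum_def by (simp add: sum.distrib[symmetric] algebra_simps)
    then show ?thesis using kernel_psd by (simp add: add_nonneg_nonneg)
  qed
  then show "0 \<le> Re (form \<nu> \<nu>)"
    using LIMSEQ_le_const[OF tendsto_Re[OF form_limit[OF assms assms]]] by blast
qed

text \<open>The Cauchy-Schwarz inequality in its degenerate case: the form at \<open>\<nu> - t z \<omega>\<close> with
  \<open>z = form \<nu> \<omega>\<close> would be negative for small \<open>t > 0\<close> if \<open>z \<noteq> 0\<close>.\<close>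

lemma form_null:
  assumes "\<nu> \<in> Meas \<Gamma>" "\<omega> \<in> Meas \<Gamma>" "form \<nu> \<nu> = 0"
  shows "form \<nu> \<omega> = 0"
proof (rule ccontr)
  define z where "z = form \<nu> \<omega>"
  define w where "w = Re (form \<omega> \<omega>)"
  assume "form \<nu> \<omega> \<noteq> 0"
  then have z: "cmod z > 0" by (simp add: z_def)
  have w: "w \<ge> 0" "form \<omega> \<omega> = of_real w" using form_psd[OF assms(2)] by (auto simp: w_def complex_is_Real_iff complex_eq_iff)
  define t where "t = 1 / (w + 1)"
  have t: "t > 0" "t * w < 1" using w by (auto simp: t_def field_simps)
  define c where "c = - of_real t * z"
  have M: "(\<lambda>E. 1 * \<nu> E + c * \<omega> E) \<in> Meas \<Gamma>" using assms by (intro combination_Meas)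
  have "form (\<lambda>E. 1 * \<nu> E + c * \<omega> E) (\<lambda>E. 1 * \<nu> E + c * \<omega> E) =
      1 * form \<nu> (\<lambda>E. 1 * \<nu> E + c * \<omega> E) + c * form \<omega> (\<lambda>E. 1 * \<nu> E + c * \<omega> E)"
    by (rule form_linear_left[OF assms(1,2) M])
  also have "\<dots> = cnj c * z + c * (cnj z + cnj c * of_real w)"
    unfolding form_linear_right[OF assms(1,1,2)] form_linear_right[OF assms(2,1,2)]
    using form_hermitian[OF assms(1,2)] assms(3) w(2) by (simp add: z_def)
  also have "\<dots> = of_real (- (t * (2 - t * w)) * (cmod z)\<^sup>2)"
    unfolding of_real_mult of_real_minus complex_norm_square by (simp add: c_def algebra_simps)
  finally have "0 \<le> - (t * (2 - t * w)) * (cmod z)\<^sup>2" using form_psd(2)[OF M] by simp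
  moreover have "t * (2 - t * w) * (cmod z)\<^sup>2 > 0" using t z by simp
  ultimately show False by simp
qed

end

section \<open>Definiteness\<close>

context metrized_graph_arcs
begin

sublocale psd_kernel \<Gamma> potential
proof
  show "compact \<Gamma>" by (rule compact)
  show "continuous_on (\<Gamma> \<times> \<Gamma>) (\<lambda>p. potential (fst p) (snd p))" by (rule continuous_on_potential)
  show "potential x y = potential y x" for x y by (rule potential_commute)
  show "(\<Sum>i<n. \<Sum>j<n. a i * a j * potential (x i) (x j)) \<ge> 0" for a :: "nat \<Rightarrow> real" and x n
    by (rule potential_psd) simp
qed

lemma continuous_potential: "y \<in> \<Gamma> \<Longrightarrow> continuous_on \<Gamma> (\<lambda>x. complex_of_real (potential x y))"
  by (intro continuous_intros continuous_on_potential_section)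

lemma interior_point:
  assumes "x \<in> \<Gamma>" "x \<notin> V"
  shows "\<exists>c L s. (c, L) \<in> E \<and> s \<in> {0<..<L} \<and> x = c s"
proof -
  obtain c L s where "(c, L) \<in> E" "s \<in> {0..L}" "x = c s" using graph_eq assms(1) by blast
  moreover from this have "s \<in> {0<..<L}" using arc_vertex_iff[of c L s] assms(2) by auto
  ultimately show ?thesis by blast
qed

lemma form_dirac:
  assumes "\<nu> \<in> Meas \<Gamma>" "y \<in> \<Gamma>"
  shows "form \<nu> (dirac \<Gamma> y) = cint \<nu> (\<lambda>x. complex_of_real (potential x y))"
proof -
  have "(\<lambda>E. cnj (dirac \<Gamma> y E)) = dirac \<Gamma> y" by (auto simp: dirac_def)
  then show ?thesis
    unfolding form_def using cint_dirac[OF assms(2) continuous_on_cint[OF assms(1) continuous_complex_kernel]] by simp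
qed

end

locale null_measure = metrized_graph_arcs +
  fixes \<nu> :: "'a set \<Rightarrow> complex"
  assumes Meas: "\<nu> \<in> Meas \<Gamma>"
    and null: "\<And>y. y \<in> \<Gamma> \<Longrightarrow> cint \<nu> (\<lambda>x. complex_of_real (potential x y)) = 0"
begin

lemma cint_combination:
  assumes "continuous_on \<Gamma> f" "continuous_on \<Gamma> g" "cint \<nu> (\<lambda>x. complex_of_real (f x)) = 0" "cint \<nu> (\<lambda>x. complex_of_real (g x)) = 0"
  shows "cint \<nu> (\<lambda>x. complex_of_real (a * f x + b * g x)) = 0"
  using cint_linear[OF Meas, of "\<lambda>x. complex_of_real (f x)" "\<lambda>x. complex_of_real (g x)" "of_real a" "of_real b"] assms
  by (simp add: continuous_on_of_real)

text \<open>The functions that \<open>\<nu>\<close> annihilates form a space that contains every section of the kernel. The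
  aim is to find in it sequences that converge to the indicators of enough sets.\<close>

definition annihilated :: "('a \<Rightarrow> real) set" where
  "annihilated = {f. continuous_on \<Gamma> f \<and> cint \<nu> (\<lambda>x. complex_of_real (f x)) = 0}"

lemma annihilated_potential: "y \<in> \<Gamma> \<Longrightarrow> (\<lambda>x. potential x y) \<in> annihilated"
  by (simp add: annihilated_def null continuous_on_potential_section)

lemma annihilated_combination: "f \<in> annihilated \<Longrightarrow> g \<in> annihilated \<Longrightarrow> (\<lambda>x. a * f x + b * g x) \<in> annihilated"
  using cint_combination by (auto simp: annihilated_def intro!: continuous_intros)

lemma annihilated_scale: "f \<in> annihilated \<Longrightarrow> (\<lambda>x. a * f x) \<in> annihilated"
  using annihilated_combination[of f f a 0] by simp

lemma annihilated_diff: "f \<in> annihilated \<Longrightarrow> g \<in> annihilated \<Longrightarrow> (\<lambda>x. f x - g x) \<in> annihilated"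
  using annihilated_combination[of f g 1 "-1"] by simp

lemma annihilated_zero: "(\<lambda>_. 0) \<in> annihilated"
  using annihilated_scale[OF annihilated_potential, of _ 0] nonempty by auto

lemma annihilated_sum:
  assumes "finite I" "\<And>i. i \<in> I \<Longrightarrow> f i \<in> annihilated" shows "(\<lambda>x. \<Sum>i\<in>I. f i x) \<in> annihilated"
  using assms
proof (induction I rule: finite_induct)
  case empty
  then show ?case by (simp add: annihilated_zero)
next
  case (insert i I)
  then show ?case using annihilated_combination[of "f i" "\<lambda>x. \<Sum>i\<in>I. f i x" 1 1] by simp
qed

lemma annihilated_cong: "f \<in> annihilated \<Longrightarrow> (\<And>x. x \<in> \<Gamma> \<Longrightarrow> f x = g x) \<Longrightarrow> g \<in> annihilated"
  using complex_integral_cong[of "borel_on \<Gamma>" "\<lambda>x. complex_of_real (f x)" "\<lambda>x. complex_of_real (g x)" \<nu>]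
  by (auto simp: annihilated_def space_borel_on cong: continuous_on_cong)

lemma annihilated_limit_null:
  assumes f: "\<And>n. f n \<in> annihilated" and X: "X \<in> sets (borel_on \<Gamma>)"
    and lim: "\<And>x. x \<in> \<Gamma> \<Longrightarrow> (\<lambda>n. f n x) \<longlonglongrightarrow> indicator X x" and bd: "\<And>n x. x \<in> \<Gamma> \<Longrightarrow> \<bar>f n x\<bar> \<le> b"
  shows "\<nu> X = 0"
proof -
  have "(\<lambda>n. cint \<nu> (\<lambda>x. complex_of_real (f n x))) \<longlonglongrightarrow> cint \<nu> (indicator X)"
  proof (rule complex_integral_dominated_convergence[OF MeasD[OF Meas]])
    show "(\<lambda>x. complex_of_real (f n x)) \<in> borel_measurable (borel_on \<Gamma>)" for n
      using f[of n] by (intro continuous_measurable) (auto simp: annihilated_def intro!: continuous_intros)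
    show "(indicator X :: 'a \<Rightarrow> complex) \<in> borel_measurable (borel_on \<Gamma>)" using X by simp
    show "(\<lambda>n. complex_of_real (f n x)) \<longlonglongrightarrow> indicator X x" if "x \<in> space (borel_on \<Gamma>)" for x
      using tendsto_of_real[OF lim, of x, where ?'a = complex] that
      by (simp add: space_borel_on indicator_def of_bool_def split: if_splits)
    show "cmod (complex_of_real (f n x)) \<le> b" if "x \<in> space (borel_on \<Gamma>)" for n x
      using bd that by (simp add: space_borel_on)
  qed
  moreover have "cint \<nu> (\<lambda>x. complex_of_real (f n x)) = 0" for n using f[of n] by (simp add: annihilated_def)
  ultimately show ?thesis
    using complex_integral_indicator[OF MeasD[OF Meas] X] LIMSEQ_unique[OF tendsto_const] by fastforce
qed

text \<open>Along an arc the kernel is the sum of an affine function and the Green kernel of the arc, so the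
  latter is a combination of three sections.\<close>

lemma annihilated_bridge:
  assumes E: "(c, L) \<in> E" "t \<in> {0..L}"
  shows "(\<lambda>x. bridge (c, L) x (c t)) \<in> annihilated"
proof -
  have "c t \<in> \<Gamma>" "c 0 \<in> \<Gamma>" "c L \<in> \<Gamma>" using arcD(7)[OF E(1)] E(2) arcD(1)[OF E(1)] by auto
  then have "(\<lambda>x. potential x (c t) - ((1 - t / L) * potential x (c 0) + t / L * potential x (c L))) \<in> annihilated"
    by (intro annihilated_diff annihilated_combination annihilated_potential)
  then show ?thesis
    by (rule annihilated_cong) (simp add: potential_commute[of _ "c t"] potential_commute[of _ "c 0"] potential_commute[of _ "c L"]
        potential_arc[OF E] bridge_commute)
qed

text \<open>The matrix \<open>grounded_laplacian\<close> inverts \<open>vertex_kernel\<close>, hence turns the sections at the vertices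
  into the barycentric coordinates.\<close>

lemma annihilated_hat:
  assumes "v \<in> V" shows "hat v \<in> annihilated"
proof -
  have "(\<lambda>x. \<Sum>w\<in>V. grounded_laplacian v w * potential x w) \<in> annihilated"
    using V_subset by (intro annihilated_sum finite_V annihilated_scale annihilated_potential) auto
  moreover have "(\<Sum>w\<in>V. grounded_laplacian v w * potential x w) = hat v x" for x
  proof -
    have "(\<Sum>w\<in>V. grounded_laplacian v w * potential x w) = (\<Sum>w\<in>V. \<Sum>u\<in>V. grounded_laplacian v w * (hat u x * vertex_kernel w u))"
      by (intro sum.cong refl) (simp add: potential_commute[of x] potential_vertex sum_distrib_left)
    also have "\<dots> = (\<Sum>u\<in>V. hat u x * (\<Sum>w\<in>V. grounded_laplacian v w * vertex_kernel w u))"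
      by (subst sum.swap) (simp add: sum_distrib_left mult_ac)
    also have "\<dots> = (\<Sum>u\<in>V. hat u x * of_bool (u = v))"
      using vertex_kernel_inverse[OF assms] by (intro sum.cong refl) (simp add: eq_commute[of v])
    finally show ?thesis using sum_of_bool(1)[OF assms] by simp
  qed
  ultimately show ?thesis by (simp add: fun_eq_iff[symmetric])
qed

text \<open>The second difference of the Green kernel in its second argument is a tent, and the difference
  of two tents with the same centre is a trapezoid, which can be made to approximate the
  indicator of any closed interval inside the arc.\<close>

definition tent :: "real \<Rightarrow> real \<Rightarrow> real \<Rightarrow> real" where "tent t \<eta> s = max 0 (\<eta> - \<bar>s - t\<bar>)"

lemma green_second_difference:
  assumes "0 \<le> \<eta>"
  shows "2 * green L s t - green L s (t - \<eta>) - green L s (t + \<eta>) = tent t \<eta> s"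
proof -
  have "2 * min s t - min s (t - \<eta>) - min s (t + \<eta>) = tent t \<eta> s" using assms by (auto simp: tent_def min_def max_def)
  moreover have "2 * (s * t / L) - s * (t - \<eta>) / L - s * (t + \<eta>) / L = 0" by (simp add: algebra_simps diff_divide_distrib add_divide_distrib)
  ultimately show ?thesis by (simp add: green_def)
qed

lemma annihilated_tent:
  assumes E: "(c, L) \<in> E" and t: "0 \<le> \<eta>" "\<eta> \<le> t" "t + \<eta> \<le> L"
  shows "\<exists>f\<in>annihilated. (\<forall>s\<in>{0..L}. f (c s) = tent t \<eta> s) \<and> (\<forall>x. x \<notin> c ` {0..L} \<longrightarrow> f x = 0)"
proof (intro bexI conjI ballI allI impI)
  let ?f = "\<lambda>x. (2 * bridge (c, L) x (c t) - bridge (c, L) x (c (t - \<eta>))) - bridge (c, L) x (c (t + \<eta>))"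
  show "?f \<in> annihilated"
    using t by (intro annihilated_diff annihilated_scale annihilated_bridge[OF E]) auto
  show "?f (c s) = tent t \<eta> s" if "s \<in> {0..L}" for s
    using that t green_second_difference[of \<eta> L s t] by (simp add: bridge_arc[OF E])
  show "?f x = 0" if "x \<notin> c ` {0..L}" for x
  proof -
    have "c ` {0<..<L} \<subseteq> c ` {0..L}" by (intro image_mono) auto
    then have "x \<notin> c ` {0<..<L}" using that by blast
    then show ?thesis using bridge_off_arc(1)[OF E, of x] by simp
  qed
qed

lemma subarc_measurable:
  assumes "(c, L) \<in> E" "0 < a" "b < L"
  shows "c ` {a..b} \<in> sets (borel_on \<Gamma>)"
proof (rule closed_in_borel_on)
  have "compact (c ` {a..b})"
    using isometric_arc_continuous[OF arcD(2)[OF assms(1)]] assms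
    by (intro compact_continuous_image) (auto intro: continuous_on_subset)
  then show "closed (c ` {a..b})" by (rule compact_imp_closed)
qed (use arcD(7)[OF assms(1)] assms in auto)

lemma null_subarc:
  assumes E: "(c, L) \<in> E" and ab: "0 < a" "a \<le> b" "b < L"
  shows "\<nu> (c ` {a..b}) = 0"
proof -
  define t where "t = (a + b) / 2"
  define r where "r = (b - a) / 2"
  \<comment> \<open>The trapezoids have half-width \<open>r\<close> at the top and \<open>\<eta> n\<close> at the bottom; \<open>\<rho>\<close> is the room that is
    left on the arc.\<close>
  define \<rho> where "\<rho> = min a (L - b)"
  define \<eta> where "\<eta> n = r + \<rho> / real (Suc n)" for n
  have rho: "\<rho> > 0" "\<rho> \<le> a" "\<rho> \<le> L - b" using ab by (auto simp: \<rho>_def)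
  have r: "0 \<le> r" "t - r = a" "t + r = b" using ab by (auto simp: r_def t_def field_simps)
  have "\<rho> / real (Suc n) \<le> \<rho>" "\<rho> / real (Suc n) > 0" for n using rho(1) by (auto simp: field_simps)
  then have eta: "r < \<eta> n" "\<eta> n \<le> t" "t + \<eta> n \<le> L" for n
    using rho r by (auto simp: \<eta>_def) (smt (verit))+
  have eta_lim: "\<eta> \<longlonglongrightarrow> r"
  proof -
    have "(\<lambda>n. r + \<rho> * inverse (real (Suc n))) \<longlonglongrightarrow> r + \<rho> * 0"
      by (intro tendsto_intros LIMSEQ_inverse_real_of_nat)
    then show ?thesis by (simp add: \<eta>_def[abs_def] divide_inverse)
  qed
  obtain g where g: "g \<in> annihilated" "\<And>s. s \<in> {0..L} \<Longrightarrow> g (c s) = tent t r s" "\<And>x. x \<notin> c ` {0..L} \<Longrightarrow> g x = 0"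
    using annihilated_tent[OF E, of r t] r ab by auto
  have "\<forall>n. \<exists>f. f \<in> annihilated \<and> (\<forall>s\<in>{0..L}. f (c s) = tent t (\<eta> n) s) \<and> (\<forall>x. x \<notin> c ` {0..L} \<longrightarrow> f x = 0)"
    using annihilated_tent[OF E, of "\<eta> _" t] eta r(1) by (metis less_eq_real_def order_trans)
  then obtain f where f: "\<And>n. f n \<in> annihilated" "\<And>n s. s \<in> {0..L} \<Longrightarrow> f n (c s) = tent t (\<eta> n) s" "\<And>n x. x \<notin> c ` {0..L} \<Longrightarrow> f n x = 0"
    by metis
  define h where "h n x = inverse (\<eta> n - r) * (f n x - g x)" for n x
  have h_arc: "h n (c s) = (if \<bar>s - t\<bar> \<le> r then 1 else if \<bar>s - t\<bar> < \<eta> n then (\<eta> n - \<bar>s - t\<bar>) / (\<eta> n - r) else 0)"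
    if "s \<in> {0..L}" for n s
    using f(2)[OF that, of n] g(2)[OF that] eta(1)[of n] by (auto simp: h_def tent_def max_def divide_inverse mult.commute)
  have h_off: "h n x = 0" if "x \<notin> c ` {0..L}" for n x using f(3)[OF that] g(3)[OF that] by (simp add: h_def)
  have mem: "c s \<in> c ` {a..b} \<longleftrightarrow> \<bar>s - t\<bar> \<le> r" if "s \<in> {0..L}" for s
  proof -
    have "c s \<in> c ` {a..b} \<longleftrightarrow> s \<in> {a..b}"
    proof
      assume "c s \<in> c ` {a..b}"
      then obtain u where u: "u \<in> {a..b}" "c s = c u" by blast
      then have "s = u" using arcD(9)[OF E that, of u] ab by auto
      then show "s \<in> {a..b}" using u by simp
    qed simp
    then show ?thesis using r by auto
  qed
  show ?thesis
  proof (rule annihilated_limit_null[where f = h and b = 1])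
    show "h n \<in> annihilated" for n
      unfolding h_def by (intro annihilated_scale annihilated_diff f(1) g(1))
    show "c ` {a..b} \<in> sets (borel_on \<Gamma>)" by (rule subarc_measurable[OF E ab(1,3)])
    fix x assume x: "x \<in> \<Gamma>"
    show "\<bar>h n x\<bar> \<le> 1" for n
    proof (cases "x \<in> c ` {0..L}")
      case True
      then obtain s where s: "s \<in> {0..L}" "x = c s" by blast
      show ?thesis using h_arc[OF s(1), of n] eta(1)[of n] s(2) by (auto simp: divide_le_eq)
    qed (simp add: h_off)
    show "(\<lambda>n. h n x) \<longlonglongrightarrow> indicator (c ` {a..b}) x"
    proof (cases "x \<in> c ` {0..L}")
      case False
      moreover have "c ` {a..b} \<subseteq> c ` {0..L}" using ab by auto
      ultimately have "indicator (c ` {a..b}) x = (0::real)" by (auto simp: indicator_def)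
      then show ?thesis using False by (simp add: h_off)
    next
      case True
      then obtain s where s: "s \<in> {0..L}" "x = c s" by blast
      show ?thesis
      proof (cases "\<bar>s - t\<bar> \<le> r")
        case True
        then show ?thesis using h_arc[OF s(1)] mem[OF s(1)] s(2) by simp
      next
        case False
        then have "\<forall>\<^sub>F n in sequentially. \<eta> n < \<bar>s - t\<bar>" using eta_lim by (intro order_tendstoD) auto
        then have "\<forall>\<^sub>F n in sequentially. h n x = 0"
          by eventually_elim (use h_arc[OF s(1)] s(2) False in auto)
        then have "(\<lambda>n. h n x) \<longlonglongrightarrow> 0" by (rule tendsto_eventually)
        then show ?thesis using mem[OF s(1)] s(2) False by simp
      qed
    qed
  qed
qed

text \<open>A hat at \<open>v\<close> with small support is obtained from \<open>hat v\<close> by cutting off, on each arc at \<open>v\<close>,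
  the multiple of the Green kernel with its corner near \<open>v\<close>.\<close>

lemma null_vertex:
  assumes v: "v \<in> V" shows "\<nu> {v} = 0"
proof -
  define len_min where "len_min = Min (snd ` E)"
  have "E \<noteq> {}" using nonempty graph_eq by auto
  then have "len_min \<in> snd ` E" unfolding len_min_def using finite_E by (intro Min_in) auto
  then have lpos: "len_min > 0" using arcD(1) by auto
  have le: "len_min \<le> L" if "(c, L) \<in> E" for c L
    unfolding len_min_def using finite_E that by (intro Min_le) force+
  define \<eta> where "\<eta> n = len_min * inverse (real (Suc n))" for n
  have eta: "0 < \<eta> n" "\<eta> n \<le> len_min" for n
    using lpos by (auto simp: \<eta>_def field_simps)
  have eta_lim: "\<eta> \<longlonglongrightarrow> 0"
  proof -
    have "\<eta> \<longlonglongrightarrow> len_min * 0" unfolding \<eta>_def[abs_def] by (intro tendsto_intros LIMSEQ_inverse_real_of_nat)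
    then show ?thesis by simp
  qed
  define cut where "cut n = (\<lambda>(c, L) x. of_bool (c 0 = v) / \<eta> n * bridge (c, L) x (c (\<eta> n)) +
      of_bool (c L = v) / \<eta> n * bridge (c, L) x (c (L - \<eta> n)))" for n
  define h where "h n x = hat v x - (\<Sum>e\<in>E. cut n e x)" for n x
  have cut_off: "cut n (d, M) x = 0" if "(d, M) \<in> E" "x \<notin> d ` {0<..<M}" for n d M x
    using bridge_off_arc(1)[OF that] by (simp add: cut_def)
  have h_vertex: "h n w = of_bool (w = v)" if "w \<in> V" for n w
  proof -
    have "cut n e w = 0" if e: "e \<in> E" for e
    proof -
      obtain d M where [simp]: "e = (d, M)" by fastforce
      have E: "(d, M) \<in> E" using e by simp
      then have "w \<notin> d ` {0<..<M}" using arcD(6) \<open>w \<in> V\<close> by blast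
      then show ?thesis using cut_off[OF E] by simp
    qed
    then show ?thesis using hat_vertex[OF v that] by (simp add: h_def eq_commute[of v w])
  qed
  have h_arc: "h n (c s) = of_bool (c 0 = v) * ((1 - s / L) - green L s (\<eta> n) / \<eta> n) +
      of_bool (c L = v) * (s / L - green L s (L - \<eta> n) / \<eta> n)"
    if E: "(c, L) \<in> E" and s: "s \<in> {0<..<L}" for n c L s
  proof -
    have "cut n e (c s) = (if e = (c, L) then cut n (c, L) (c s) else 0)" if e: "e \<in> E" for e
    proof (cases "e = (c, L)")
      case False
      obtain d M where dM: "e = (d, M)" by fastforce
      then have "(d, M) \<in> E" "(c, L) \<noteq> (d, M)" using e False by auto
      then have "cut n (d, M) (c s) = 0" using cut_off arc_interiors[OF E _ _ s] by blast
      then show ?thesis using False dM by (subst if_not_P[OF False]) simp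
    qed simp
    then have "(\<Sum>e\<in>E. cut n e (c s)) = (\<Sum>e\<in>E. if e = (c, L) then cut n (c, L) (c s) else 0)"
      by (intro sum.cong) auto
    also have "\<dots> = cut n (c, L) (c s)" using E finite_E by simp
    finally have "h n (c s) = hat v (c s) - cut n (c, L) (c s)" by (simp add: h_def)
    moreover have "bridge (c, L) (c s) (c (\<eta> n)) = green L s (\<eta> n)" "bridge (c, L) (c s) (c (L - \<eta> n)) = green L s (L - \<eta> n)"
      using bridge_arc[OF E, of s "\<eta> n"] bridge_arc[OF E, of s "L - \<eta> n"] s eta[of n] le[OF E] by auto
    ultimately show ?thesis
      using hat_arc[OF E _ v, of s] s by (simp add: cut_def algebra_simps)
  qed
  have profile: "1 - s / L - green L s \<eta>' / \<eta>' = max 0 (1 - s / \<eta>')" "s / L - green L s (L - \<eta>') / \<eta>' = max 0 (1 - (L - s) / \<eta>')"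
    if "s \<in> {0<..<L}" "0 < \<eta>'" "\<eta>' \<le> L" for s L \<eta>'
  proof -
    show "1 - s / L - green L s \<eta>' / \<eta>' = max 0 (1 - s / \<eta>')"
      using that by (cases "s \<le> \<eta>'") (auto simp: green_def field_simps max_def)
    show "s / L - green L s (L - \<eta>') / \<eta>' = max 0 (1 - (L - s) / \<eta>')"
      using that by (cases "s \<le> L - \<eta>'") (auto simp: green_def field_simps max_def)
  qed
  show ?thesis
  proof (rule annihilated_limit_null[where f = h and b = 2])
    show "h n \<in> annihilated" for n
    proof -
      have "cut n e \<in> annihilated" if e: "e \<in> E" for e
      proof -
        obtain c L where cL: "e = (c, L)" by fastforce
        have E: "(c, L) \<in> E" using e cL by simp
        show ?thesis unfolding cut_def cL prod.case
          by (intro annihilated_combination annihilated_bridge[OF E]) (use eta[of n] le[OF E] in auto)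
      qed
      then show ?thesis unfolding h_def by (intro annihilated_diff annihilated_hat v annihilated_sum finite_E)
    qed
    show "{v} \<in> sets (borel_on \<Gamma>)" using singleton_in_borel_on v V_subset by auto
    fix x assume x: "x \<in> \<Gamma>"
    show "\<bar>h n x\<bar> \<le> 2" for n
    proof (cases "x \<in> V")
      case False
      then obtain c L s where E: "(c, L) \<in> E" "s \<in> {0<..<L}" "x = c s"
        using interior_point[of x] x by blast
      have "max 0 (1 - s / \<eta> n) \<le> 1" "max 0 (1 - (L - s) / \<eta> n) \<le> 1" using E(2) eta(1)[of n] by auto
      then show ?thesis
        using h_arc[OF E(1,2), of n] profile[OF E(2) eta(1), of n] eta(2)[of n] le[OF E(1)] E(3) by (auto simp: of_bool_def)
    qed (simp add: h_vertex)
    show "(\<lambda>n. h n x) \<longlonglongrightarrow> indicator {v} x"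
    proof (cases "x \<in> V")
      case True
      then show ?thesis by (simp add: h_vertex indicator_def of_bool_def)
    next
      case False
      then obtain c L s where E: "(c, L) \<in> E" "s \<in> {0<..<L}" "x = c s"
        using interior_point[of x] x by blast
      have "\<forall>\<^sub>F n in sequentially. \<eta> n < min s (L - s)" using eta_lim E(2) by (intro order_tendstoD) auto
      then have "\<forall>\<^sub>F n in sequentially. h n x = 0"
      proof eventually_elim
        case (elim n)
        then have "1 - s / \<eta> n \<le> 0" "1 - (L - s) / \<eta> n \<le> 0" using eta(1)[of n] by (auto simp: field_simps)
        then show ?case using h_arc[OF E(1,2), of n] profile[OF E(2) eta(1), of n] eta(2)[of n] le[OF E(1)] E(3) by simp
      qed
      then have "(\<lambda>n. h n x) \<longlonglongrightarrow> 0" by (rule tendsto_eventually)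
      moreover have "x \<noteq> v" using False v by auto
      ultimately show ?thesis by simp
    qed
  qed
qed

text \<open>A family of null sets that is closed under intersections and generates the Borel sets. The
  subarcs stay away from the vertices, so that those on different arcs are disjoint.\<close>

definition generators :: "'a set set" where
  "generators = insert {} ((\<lambda>v. {v}) ` V \<union> {c ` {a..b} | c a b. \<exists>L. (c, L) \<in> E \<and> 0 < a \<and> a \<le> b \<and> b < L})"

lemma subarc_generator:
  "(c, L) \<in> E \<Longrightarrow> 0 < a \<Longrightarrow> a \<le> b \<Longrightarrow> b < L \<Longrightarrow> c ` {a..b} \<in> generators"
  unfolding generators_def by blast

lemma null_generator: "A \<in> generators \<Longrightarrow> \<nu> A = 0"
  unfolding generators_def using null_subarc null_vertex bounded_complex_measureD(2)[OF MeasD[OF Meas]] by auto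

lemma generators_measurable: "generators \<subseteq> sets (borel_on \<Gamma>)"
  unfolding generators_def using singleton_in_borel_on V_subset subarc_measurable by auto

lemma Int_stable_generators: "Int_stable generators"
proof (rule Int_stableI)
  fix A B assume AB: "A \<in> generators" "B \<in> generators"
  have arc: "(\<exists>c L a b. A = c ` {a..b} \<and> (c, L) \<in> E \<and> 0 < a \<and> a \<le> b \<and> b < L) \<or> (\<exists>v. A \<subseteq> {v})" if "A \<in> generators" for A
    using that unfolding generators_def by blast
  have small: "A \<inter> B \<in> generators" if "A \<subseteq> {v}" "A \<in> generators" for A B v
  proof -
    have "A \<inter> B = {} \<or> A \<inter> B = A" using that by auto
    then show ?thesis
    proof
      assume "A \<inter> B = {}"
      then show ?thesis by (simp add: generators_def)
    next
      assume "A \<inter> B = A"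
      then show ?thesis using that(2) by simp
    qed
  qed
  show "A \<inter> B \<in> generators"
  proof (cases "\<exists>v. A \<subseteq> {v} \<or> B \<subseteq> {v}")
    case True
    then show ?thesis using small[of A _ B] small[of B _ A] AB by (metis Int_commute)
  next
    case False
    then obtain c L a b d M a' b' where A: "A = c ` {a..b}" "(c, L) \<in> E" "0 < a" "a \<le> b" "b < L"
      and B: "B = d ` {a'..b'}" "(d, M) \<in> E" "0 < a'" "a' \<le> b'" "b' < M"
      using arc[OF AB(1)] arc[OF AB(2)] by metis
    show ?thesis
    proof (cases "(c, L) = (d, M)")
      case True
      have "inj_on c {0..L}" by (rule isometric_arc_inj[OF arcD(2)[OF A(2)]])
      then have "A \<inter> B = c ` ({a..b} \<inter> {a'..b'})"
        unfolding A(1) B(1) using True A B by (subst inj_on_image_Int[of c "{0..L}"]) auto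
      also have "{a..b} \<inter> {a'..b'} = {max a a'..min b b'}" by auto
      finally have eq: "A \<inter> B = c ` {max a a'..min b b'}" .
      show ?thesis
      proof (cases "max a a' \<le> min b b'")
        case True
        then show ?thesis unfolding eq using A by (intro subarc_generator[OF A(2)]) auto
      next
        case False
        then have "A \<inter> B = {}" unfolding eq by auto
        then show ?thesis by (simp add: generators_def)
      qed
    next
      case False
      have "c s \<noteq> d t" if "s \<in> {a..b}" "t \<in> {a'..b'}" for s t
        using arcs_disjoint[OF A(2) B(2), of s t] False that A B by auto
      then have "A \<inter> B = {}" unfolding A(1) B(1) by auto
      then show ?thesis by (simp add: generators_def)
    qed
  qed
qed

text \<open>An open set contains, with each point of the interior of an arc, a subarc around it with
  rational end parameters.\<close>

lemma open_in_generated: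
  assumes "open U" shows "\<Gamma> \<inter> U \<in> sigma_sets \<Gamma> generators"
proof -
  define S where "S = (\<lambda>v. {v}) ` (V \<inter> U) \<union>
    {c ` {a..b} | c a b. a \<in> \<rat> \<and> b \<in> \<rat> \<and> (\<exists>L. (c, L) \<in> E \<and> 0 < a \<and> a \<le> b \<and> b < L \<and> c ` {a..b} \<subseteq> U)}"
  have "countable ((\<lambda>((c, L), a, b). c ` {a..b}) ` (E \<times> \<rat> \<times> \<rat>))"
    using finite_E countable_rat by (intro countable_image countable_SIGMA) (auto intro: countable_finite)
  moreover have "{c ` {a..b} | c a b. a \<in> \<rat> \<and> b \<in> \<rat> \<and> (\<exists>L. (c, L) \<in> E \<and> 0 < a \<and> a \<le> b \<and> b < L \<and> c ` {a..b} \<subseteq> U)}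
      \<subseteq> (\<lambda>((c, L), a, b). c ` {a..b}) ` (E \<times> \<rat> \<times> \<rat>)" by force
  ultimately have "countable S" unfolding S_def
    using finite_V by (intro countable_Un) (auto intro: countable_finite countable_subset)
  moreover have "S \<subseteq> generators" unfolding S_def generators_def by blast
  ultimately have "\<Union>S \<in> sigma_sets \<Gamma> generators"
    by (intro sigma_sets_UNION) (auto intro: sigma_sets.Basic)
  moreover have "\<Union>S = \<Gamma> \<inter> U"
  proof
    have "c ` {a..b} \<subseteq> \<Gamma>" if "(c, L) \<in> E" "0 < a" "b < L" for c L a b using arcD(7)[OF that(1)] that by auto
    then show "\<Union>S \<subseteq> \<Gamma> \<inter> U" unfolding S_def using V_subset by blast
    show "\<Gamma> \<inter> U \<subseteq> \<Union>S"
    proof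
      fix x assume x: "x \<in> \<Gamma> \<inter> U"
      show "x \<in> \<Union>S"
      proof (cases "x \<in> V")
        case True
        then show ?thesis using x by (auto simp: S_def)
      next
        case False
        then obtain c L s where E: "(c, L) \<in> E" "s \<in> {0<..<L}" "x = c s"
          using interior_point[of x] x by blast
        obtain e where e: "e > 0" "ball x e \<subseteq> U" using assms x by (auto elim: openE)
        define r where "r = min e (min s (L - s))"
        have r: "r > 0" "r \<le> e" "r \<le> s" "r \<le> L - s" using e E(2) by (auto simp: r_def)
        obtain a where a: "a \<in> \<rat>" "s - r < a" "a < s" using Rats_dense_in_real[of "s - r" s] r by auto
        obtain b where b: "b \<in> \<rat>" "s < b" "b < s + r" using Rats_dense_in_real[of s "s + r"] r by auto
        have "c ` {a..b} \<subseteq> U"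
        proof
          fix y assume "y \<in> c ` {a..b}"
          then obtain u where u: "u \<in> {a..b}" "y = c u" by blast
          then have "dist x y < e" using arcD(8)[OF E(1), of s u] E(2,3) a b r by auto
          then show "y \<in> U" using e(2) by auto
        qed
        moreover have "0 < a" "a \<le> b" "b < L" using a b r by auto
        ultimately have "c ` {a..b} \<in> S" unfolding S_def using a(1) b(1) E(1) by blast
        moreover have "x \<in> c ` {a..b}" using E(3) a b by auto
        ultimately show ?thesis by blast
      qed
    qed
  qed
  ultimately show ?thesis by simp
qed

lemma sets_generated: "sets (borel_on \<Gamma>) = sigma_sets \<Gamma> generators"
proof
  show "sigma_sets \<Gamma> generators \<subseteq> sets (borel_on \<Gamma>)"
    using sets.sigma_sets_subset[OF generators_measurable] by (simp add: space_borel_on)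
  show "sets (borel_on \<Gamma>) \<subseteq> sigma_sets \<Gamma> generators"
  proof
    fix A assume "A \<in> sets (borel_on \<Gamma>)"
    then obtain X where X: "X \<in> sets borel" "A = \<Gamma> \<inter> X" by (auto simp: sets_restrict_space)
    have "X \<in> sigma_sets UNIV {S. open S}" using X(1) by (simp add: borel_def)
    then have "\<Gamma> \<inter> X \<in> sigma_sets \<Gamma> generators"
    proof induction
      case (Basic a)
      then show ?case by (simp add: open_in_generated)
    next
      case Empty
      then show ?case by (simp add: sigma_sets.Empty)
    next
      case (Compl a)
      have "\<Gamma> \<inter> (UNIV - a) = \<Gamma> - (\<Gamma> \<inter> a)" by auto
      then show ?case using sigma_sets.Compl[OF Compl.IH] by simp
    next
      case (Union a)
      have "\<Gamma> \<inter> (\<Union>i. a i) = (\<Union>i. \<Gamma> \<inter> a i)" by auto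
      then show ?case using sigma_sets.Union[OF Union.IH] by simp
    qed
    then show "A \<in> sigma_sets \<Gamma> generators" using X by simp
  qed
qed

lemma measure_zero:
  assumes "\<nu> \<Gamma> = 0" shows "\<nu> = (\<lambda>_. 0)"
proof
  fix A
  note D = bounded_complex_measureD[OF MeasD[OF Meas]]
  obtain B where B: "signed_measure_on (borel_on \<Gamma>) (\<lambda>E. Re (\<nu> E)) B" "signed_measure_on (borel_on \<Gamma>) (\<lambda>E. Im (\<nu> E)) B"
    using signed_parts[OF MeasD[OF Meas]] by blast
  have additive: "\<nu> (A \<union> C) = \<nu> A + \<nu> C" if "A \<in> sets (borel_on \<Gamma>)" "C \<in> sets (borel_on \<Gamma>)" "A \<inter> C = {}" for A C
    using signed_measure_on.additive[OF B(1) that] signed_measure_on.additive[OF B(2) that] by (simp add: complex_eq_iff)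
  show "\<nu> A = 0"
  proof (cases "A \<in> sets (borel_on \<Gamma>)")
    case True
    have sub: "generators \<subseteq> Pow \<Gamma>" using generators_measurable sets.sets_into_space[of _ "borel_on \<Gamma>"] by (auto simp: space_borel_on)
    have "A \<in> sigma_sets \<Gamma> generators" using True by (simp add: sets_generated)
    with Int_stable_generators sub show ?thesis
    proof (induction rule: sigma_sets_induct_disjoint)
      case (basic A)
      then show ?case by (rule null_generator)
    next
      case empty
      then show ?case by (rule D(2))
    next
      case (compl A)
      then have "A \<in> sets (borel_on \<Gamma>)" by (simp add: sets_generated)
      then have "\<nu> (A \<union> (\<Gamma> - A)) = \<nu> A + \<nu> (\<Gamma> - A)"
        using sets.compl_sets[of A "borel_on \<Gamma>"] by (intro additive) (auto simp: space_borel_on)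
      moreover have "A \<union> (\<Gamma> - A) = \<Gamma>" using \<open>A \<in> sets (borel_on \<Gamma>)\<close> sets.sets_into_space by (fastforce simp: space_borel_on)
      ultimately show ?case using compl assms by simp
    next
      case (union A)
      then have "range A \<subseteq> sets (borel_on \<Gamma>)" by (auto simp: sets_generated)
      then have "(\<lambda>i. \<nu> (A i)) sums \<nu> (\<Union>i. A i)" using union by (intro D(3))
      then show ?case using union sums_unique2[OF sums_zero] by fastforce
    qed
  qed (rule D(1))
qed

end

section \<open>The energy pairings\<close>

context metrized_graph_arcs
begin

text \<open>By Cauchy-Schwarz a null vector of the form is orthogonal to all Dirac measures, which means that
  its potential vanishes.\<close>

lemma form_definite:
  assumes "\<nu> \<in> Meas0 \<Gamma>" "form \<nu> \<nu> = 0"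
  shows "\<nu> = (\<lambda>_. 0)"
proof -
  have nu: "\<nu> \<in> Meas \<Gamma>" "\<nu> \<Gamma> = 0" using assms(1) by (auto simp: Meas0_def)
  interpret null_measure \<Gamma> V E \<nu>
  proof
    show "\<nu> \<in> Meas \<Gamma>" by (rule nu(1))
    show "cint \<nu> (\<lambda>x. complex_of_real (potential x y)) = 0" if "y \<in> \<Gamma>" for y
      using form_null[OF nu(1) dirac_Meas(1)[OF that] assms(2)] form_dirac[OF nu(1) that] by simp
  qed
  show ?thesis by (rule measure_zero[OF nu(2)])
qed

definition potential_of :: "('a set \<Rightarrow> complex) \<Rightarrow> 'a \<Rightarrow> complex" where
  "potential_of \<nu> y = cint \<nu> (\<lambda>x. complex_of_real (potential x y))"

lemma continuous_potential_of: "\<nu> \<in> Meas \<Gamma> \<Longrightarrow> continuous_on \<Gamma> (potential_of \<nu>)"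
  unfolding potential_of_def[abs_def] by (rule continuous_on_cint[OF _ continuous_complex_kernel])

lemma cint_linear3:
  assumes "\<nu> \<in> Meas \<Gamma>" "continuous_on \<Gamma> f" "continuous_on \<Gamma> g"
  shows "cint \<nu> (\<lambda>x. f x + a * g x + b) = cint \<nu> f + a * cint \<nu> g + b * \<nu> \<Gamma>"
proof -
  have "continuous_on \<Gamma> (\<lambda>x. 1 * f x + a * g x)" using assms by (intro continuous_intros)
  from cint_linear[OF assms(1) this continuous_on_const, of 1 b 1]
  show ?thesis using cint_linear[OF assms, of 1 a] cint_const[OF assms(1), of 1] by simp
qed

lemma signed_Meas1D:
  assumes "\<mu> \<in> signed_Meas1 \<Gamma>"
  shows "\<mu> \<in> Meas \<Gamma>" "\<mu> \<Gamma> = 1" "(\<lambda>E. cnj (\<mu> E)) = \<mu>"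
  using assms by (auto simp: signed_Meas1_def Meas1_def Reals_cnj_iff)

lemma j_mu_eq:
  assumes mu: "\<mu> \<in> signed_Meas1 \<Gamma>" and "x \<in> \<Gamma>" "y \<in> \<Gamma>"
  shows "j_mu \<Gamma> \<mu> x y = complex_of_real (potential x y) - potential_of \<mu> x - potential_of \<mu> y
    + cint \<mu> (\<lambda>\<zeta>. complex_of_real (potential \<zeta> \<zeta>))"
proof -
  note m = signed_Meas1D[OF mu]
  have diag: "continuous_on \<Gamma> (\<lambda>\<zeta>. complex_of_real (potential \<zeta> \<zeta>))"
    using continuous_on_compose2[OF continuous_complex_kernel, of \<Gamma> "\<lambda>\<zeta>. (\<zeta>, \<zeta>)"] by (force intro: continuous_intros)
  have cont: "continuous_on \<Gamma> (\<lambda>\<zeta>. complex_of_real (potential \<zeta> x) + 1 * complex_of_real (potential \<zeta> y) + 0)"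
    using assms by (intro continuous_intros continuous_potential)
  have "j_mu \<Gamma> \<mu> x y = cint \<mu> (\<lambda>\<zeta>. complex_of_real (potential \<zeta> \<zeta>)
      + (-1) * (complex_of_real (potential \<zeta> x) + 1 * complex_of_real (potential \<zeta> y) + 0) + complex_of_real (potential x y))"
    unfolding j_mu_def
    by (rule complex_integral_cong)
       (use assms in \<open>simp add: space_borel_on j_kernel_potential potential_commute[of x]\<close>)
  also have "\<dots> = cint \<mu> (\<lambda>\<zeta>. complex_of_real (potential \<zeta> \<zeta>)) +
      (-1) * cint \<mu> (\<lambda>\<zeta>. complex_of_real (potential \<zeta> x) + 1 * complex_of_real (potential \<zeta> y) + 0) + complex_of_real (potential x y) * \<mu> \<Gamma>"
    by (rule cint_linear3[OF m(1) diag cont])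
  also have "cint \<mu> (\<lambda>\<zeta>. complex_of_real (potential \<zeta> x) + 1 * complex_of_real (potential \<zeta> y) + 0) =
      potential_of \<mu> x + 1 * potential_of \<mu> y + 0 * \<mu> \<Gamma>"
    unfolding potential_of_def by (rule cint_linear3[OF m(1)]) (use assms continuous_potential in auto)
  finally show ?thesis using m(2) by simp
qed

text \<open>Integrating \<open>j_mu\<close> against \<open>\<mu>\<close>, the potential of \<open>\<mu>\<close> cancels, so the result is a constant.\<close>

lemma g_mu_eq:
  assumes mu: "\<mu> \<in> signed_Meas1 \<Gamma>" and xy: "x \<in> \<Gamma>" "y \<in> \<Gamma>"
  shows "g_mu \<Gamma> \<mu> x y = complex_of_real (potential x y) - potential_of \<mu> x - potential_of \<mu> y + form \<mu> \<mu>"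
proof -
  note m = signed_Meas1D[OF mu]
  define \<kappa> where "\<kappa> = cint \<mu> (\<lambda>\<zeta>. complex_of_real (potential \<zeta> \<zeta>))"
  have form: "form \<mu> \<mu> = cint \<mu> (potential_of \<mu>)" by (simp add: form_def m(3) potential_of_def[abs_def])
  have int: "cint \<mu> (\<lambda>x. j_mu \<Gamma> \<mu> x y) = \<kappa> - form \<mu> \<mu>" if y: "y \<in> \<Gamma>" for y
  proof -
    have "cint \<mu> (\<lambda>x. j_mu \<Gamma> \<mu> x y) =
        cint \<mu> (\<lambda>x. complex_of_real (potential x y) + (-1) * potential_of \<mu> x + (\<kappa> - potential_of \<mu> y))"
      by (rule complex_integral_cong) (use y in \<open>simp add: space_borel_on j_mu_eq[OF mu] \<kappa>_def\<close>)
    also have "\<dots> = potential_of \<mu> y + (-1) * form \<mu> \<mu> + (\<kappa> - potential_of \<mu> y) * \<mu> \<Gamma>"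
      unfolding form potential_of_def[of \<mu> y]
      by (rule cint_linear3[OF m(1) continuous_potential[OF y] continuous_potential_of[OF m(1)]])
    finally show ?thesis using m(2) by simp
  qed
  have "c_mu \<Gamma> \<mu> = \<kappa> - form \<mu> \<mu>"
    unfolding c_mu_def using int xy by (intro the_equality) auto
  then show ?thesis using j_mu_eq[OF assms] by (simp add: g_mu_def \<kappa>_def)
qed

text \<open>The projection of \<open>Meas \<Gamma>\<close> onto \<open>Meas0 \<Gamma>\<close> along \<open>\<mu>\<close>. The factor \<open>1\<close> gives it the shape of the
  combinations in the linearity rules.\<close>

definition projection :: "('a set \<Rightarrow> complex) \<Rightarrow> ('a set \<Rightarrow> complex) \<Rightarrow> 'a set \<Rightarrow> complex" where
  "projection \<mu> \<nu> = (\<lambda>X. 1 * \<nu> X + (- \<nu> \<Gamma>) * \<mu> X)"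

lemma projection_Meas0:
  assumes "\<mu> \<in> signed_Meas1 \<Gamma>" "\<nu> \<in> Meas \<Gamma>"
  shows "projection \<mu> \<nu> \<in> Meas0 \<Gamma>"
proof -
  have "projection \<mu> \<nu> \<in> Meas \<Gamma>"
    unfolding projection_def by (rule combination_Meas[OF assms(2) signed_Meas1D(1)[OF assms(1)]])
  then show ?thesis using signed_Meas1D(2)[OF assms(1)] by (simp add: Meas0_def projection_def)
qed

text \<open>The four terms of \<open>g_mu\<close> are those in the expansion of the form at \<open>\<nu> - \<nu>(\<Gamma>) \<mu>\<close> and
  \<open>\<omega> - \<omega>(\<Gamma>) \<mu>\<close>; all parts of the theorem follow from this identity.\<close>

lemma mu_energy_pairing_eq:
  assumes mu: "\<mu> \<in> signed_Meas1 \<Gamma>" and nu: "\<nu> \<in> Meas \<Gamma>" and om: "\<omega> \<in> Meas \<Gamma>"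
  shows "mu_energy_pairing \<Gamma> \<mu> \<nu> \<omega> = form (projection \<mu> \<nu>) (projection \<mu> \<omega>)"
proof -
  note m = signed_Meas1D[OF mu]
  have swap: "cint \<nu> (potential_of \<mu>) = form \<nu> \<mu>"
  proof -
    have "form \<nu> \<mu> = cint \<mu> (\<lambda>y. cint \<nu> (\<lambda>x. complex_of_real (potential x y)))" by (simp add: form_def m(3))
    also have "\<dots> = cint \<nu> (\<lambda>x. cint \<mu> (\<lambda>y. complex_of_real (potential x y)))"
      by (rule cint_swap[OF nu m(1) continuous_complex_kernel])
    finally show ?thesis by (simp add: potential_of_def[abs_def] potential_commute)
  qed
  have inner: "cint \<nu> (\<lambda>x. g_mu \<Gamma> \<mu> x y) = potential_of \<nu> y + (- \<nu> \<Gamma>) * potential_of \<mu> y + (\<nu> \<Gamma> * form \<mu> \<mu> - form \<nu> \<mu>)"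
    if y: "y \<in> \<Gamma>" for y
  proof -
    have "cint \<nu> (\<lambda>x. g_mu \<Gamma> \<mu> x y) =
        cint \<nu> (\<lambda>x. complex_of_real (potential x y) + (-1) * potential_of \<mu> x + (form \<mu> \<mu> - potential_of \<mu> y))"
      by (rule complex_integral_cong) (use y in \<open>simp add: space_borel_on g_mu_eq[OF mu]\<close>)
    also have "\<dots> = potential_of \<nu> y + (-1) * form \<nu> \<mu> + (form \<mu> \<mu> - potential_of \<mu> y) * \<nu> \<Gamma>"
      unfolding swap[symmetric] potential_of_def[of \<nu> y]
      by (rule cint_linear3[OF nu continuous_potential[OF y] continuous_potential_of[OF m(1)]])
    finally show ?thesis by (simp add: algebra_simps)
  qed
  define \<omega>' where "\<omega>' = (\<lambda>X. cnj (\<omega> X))"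
  have om': "\<omega>' \<in> Meas \<Gamma>" unfolding \<omega>'_def by (rule cnj_Meas[OF om])
  have "mu_energy_pairing \<Gamma> \<mu> \<nu> \<omega> =
      cint \<omega>' (\<lambda>y. potential_of \<nu> y + (- \<nu> \<Gamma>) * potential_of \<mu> y + (\<nu> \<Gamma> * form \<mu> \<mu> - form \<nu> \<mu>))"
    unfolding mu_energy_pairing_def \<omega>'_def
    by (rule complex_integral_cong) (simp add: space_borel_on inner)
  also have "\<dots> = cint \<omega>' (potential_of \<nu>) + (- \<nu> \<Gamma>) * cint \<omega>' (potential_of \<mu>) + (\<nu> \<Gamma> * form \<mu> \<mu> - form \<nu> \<mu>) * \<omega>' \<Gamma>"
    by (rule cint_linear3[OF om' continuous_potential_of[OF nu] continuous_potential_of[OF m(1)]])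
  also have "\<dots> = form \<nu> \<omega> - \<nu> \<Gamma> * form \<mu> \<omega> + (\<nu> \<Gamma> * form \<mu> \<mu> - form \<nu> \<mu>) * cnj (\<omega> \<Gamma>)"
    by (simp add: form_def potential_of_def[abs_def] \<omega>'_def)
  also have "\<dots> = form (projection \<mu> \<nu>) (projection \<mu> \<omega>)"
  proof -
    have M: "projection \<mu> \<omega> \<in> Meas \<Gamma>" using projection_Meas0[OF mu om] by (simp add: Meas0_def)
    have "form (projection \<mu> \<nu>) (projection \<mu> \<omega>) = 1 * form \<nu> (projection \<mu> \<omega>) + (- \<nu> \<Gamma>) * form \<mu> (projection \<mu> \<omega>)"
      unfolding projection_def[of \<mu> \<nu>] by (rule form_linear_left[OF nu m(1) M])
    moreover have "form \<nu>' (projection \<mu> \<omega>) = cnj 1 * form \<nu>' \<omega> + cnj (- \<omega> \<Gamma>) * form \<nu>' \<mu>" if "\<nu>' \<in> Meas \<Gamma>" for \<nu>'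
      unfolding projection_def by (rule form_linear_right[OF that om m(1)])
    ultimately show ?thesis using nu m(1) by (simp add: algebra_simps)
  qed
  finally show ?thesis .
qed

lemma energy_pairing_independent:
  assumes mu: "\<mu> \<in> signed_Meas1 \<Gamma>" and "\<nu> \<in> Meas0 \<Gamma>" "\<omega> \<in> Meas0 \<Gamma>"
  shows "mu_energy_pairing \<Gamma> \<mu> \<nu> \<omega> = form \<nu> \<omega>"
  using mu_energy_pairing_eq[OF mu, of \<nu> \<omega>] assms(2,3) by (simp add: Meas0_def projection_def)

lemma signed_Meas1_nonempty: "\<exists>\<mu>. \<mu> \<in> signed_Meas1 \<Gamma>"
proof -
  obtain p where "p \<in> \<Gamma>" using nonempty by blast
  then have "dirac \<Gamma> p \<in> signed_Meas1 \<Gamma>"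
    using dirac_Meas by (auto simp: signed_Meas1_def Meas1_def dirac_def)
  then show ?thesis by blast
qed

lemma energy_pairing_eq:
  assumes "\<nu> \<in> Meas0 \<Gamma>" "\<omega> \<in> Meas0 \<Gamma>"
  shows "energy_pairing \<Gamma> \<nu> \<omega> = form \<nu> \<omega>"
proof -
  have "\<forall>\<mu>\<in>signed_Meas1 \<Gamma>. mu_energy_pairing \<Gamma> \<mu> \<nu> \<omega> = form \<nu> \<omega>"
    using energy_pairing_independent assms by blast
  then show ?thesis unfolding energy_pairing_def
    using signed_Meas1_nonempty by (intro the_equality) auto
qed

lemma projection_eq_zero_iff:
  "projection \<mu> \<nu> = (\<lambda>_. 0) \<longleftrightarrow> \<nu> = (\<lambda>X. \<nu> \<Gamma> * \<mu> X)"
  by (auto simp: projection_def fun_eq_iff add_eq_0_iff)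

lemma form_zero_left: "\<omega> \<in> Meas \<Gamma> \<Longrightarrow> form (\<lambda>_. 0) \<omega> = 0"
  using form_linear_left[of \<omega> \<omega> \<omega> 0 0] by simp

lemma pairing_null_iff:
  assumes mu: "\<mu> \<in> signed_Meas1 \<Gamma>" and nu: "\<nu> \<in> Meas \<Gamma>"
  shows "mu_energy_pairing \<Gamma> \<mu> \<nu> \<nu> = 0 \<longleftrightarrow> \<nu> = (\<lambda>X. \<nu> \<Gamma> * \<mu> X)"
proof -
  have M: "projection \<mu> \<nu> \<in> Meas0 \<Gamma>" by (rule projection_Meas0[OF assms])
  have "mu_energy_pairing \<Gamma> \<mu> \<nu> \<nu> = form (projection \<mu> \<nu>) (projection \<mu> \<nu>)"
    by (rule mu_energy_pairing_eq[OF mu nu nu])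
  then show ?thesis
    using form_definite[OF M] form_zero_left[of "\<lambda>_. 0"] M projection_eq_zero_iff[of \<mu> \<nu>]
    by (auto simp: Meas0_def)
qed

lemma energy_pairing_positive_definite: "positive_definite_on (Meas0 \<Gamma>) (energy_pairing \<Gamma>)"
  unfolding positive_definite_on_def positive_semidefinite_on_def
proof (intro conjI ballI)
  fix \<nu> assume nu: "\<nu> \<in> Meas0 \<Gamma>"
  then have M: "\<nu> \<in> Meas \<Gamma>" by (simp add: Meas0_def)
  show "energy_pairing \<Gamma> \<nu> \<nu> \<in> \<real>" "0 \<le> Re (energy_pairing \<Gamma> \<nu> \<nu>)"
    using form_psd[OF M] by (simp_all add: energy_pairing_eq[OF nu nu])
  show "energy_pairing \<Gamma> \<nu> \<nu> = 0 \<longleftrightarrow> \<nu> = (\<lambda>_. 0)"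
    unfolding energy_pairing_eq[OF nu nu]
    using form_definite[OF nu] form_zero_left[OF M] by blast
qed

lemma mu_energy_pairing_psd:
  assumes "\<mu> \<in> signed_Meas1 \<Gamma>" "\<nu> \<in> Meas \<Gamma>"
  shows "mu_energy_pairing \<Gamma> \<mu> \<nu> \<nu> \<in> \<real>" "0 \<le> Re (mu_energy_pairing \<Gamma> \<mu> \<nu> \<nu>)"
  using form_psd[of "projection \<mu> \<nu>"] projection_Meas0[OF assms]
  by (auto simp: mu_energy_pairing_eq[OF assms(1,2,2)] Meas0_def)

lemma mu_energy_pairing_kernel:
  assumes mu: "\<mu> \<in> signed_Meas1 \<Gamma>"
  shows "pairing_kernel (Meas \<Gamma>) (mu_energy_pairing \<Gamma> \<mu>) = {\<lambda>X. c * \<mu> X | c. True}"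
proof (rule set_eqI, rule iffI)
  fix \<nu> assume "\<nu> \<in> pairing_kernel (Meas \<Gamma>) (mu_energy_pairing \<Gamma> \<mu>)"
  then have "\<nu> \<in> Meas \<Gamma>" "mu_energy_pairing \<Gamma> \<mu> \<nu> \<nu> = 0" by (auto simp: pairing_kernel_def)
  then have "\<nu> = (\<lambda>X. \<nu> \<Gamma> * \<mu> X)" using pairing_null_iff[OF mu] by blast
  then show "\<nu> \<in> {\<lambda>X. c * \<mu> X | c. True}" by blast
next
  note m = signed_Meas1D[OF mu]
  fix \<nu> assume "\<nu> \<in> {\<lambda>X. c * \<mu> X | c. True}"
  then obtain c where c: "\<nu> = (\<lambda>X. c * \<mu> X)" by blast
  then have nu: "\<nu> \<in> Meas \<Gamma>" using combination_Meas[OF m(1) m(1), of c 0] by simp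
  have "projection \<mu> \<nu> = (\<lambda>_. 0)" using projection_eq_zero_iff[of \<mu> \<nu>] c m(2) by simp
  then have "mu_energy_pairing \<Gamma> \<mu> \<nu> \<omega> = 0" if "\<omega> \<in> Meas \<Gamma>" for \<omega>
    using mu_energy_pairing_eq[OF mu nu that] form_zero_left projection_Meas0[OF mu that] by (simp add: Meas0_def)
  then show "\<nu> \<in> pairing_kernel (Meas \<Gamma>) (mu_energy_pairing \<Gamma> \<mu>)" using nu by (simp add: pairing_kernel_def)
qed

lemma energy_minimizer:
  assumes mu: "\<mu> \<in> signed_Meas1 \<Gamma>"
  shows "is_arg_min (\<lambda>\<nu>. Re (energy_integral \<Gamma> \<mu> \<nu>)) (\<lambda>\<nu>. \<nu> \<in> Meas1 \<Gamma>) \<nu> \<longleftrightarrow> \<nu> = \<mu>"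
proof -
  have M1: "\<omega> \<in> Meas \<Gamma> \<and> \<omega> \<Gamma> = 1" if "\<omega> \<in> Meas1 \<Gamma>" for \<omega> using that by (simp add: Meas1_def)
  have mem: "\<mu> \<in> Meas1 \<Gamma>" using mu by (simp add: signed_Meas1_def)
  have nonneg: "0 \<le> Re (energy_integral \<Gamma> \<mu> \<omega>)" if "\<omega> \<in> Meas1 \<Gamma>" for \<omega>
    using mu_energy_pairing_psd(2)[OF mu] M1[OF that] by (simp add: energy_integral_def)
  have zero: "Re (energy_integral \<Gamma> \<mu> \<omega>) = 0 \<longleftrightarrow> \<omega> = \<mu>" if "\<omega> \<in> Meas1 \<Gamma>" for \<omega>
  proof -
    have "Re (energy_integral \<Gamma> \<mu> \<omega>) = 0 \<longleftrightarrow> mu_energy_pairing \<Gamma> \<mu> \<omega> \<omega> = 0"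
      using mu_energy_pairing_psd(1)[OF mu, of \<omega>] M1[OF that]
      by (auto simp: energy_integral_def complex_eq_iff complex_is_Real_iff)
    then show ?thesis using pairing_null_iff[OF mu, of \<omega>] M1[OF that] by simp
  qed
  have zero_mu: "Re (energy_integral \<Gamma> \<mu> \<mu>) = 0" using zero[OF mem] by simp
  show ?thesis
  proof
    assume "is_arg_min (\<lambda>\<nu>. Re (energy_integral \<Gamma> \<mu> \<nu>)) (\<lambda>\<nu>. \<nu> \<in> Meas1 \<Gamma>) \<nu>"
    then have "\<nu> \<in> Meas1 \<Gamma>" "\<not> Re (energy_integral \<Gamma> \<mu> \<mu>) < Re (energy_integral \<Gamma> \<mu> \<nu>)"
      using mem by (auto simp: is_arg_min_def)
    then show "\<nu> = \<mu>" using nonneg[of \<nu>] zero[of \<nu>] zero_mu by linarith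
  next
    assume "\<nu> = \<mu>"
    then show "is_arg_min (\<lambda>\<nu>. Re (energy_integral \<Gamma> \<mu> \<nu>)) (\<lambda>\<nu>. \<nu> \<in> Meas1 \<Gamma>) \<nu>"
      using mem nonneg zero_mu by (fastforce simp: is_arg_min_def)
  qed
qed

end

theorem theorem10p4:
  fixes \<Gamma> :: "'a::metric_space set"
  assumes "metrized_graph \<Gamma>"
  shows
    "(\<forall>\<mu>\<in>signed_Meas1 \<Gamma>. \<forall>\<nu>\<in>Meas0 \<Gamma>. \<forall>\<omega>\<in>Meas0 \<Gamma>.
        mu_energy_pairing \<Gamma> \<mu> \<nu> \<omega> = energy_pairing \<Gamma> \<nu> \<omega>) \<and>
     positive_definite_on (Meas0 \<Gamma>) (energy_pairing \<Gamma>) \<and>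
     (\<forall>\<mu>\<in>signed_Meas1 \<Gamma>.
        positive_semidefinite_on (Meas \<Gamma>) (mu_energy_pairing \<Gamma> \<mu>) \<and>
        pairing_kernel (Meas \<Gamma>) (mu_energy_pairing \<Gamma> \<mu>) = {\<lambda>E. c * \<mu> E | c. True}) \<and>
     (\<forall>\<mu>\<in>signed_Meas1 \<Gamma>.
        (\<forall>\<nu>\<in>Meas1 \<Gamma>. energy_integral \<Gamma> \<mu> \<nu> \<in> \<real>) \<and>
        (\<forall>\<nu>. is_arg_min (\<lambda>\<nu>. Re (energy_integral \<Gamma> \<mu> \<nu>)) (\<lambda>\<nu>. \<nu> \<in> Meas1 \<Gamma>) \<nu> \<longleftrightarrow> \<nu> = \<mu>))"
proof -
  interpret metrized_graph_set \<Gamma> by unfold_locales (rule assms)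
  obtain V E where "arc_system \<Gamma> V E" using arc_system_exists by blast
  then interpret metrized_graph_arcs \<Gamma> V E by unfold_locales
  show ?thesis
  proof (intro conjI ballI allI)
    show "mu_energy_pairing \<Gamma> \<mu> \<nu> \<omega> = energy_pairing \<Gamma> \<nu> \<omega>"
      if "\<mu> \<in> signed_Meas1 \<Gamma>" "\<nu> \<in> Meas0 \<Gamma>" "\<omega> \<in> Meas0 \<Gamma>" for \<mu> \<nu> \<omega>
      using energy_pairing_independent energy_pairing_eq that by simp
    show "positive_definite_on (Meas0 \<Gamma>) (energy_pairing \<Gamma>)" by (rule energy_pairing_positive_definite)
    fix \<mu> assume mu: "\<mu> \<in> signed_Meas1 \<Gamma>"
    show "positive_semidefinite_on (Meas \<Gamma>) (mu_energy_pairing \<Gamma> \<mu>)"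
      unfolding positive_semidefinite_on_def using mu_energy_pairing_psd[OF mu] by blast
    show "pairing_kernel (Meas \<Gamma>) (mu_energy_pairing \<Gamma> \<mu>) = {\<lambda>E. c * \<mu> E | c. True}"
      by (rule mu_energy_pairing_kernel[OF mu])
    show "energy_integral \<Gamma> \<mu> \<nu> \<in> \<real>" if "\<nu> \<in> Meas1 \<Gamma>" for \<nu>
      using mu_energy_pairing_psd(1)[OF mu] that by (simp add: energy_integral_def Meas1_def)
    show "is_arg_min (\<lambda>\<nu>. Re (energy_integral \<Gamma> \<mu> \<nu>)) (\<lambda>\<nu>. \<nu> \<in> Meas1 \<Gamma>) \<nu> \<longleftrightarrow> \<nu> = \<mu>" for \<nu>
      by (rule energy_minimizer[OF mu])
  qed
qed

end
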